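(* Let $\Phi_r$ be a time reparameterization of the flow $\Phi$ with associated function $r$. Let $\mu\in\mathcal{M}(\Phi)$ be hyperbolic and let $r\in L^1(M,\mu)$. For the $\Phi_r$-invariant probability measure $\mu_r$ given by $d\mu_r=\frac{r}{\int_M r\,d\mu}\,d\mu$ we have $$\lambda_i^r(\mu_r)\int_M r\,d\mu=\lambda_i(\mu),\qquad i=1,\dots,\dim M .$$ Therefore, $\mu_r\in\mathcal{M}(\Phi_r)$ is hyperbolic (with respect to $\Phi_r$) if $r$ is positive $\mu$-almost everywhere.
   Context: Setting. $M$ is a manifold of class $C^m$, $m\ge 2$, with a Riemannian metric of class $C^{m-1}$ and induced norm $\|\cdot\|$ on tangent spaces. $f$ is a $C^\ell$ vector field on $M$, $1\le \ell<m$, such that $dx/dt=f(x)$ generates a $C^\ell$ flow $\Phi=\{\varphi^t\}_{t\in\mathbb{R}}$. A $C^\ell$ flow $\Phi_r=\{\varphi^\tau_r\}_{\tau\in\mathbb{R}}$ on $M$ is a time reparameterization of $\Phi$ if for every $x$ the orbits of $x$ under both flows coincide and have the same orientation. Its associated function $r\ge0$ is positive and $C^{\ell-1}$ at every non-fixed point, where $\varphi_r^\tau(x)=\varphi^{t(x,\tau)}(x)$ and $r(x)=\big(\frac{\partial}{\partial\tau}t(x,\tau)|_{\tau=0}\big)^{-1}$. Thus $d\tau=r(x)\,dt$ and $\tau\mapsto\varphi_r^\tau(x)$ solves $dx/d\tau=f(x)/r(x)$. $\mathcal M(\Phi)$ and $\mathcal M(\Phi_r)$ are the sets of Borel probability measures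 on $M$ invariant under $\Phi$ and $\Phi_r$ respectively. Lyapunov exponents. At a Lyapunov regular point $x$ of $\Phi$ (standard Oseledets sense), $\lambda_1(x)\le\cdots\le\lambda_{\dim M}(x)$ denote the Lyapunov exponents $\lim_{t\to\pm\infty}\frac1t\log\|D_x\varphi^t(v)\|$, counted with multiplicity (the dimension of the corresponding subspace of the Oseledets splitting). $\lambda^r_1(x)\le\cdots\le\lambda_{\dim M}^r(x)$ denote those of $\Phi_r$. By the multiplicative ergodic theorem, the Lyapunov regular points of $\Phi$ (resp. $\Phi_r$) are taken to have full measure for every measure in $\mathcal M(\Phi)$ (resp. $\mathcal M(\Phi_r)$). Put $\lambda_i(\mu)=\int_M\lambda_i(x)\,d\mu(x)$ and $\lambda_i^r(\nu)=\int_M\lambda_i^r(x)\,d\nu(x)$ for $\nu\in\mathcal M(\Phi_r)$. A measure $\mu\in\mathcal M(\Phi)$ is hyperbolic if for $\mu$-almost every $x$ there is an index $j(x)$ such that the subspace of the Oseledets splitting corresponding to $\lambda_{j(x)}(x)$ is one-dimensional and is the flow direction $\mathbb{R}f(x)$, and $$\lambda_1(x)\le\cdots\le\lambda_{j(x)-1}(x)<\lambda_{j(x)}(x)=0<\lambda_{j(x)+1}(x)\le\cdots\le\lambda_{\dim M}(x).$$ This includes the case where all exponents other than that of the flow direction are positive, or all are negative. Hyperbolicity with respect to $\Phi_r$ is defined analogously. *)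

theory Defs
  imports "HOL-Analysis.Analysis" "HOL-Probability.Probability"
begin

section \<open>Functions of class C\<open>^k\<close> on an open set\<close>

primrec Ck_on :: "nat \<Rightarrow> ('a::euclidean_space \<Rightarrow> 'b::real_normed_vector) \<Rightarrow> 'a set \<Rightarrow> bool" where
  "Ck_on 0 f S \<longleftrightarrow> continuous_on S f"
| "Ck_on (Suc k) f S \<longleftrightarrow> (\<forall>x\<in>S. f differentiable (at x)) \<and>
     (\<forall>v. Ck_on k (\<lambda>x. frechet_derivative f (at x) v) S)"

section \<open>Manifolds and tangent vectors\<close>

text \<open>
  The points of the manifold form a (Hausdorff, second countable) type; a chart is a pair of a
  domain and a coordinate map into \<open>\<real>\<^sup>n\<close>, where \<open>n = CARD('n)\<close> is the dimension. The structure is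
  given by an atlas, which need not be maximal.
\<close>

type_synonym ('a, 'n) chart = "'a set \<times> ('a \<Rightarrow> real^'n)"

definition chart_inv :: "('a, 'n) chart \<Rightarrow> real^'n \<Rightarrow> 'a" where
  "chart_inv c = inv_into (fst c) (snd c)"

definition is_chart :: "('a::topological_space, 'n::finite) chart \<Rightarrow> bool" where
  "is_chart c \<longleftrightarrow> open (fst c) \<and> open (snd c ` fst c) \<and>
     homeomorphism (fst c) (snd c ` fst c) (snd c) (chart_inv c)"

definition Ck_manifold ::
  "nat \<Rightarrow> ('a::{t2_space,second_countable_topology}, 'n::finite) chart set \<Rightarrow> bool" where
  "Ck_manifold m A \<longleftrightarrow> (\<forall>c\<in>A. is_chart c) \<and> (\<forall>x. \<exists>c\<in>A. x \<in> fst c) \<and>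
     (\<forall>c\<in>A. \<forall>d\<in>A. Ck_on m (\<lambda>u. snd d (chart_inv c u)) (snd c ` (fst c \<inter> fst d)))"

text \<open>
  The tangent space at \<open>x\<close> is \<open>real^'n\<close>: a tangent vector is represented by its coordinates in a
  chart around \<open>x\<close> selected once and for all. \<open>coord_change c d x\<close> turns the coordinates of a
  tangent vector at \<open>x\<close> with respect to \<open>c\<close> into those with respect to \<open>d\<close>.
\<close>

definition chart_at :: "('a, 'n) chart set \<Rightarrow> 'a \<Rightarrow> ('a, 'n) chart" where
  "chart_at A x = (SOME c. c \<in> A \<and> x \<in> fst c)"

definition coord_change ::
  "('a, 'n::finite) chart \<Rightarrow> ('a, 'n) chart \<Rightarrow> 'a \<Rightarrow> real^'n \<Rightarrow> real^'n" where
  "coord_change c d x = frechet_derivative (\<lambda>u. snd d (chart_inv c u)) (at (snd c x))"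

definition tangent_map ::
  "('a, 'n::finite) chart set \<Rightarrow> ('a \<Rightarrow> 'a) \<Rightarrow> 'a \<Rightarrow> real^'n \<Rightarrow> real^'n" where
  "tangent_map A F x =
     frechet_derivative (\<lambda>u. snd (chart_at A (F x)) (F (chart_inv (chart_at A x) u)))
       (at (snd (chart_at A x) x))"

definition Ck_vector_field ::
  "('a, 'n::finite) chart set \<Rightarrow> nat \<Rightarrow> ('a \<Rightarrow> real^'n) \<Rightarrow> bool" where
  "Ck_vector_field A k f \<longleftrightarrow>
     (\<forall>c\<in>A. Ck_on k (\<lambda>u. let y = chart_inv c u in coord_change (chart_at A y) c y (f y))
               (snd c ` fst c))"

section \<open>Riemannian metrics\<close>

definition Ck_riemannian_metric ::
  "('a, 'n::finite) chart set \<Rightarrow> nat \<Rightarrow> ('a \<Rightarrow> real^'n \<Rightarrow> real^'n \<Rightarrow> real) \<Rightarrow> bool" where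
  "Ck_riemannian_metric A k g \<longleftrightarrow>
     (\<forall>x. bilinear (g x) \<and> (\<forall>v w. g x v w = g x w v) \<and> (\<forall>v. v \<noteq> 0 \<longrightarrow> g x v v > 0)) \<and>
     (\<forall>c\<in>A. \<forall>v w. Ck_on k
        (\<lambda>u. let y = chart_inv c u in
           g y (coord_change c (chart_at A y) y v) (coord_change c (chart_at A y) y w))
        (snd c ` fst c))"

definition riem_norm :: "('a \<Rightarrow> real^'n \<Rightarrow> real^'n \<Rightarrow> real) \<Rightarrow> 'a \<Rightarrow> real^'n \<Rightarrow> real" where
  "riem_norm g x v = sqrt (g x v v)"

definition gram :: "('a \<Rightarrow> real^'n \<Rightarrow> real^'n \<Rightarrow> real) \<Rightarrow> 'a \<Rightarrow> real^'n^'n::finite" where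
  "gram g x = (\<chi> i j. g x (axis i 1) (axis j 1))"

text \<open>
  The absolute value of the determinant of a linear map from the tangent space at \<open>x\<close> to the one
  at \<open>y\<close>, taken with respect to orthonormal bases for \<open>g x\<close> and \<open>g y\<close>; passing from the standard
  basis to orthonormal ones produces the Gram determinants.
\<close>

definition riem_det ::
  "('a \<Rightarrow> real^'n \<Rightarrow> real^'n \<Rightarrow> real) \<Rightarrow> 'a \<Rightarrow> 'a \<Rightarrow> (real^'n \<Rightarrow> real^'n::finite) \<Rightarrow> real" where
  "riem_det g x y L = \<bar>det (matrix L)\<bar> * sqrt (det (gram g y)) / sqrt (det (gram g x))"

section \<open>Flows and time reparameterizations\<close>

definition Ck_flow ::
  "('a::topological_space, 'n::finite) chart set \<Rightarrow> nat \<Rightarrow> (real \<Rightarrow> 'a \<Rightarrow> 'a) \<Rightarrow> bool" where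
  "Ck_flow A k \<Phi> \<longleftrightarrow> (\<forall>x. \<Phi> 0 x = x) \<and> (\<forall>s t x. \<Phi> (s + t) x = \<Phi> s (\<Phi> t x)) \<and>
     continuous_on UNIV (\<lambda>(t, x). \<Phi> t x) \<and>
     (\<forall>c\<in>A. \<forall>d\<in>A. Ck_on k (\<lambda>(t, u). snd d (\<Phi> t (chart_inv c u)))
        {(t, u). u \<in> snd c ` fst c \<and> \<Phi> t (chart_inv c u) \<in> fst d})"

definition generates ::
  "('a, 'n::finite) chart set \<Rightarrow> ('a \<Rightarrow> real^'n) \<Rightarrow> (real \<Rightarrow> 'a \<Rightarrow> 'a) \<Rightarrow> bool" where
  "generates A f \<Phi> \<longleftrightarrow>
     (\<forall>x t. ((\<lambda>s. snd (chart_at A (\<Phi> t x)) (\<Phi> s x)) has_vector_derivative f (\<Phi> t x)) (at t))"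

text \<open>
  The relation \<open>\<Psi> \<tau> x = \<Phi> (\<theta> \<tau>) x\<close> alone leaves \<open>\<theta>\<close> undetermined modulo the period when \<open>x\<close> is
  periodic; at a point that is not fixed, continuity and \<open>\<theta> 0 = 0\<close> make it unique.
\<close>

definition time_change ::
  "(real \<Rightarrow> 'a \<Rightarrow> 'a) \<Rightarrow> (real \<Rightarrow> 'a \<Rightarrow> 'a) \<Rightarrow> 'a \<Rightarrow> (real \<Rightarrow> real) \<Rightarrow> bool" where
  "time_change \<Phi> \<Psi> x \<theta> \<longleftrightarrow> \<theta> 0 = 0 \<and> continuous_on UNIV \<theta> \<and> strict_mono \<theta> \<and>
     (\<forall>\<tau>. \<Psi> \<tau> x = \<Phi> (\<theta> \<tau>) x)"

definition time_reparameterization ::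
  "(real \<Rightarrow> 'a \<Rightarrow> 'a) \<Rightarrow> (real \<Rightarrow> 'a \<Rightarrow> 'a) \<Rightarrow> bool" where
  "time_reparameterization \<Phi> \<Psi> \<longleftrightarrow>
     (\<forall>x. range (\<lambda>\<tau>. \<Psi> \<tau> x) = range (\<lambda>t. \<Phi> t x) \<and> (\<exists>\<theta>. time_change \<Phi> \<Psi> x \<theta>))"

definition nonfixed :: "(real \<Rightarrow> 'a \<Rightarrow> 'a) \<Rightarrow> 'a set" where
  "nonfixed \<Phi> = {x. \<exists>t. \<Phi> t x \<noteq> x}"

text \<open>At fixed points the values of the associated function are only required to be nonnegative.\<close>

definition associated_function ::
  "('a, 'n::finite) chart set \<Rightarrow> nat \<Rightarrow> (real \<Rightarrow> 'a \<Rightarrow> 'a) \<Rightarrow> (real \<Rightarrow> 'a \<Rightarrow> 'a) \<Rightarrow>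
     ('a \<Rightarrow> real) \<Rightarrow> bool" where
  "associated_function A l \<Phi> \<Psi> r \<longleftrightarrow>
     (\<forall>x. r x \<ge> 0) \<and>
     (\<forall>x\<in>nonfixed \<Phi>. r x > 0 \<and>
        (\<exists>\<theta> D. time_change \<Phi> \<Psi> x \<theta> \<and> (\<theta> has_real_derivative D) (at 0) \<and> r x = inverse D)) \<and>
     (\<forall>c\<in>A. Ck_on (l - 1) (\<lambda>u. r (chart_inv c u)) (snd c ` (fst c \<inter> nonfixed \<Phi>)))"

definition invariant_measures ::
  "(real \<Rightarrow> 'a \<Rightarrow> 'a::topological_space) \<Rightarrow> 'a measure set" where
  "invariant_measures \<Phi> =
     {\<mu>. prob_space \<mu> \<and> sets \<mu> = sets borel \<and> (\<forall>t. distr \<mu> \<mu> (\<Phi> t) = \<mu>)}"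

definition reparam_measure :: "'a measure \<Rightarrow> ('a \<Rightarrow> real) \<Rightarrow> 'a measure" where
  "reparam_measure \<mu> r = density \<mu> (\<lambda>x. ennreal (r x / (\<integral>y. r y \<partial>\<mu>)))"

section \<open>Lyapunov exponents\<close>

text \<open>
  \<open>\<Lambda>\<close> is the set of distinct exponents at \<open>x\<close>, and \<open>E \<kappa>\<close> is the subspace belonging to
  \<open>\<kappa> \<in> \<Lambda>\<close>; \<open>E\<close> is irrelevant outside \<open>\<Lambda>\<close>. The last condition, that the volume growth
  rate is the sum of the exponents, is part of Lyapunov regularity and prevents the angles between
  the images of the subspaces from decaying exponentially.
\<close>

definition oseledets_splitting ::
  "('a, 'n::finite) chart set \<Rightarrow> ('a \<Rightarrow> real^'n \<Rightarrow> real^'n \<Rightarrow> real) \<Rightarrow> (real \<Rightarrow> 'a \<Rightarrow> 'a) \<Rightarrow> 'a \<Rightarrow>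
     real set \<times> (real \<Rightarrow> (real^'n) set) \<Rightarrow> bool" where
  "oseledets_splitting A g \<Phi> x = (\<lambda>(\<Lambda>, E).
     finite \<Lambda> \<and>
     (\<forall>\<kappa>\<in>\<Lambda>. subspace (E \<kappa>) \<and> E \<kappa> \<noteq> {0}) \<and>
     (\<forall>v. \<exists>!w. w \<in> Pi\<^sub>E \<Lambda> E \<and> v = (\<Sum>\<kappa>\<in>\<Lambda>. w \<kappa>)) \<and>
     (\<forall>F\<in>{at_top, at_bot}.
        (\<forall>\<kappa>\<in>\<Lambda>. \<forall>v\<in>E \<kappa> - {0}.
           ((\<lambda>t. 1 / t * ln (riem_norm g (\<Phi> t x) (tangent_map A (\<Phi> t) x v))) \<longlongrightarrow> \<kappa>) F) \<and>
        ((\<lambda>t. 1 / t * ln (riem_det g x (\<Phi> t x) (tangent_map A (\<Phi> t) x)))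
           \<longlongrightarrow> (\<Sum>\<kappa>\<in>\<Lambda>. \<kappa> * real (dim (E \<kappa>)))) F))"

definition lyapunov_regular ::
  "('a, 'n::finite) chart set \<Rightarrow> ('a \<Rightarrow> real^'n \<Rightarrow> real^'n \<Rightarrow> real) \<Rightarrow> (real \<Rightarrow> 'a \<Rightarrow> 'a) \<Rightarrow> 'a \<Rightarrow>
     bool" where
  "lyapunov_regular A g \<Phi> x \<longleftrightarrow> (\<exists>S. oseledets_splitting A g \<Phi> x S)"

text \<open>At a regular point \<open>\<Lambda>\<close> and the subspaces are unique, so nothing depends on the choice.\<close>

definition splitting_at ::
  "('a, 'n::finite) chart set \<Rightarrow> ('a \<Rightarrow> real^'n \<Rightarrow> real^'n \<Rightarrow> real) \<Rightarrow> (real \<Rightarrow> 'a \<Rightarrow> 'a) \<Rightarrow> 'a \<Rightarrow>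
     real set \<times> (real \<Rightarrow> (real^'n) set)" where
  "splitting_at A g \<Phi> x = (SOME S. oseledets_splitting A g \<Phi> x S)"

definition oseledets_space ::
  "('a, 'n::finite) chart set \<Rightarrow> ('a \<Rightarrow> real^'n \<Rightarrow> real^'n \<Rightarrow> real) \<Rightarrow> (real \<Rightarrow> 'a \<Rightarrow> 'a) \<Rightarrow> 'a \<Rightarrow>
     real \<Rightarrow> (real^'n) set" where
  "oseledets_space A g \<Phi> x = snd (splitting_at A g \<Phi> x)"

text \<open>
  \<open>lyap_exp A g \<Phi> i x\<close>, for \<open>i = 1, \<dots>, n\<close>, is the \<open>i\<close>-th smallest exponent at the regular point
  \<open>x\<close>, each exponent being repeated according to the dimension of its subspace.
\<close>

definition lyap_exp ::
  "('a, 'n::finite) chart set \<Rightarrow> ('a \<Rightarrow> real^'n \<Rightarrow> real^'n \<Rightarrow> real) \<Rightarrow> (real \<Rightarrow> 'a \<Rightarrow> 'a) \<Rightarrow> nat \<Rightarrow>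
     'a \<Rightarrow> real" where
  "lyap_exp A g \<Phi> i x =
     concat (map (\<lambda>\<kappa>. replicate (dim (oseledets_space A g \<Phi> x \<kappa>)) \<kappa>)
       (sorted_list_of_set (fst (splitting_at A g \<Phi> x)))) ! (i - 1)"

text \<open>
  The exponents are defined only almost everywhere, so they are integrated against the completed
  measure, for which the values on null sets are irrelevant.
\<close>

definition mean_lyap_exp ::
  "('a, 'n::finite) chart set \<Rightarrow> ('a \<Rightarrow> real^'n \<Rightarrow> real^'n \<Rightarrow> real) \<Rightarrow> (real \<Rightarrow> 'a \<Rightarrow> 'a) \<Rightarrow> nat \<Rightarrow>
     'a measure \<Rightarrow> real" where
  "mean_lyap_exp A g \<Phi> i \<mu> = (\<integral>x. lyap_exp A g \<Phi> i x \<partial>completion \<mu>)"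

text \<open>The argument \<open>f\<close> is the vector field generating the flow, which gives the flow direction.\<close>

definition hyperbolic ::
  "('a, 'n::finite) chart set \<Rightarrow> ('a \<Rightarrow> real^'n \<Rightarrow> real^'n \<Rightarrow> real) \<Rightarrow> ('a \<Rightarrow> real^'n) \<Rightarrow>
     (real \<Rightarrow> 'a \<Rightarrow> 'a) \<Rightarrow> 'a measure \<Rightarrow> bool" where
  "hyperbolic A g f \<Phi> \<mu> \<longleftrightarrow>
     (AE x in \<mu>. lyapunov_regular A g \<Phi> x \<and>
        (\<exists>j\<in>{1..CARD('n)}.
           dim (oseledets_space A g \<Phi> x (lyap_exp A g \<Phi> j x)) = 1 \<and>
           oseledets_space A g \<Phi> x (lyap_exp A g \<Phi> j x) = span {f x} \<and>
           lyap_exp A g \<Phi> j x = 0 \<and>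
           (\<forall>i\<in>{1..<j}. lyap_exp A g \<Phi> i x < 0) \<and>
           (\<forall>i\<in>{j<..CARD('n)}. lyap_exp A g \<Phi> i x > 0)))"

end

theory Submission
  imports Defs
begin

text \<open>
  Off the fixed points \<open>\<Psi>\<close> follows the orbits of \<open>\<Phi>\<close>: at the time \<open>S x t\<close>, the integral of \<open>r\<close> along
  the orbit from \<open>0\<close> to \<open>t\<close>, it has reached \<open>\<Phi> t x\<close>. By Birkhoff's theorem \<open>S x t / t\<close> converges almost
  everywhere to some \<open>\<rho> x > 0\<close>, the conditional expectation of \<open>r\<close> on the invariant sets. The tangent
  maps of the two flows at these times agree modulo the flow direction, so vectors have the same growth
  modulo that direction, and the determinant condition in Lyapunov regularity makes this growth
  determine the exponents (Hadamard's inequality). The flow direction itself has exponent \<open>0\<close> for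
  \<open>\<Psi>\<close> as well, because \<open>ln r\<close> along an orbit grows sublinearly in measure. Hence the exponents of
  \<open>\<Phi>\<close> are \<open>\<rho>\<close> times those of \<open>\<Psi>\<close>, and integrating the invariant functions \<open>\<lambda>\<^sup>r\<close> against \<open>\<rho> \<mu>\<close> is the
  same as integrating them against \<open>r \<mu>\<close>.
\<close>

section \<open>Birkhoff averages\<close>

text \<open>Two gaps in regularity shape the argument. For \<open>l = 1\<close> the function
  \<open>r\<close> is only continuous, so \<open>clock x \<tau>\<close> cannot be differentiated in
  \<open>x\<close> through an integral. Only its continuity in \<open>x\<close> is available, and
  the comparison of the tangent maps is extracted from difference quotients by compactness. The
  component in the flow direction stays uncontrolled, which is why growth is measured in the
  quotient by this direction and the volume condition has to supply the lost information. Secondly,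
  \<open>ln r\<close> need not be integrable, so pointwise sublinear growth along orbits is out of
  reach. Convergence in measure is enough because regularity of both flows already provides a limit
  of \<open>ln (r (\<Phi> n x)) / n\<close>, which then has to be \<open>0\<close>. Finally, the
  exponents are not known to be measurable or integrable. The means are Bochner integrals with
  default value \<open>0\<close>, so the identity of means also needs that both sides degenerate
  together.\<close>

definition birkhoff_sum :: "('a \<Rightarrow> 'a) \<Rightarrow> ('a \<Rightarrow> real) \<Rightarrow> nat \<Rightarrow> 'a \<Rightarrow> real" where
  "birkhoff_sum T f n x = (\<Sum>k<n. f ((T ^^ k) x))"

lemma birkhoff_sum_0 [simp]: "birkhoff_sum T f 0 x = 0"
  by (simp add: birkhoff_sum_def)

lemma birkhoff_sum_Suc: "birkhoff_sum T f (Suc n) x = f x + birkhoff_sum T f n (T x)"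
  by (simp add: birkhoff_sum_def sum.lessThan_Suc_shift funpow_swap1 del: sum.lessThan_Suc)

lemma birkhoff_sum_uminus: "birkhoff_sum T (\<lambda>x. - f x) n x = - birkhoff_sum T f n x"
  by (simp add: birkhoff_sum_def sum_negf)

lemma birkhoff_sum_diff_const:
  "birkhoff_sum T (\<lambda>x. f x - b) n x = birkhoff_sum T f n x - real n * b"
  by (simp add: birkhoff_sum_def sum_subtractf)

lemma birkhoff_sum_nonneg: "(\<And>x. 0 \<le> f x) \<Longrightarrow> 0 \<le> birkhoff_sum T f n x"
  by (simp add: birkhoff_sum_def sum_nonneg)

text \<open>The maximum of the sums over \<open>0, \<dots>, n\<close> steps, the empty sum included.
  The recursive form is the identity on which Garsia's proof of the maximal inequality
  rests.\<close>

primrec max_birkhoff_sum :: "('a \<Rightarrow> 'a) \<Rightarrow> ('a \<Rightarrow> real) \<Rightarrow> nat \<Rightarrow> 'a \<Rightarrow> real" where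
  "max_birkhoff_sum T f 0 x = 0"
| "max_birkhoff_sum T f (Suc n) x = max 0 (f x + max_birkhoff_sum T f n (T x))"

lemma max_birkhoff_sum_nonneg: "0 \<le> max_birkhoff_sum T f n x"
  by (cases n) auto

lemma birkhoff_sum_le_max: "birkhoff_sum T f n x \<le> max_birkhoff_sum T f n x"
proof (induction n arbitrary: x)
  case (Suc n)
  show ?case using Suc[of "T x"] by (simp add: birkhoff_sum_Suc)
qed simp

lemma max_birkhoff_sum_mono: "max_birkhoff_sum T f n x \<le> max_birkhoff_sum T f (Suc n) x"
proof (induction n arbitrary: x)
  case (Suc n)
  show ?case using Suc[of "T x"] by (simp add: max_def)
qed simp

text \<open>Stands in for a threshold set of the upper limit of the averages: for
  \<open>f - b\<close> it contains every point whose upper limit exceeds \<open>b\<close> and none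
  whose upper limit is below \<open>b\<close>. It is expressed through finite sums alone, and one
  step along the orbit changes them only by \<open>f x\<close>, which makes the set exactly
  invariant.\<close>

definition unbounded_sums :: "('a \<Rightarrow> 'a) \<Rightarrow> ('a \<Rightarrow> real) \<Rightarrow> 'a set" where
  "unbounded_sums T f = {x. \<forall>K. \<exists>n. K < birkhoff_sum T f n x}"

lemma unbounded_sums_nat: "x \<in> unbounded_sums T f \<longleftrightarrow> (\<forall>K::nat. \<exists>n. real K < birkhoff_sum T f n x)"
  unfolding unbounded_sums_def
proof safe
  fix K :: real assume *: "\<forall>K::nat. \<exists>n. real K < birkhoff_sum T f n x"
  obtain N :: nat where "K < real N" using reals_Archimedean2 by blast
  with * show "\<exists>n. K < birkhoff_sum T f n x" by (meson less_trans)
qed auto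

lemma unbounded_sums_invariant: "T x \<in> unbounded_sums T f \<longleftrightarrow> x \<in> unbounded_sums T f"
proof
  assume *: "T x \<in> unbounded_sums T f"
  show "x \<in> unbounded_sums T f"
    unfolding unbounded_sums_def
  proof safe
    fix K
    obtain n where "K - f x < birkhoff_sum T f n (T x)"
      using * by (auto simp: unbounded_sums_def)
    then show "\<exists>n. K < birkhoff_sum T f n x"
      by (intro exI[of _ "Suc n"]) (simp add: birkhoff_sum_Suc)
  qed
next
  assume *: "x \<in> unbounded_sums T f"
  show "T x \<in> unbounded_sums T f"
    unfolding unbounded_sums_def
  proof safe
    fix K
    \<comment> \<open>The maximum with \<open>0\<close> rules out \<open>n = 0\<close>, where the
      sum vanishes.\<close>
    obtain n where n: "max 0 (K + f x) < birkhoff_sum T f n x"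
      using * unfolding unbounded_sums_def by blast
    then obtain m where "n = Suc m" by (cases n) auto
    with n show "\<exists>n. K < birkhoff_sum T f n (T x)"
      by (intro exI[of _ m]) (simp add: birkhoff_sum_Suc)
  qed
qed

lemma unbounded_sums_pos: "x \<in> unbounded_sums T f \<Longrightarrow> \<exists>n. 0 < birkhoff_sum T f n x"
  by (simp add: unbounded_sums_def)

locale measure_preserving_map = prob_space +
  fixes T :: "'a \<Rightarrow> 'a"
  assumes measurable_T [measurable]: "T \<in> M \<rightarrow>\<^sub>M M"
    and distr_T: "distr M M T = M"
begin

lemma null_sets_measure_le:
  assumes "A \<in> sets M" "measure M A \<le> 0" shows "A \<in> null_sets M"
  using assms by (simp add: measure_le_0_iff emeasure_eq_measure null_sets_def)

lemma measurable_funpow [measurable]: "(T ^^ k) \<in> M \<rightarrow>\<^sub>M M"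
  by (induction k) auto

lemma distr_funpow: "distr M M (T ^^ k) = M"
proof (induction k)
  case 0
  show ?case by (simp add: id_def distr_id)
next
  case (Suc k)
  have "distr M M (T ^^ Suc k) = distr (distr M M (T ^^ k)) M T"
    by (simp add: distr_distr)
  also have "\<dots> = M" by (simp only: Suc distr_T)
  finally show ?case .
qed

lemma nn_integral_funpow:
  assumes [measurable]: "f \<in> borel_measurable M"
  shows "(\<integral>\<^sup>+x. f ((T ^^ k) x) \<partial>M) = (\<integral>\<^sup>+x. f x \<partial>M)"
  using nn_integral_distr[OF measurable_funpow, of f k] by (simp add: distr_funpow)

lemma nn_integral_T:
  assumes "f \<in> borel_measurable M"
  shows "(\<integral>\<^sup>+x. f (T x) \<partial>M) = (\<integral>\<^sup>+x. f x \<partial>M)"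
  using nn_integral_funpow[OF assms, of 1] by simp

lemma integrable_T:
  fixes f :: "'a \<Rightarrow> real"
  assumes "integrable M f" shows "integrable M (\<lambda>x. f (T x))"
  using integrable_distr[OF measurable_T, of f] assms by (simp add: distr_T)

lemma integral_T:
  fixes f :: "'a \<Rightarrow> real"
  assumes "f \<in> borel_measurable M" shows "(\<integral>x. f (T x) \<partial>M) = (\<integral>x. f x \<partial>M)"
  using integral_distr[OF measurable_T, of f] assms by (simp add: distr_T)

lemma AE_funpow:
  assumes "AE x in M. P x" shows "AE x in M. P ((T ^^ k) x)"
  by (rule AE_distrD[OF measurable_funpow[of k], unfolded distr_funpow, OF assms])

lemma measurable_birkhoff_sum [measurable (raw)]:
  assumes [measurable]: "f \<in> borel_measurable M"
  shows "birkhoff_sum T f n \<in> borel_measurable M"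
  unfolding birkhoff_sum_def[abs_def] by measurable

lemma measurable_max_birkhoff_sum [measurable (raw)]:
  assumes [measurable]: "f \<in> borel_measurable M"
  shows "max_birkhoff_sum T f n \<in> borel_measurable M"
proof (induction n)
  case (Suc n)
  note [measurable] = Suc
  show ?case unfolding max_birkhoff_sum.simps(2)[abs_def] by measurable
qed simp

lemma integrable_max_birkhoff_sum:
  assumes "integrable M f" shows "integrable M (max_birkhoff_sum T f n)"
proof (induction n)
  case (Suc n)
  have "integrable M (\<lambda>x. f x + max_birkhoff_sum T f n (T x))"
    by (rule Bochner_Integration.integrable_add[OF assms integrable_T[OF Suc]])
  then show ?case unfolding max_birkhoff_sum.simps(2)[abs_def] by (intro integrable_max) auto
qed simp

lemma unbounded_sums_sets:
  assumes [measurable]: "f \<in> borel_measurable M"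
  shows "unbounded_sums T f \<inter> space M \<in> sets M"
proof -
  have "unbounded_sums T f \<inter> space M = {x \<in> space M. \<forall>K::nat. \<exists>n. real K < birkhoff_sum T f n x}"
    by (auto simp: unbounded_sums_nat)
  also have "\<dots> \<in> sets M" by measurable
  finally show ?thesis .
qed

text \<open>Garsia's argument: where \<open>max_birkhoff_sum T f (Suc m)\<close> is positive it
  equals \<open>f\<close> plus \<open>max_birkhoff_sum T f m\<close> after one step, and elsewhere
  its difference to the latter is nonpositive. After integration, invariance removes the shift and
  monotonicity in \<open>m\<close> gives the sign.\<close>

lemma maximal_ergodic_inequality:
  assumes f: "integrable M f"
  shows "0 \<le> (\<integral>x. f x * indicator {x. 0 < max_birkhoff_sum T f n x} x \<partial>M)"
proof (cases n)
  case (Suc m)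
  have [measurable]: "f \<in> borel_measurable M" using f by auto
  let ?P = "{x. 0 < max_birkhoff_sum T f (Suc m) x}"
  let ?M = "\<lambda>n. max_birkhoff_sum T f n"
  have I: "integrable M (?M n)" for n by (rule integrable_max_birkhoff_sum[OF f])
  have "0 \<le> (\<integral>x. ?M (Suc m) x \<partial>M) - (\<integral>x. ?M m x \<partial>M)"
    using integral_mono[OF I[of m] I[of "Suc m"] max_birkhoff_sum_mono] by simp
  also have "\<dots> = (\<integral>x. ?M (Suc m) x \<partial>M) - (\<integral>x. ?M m (T x) \<partial>M)"
    using integral_T[of "?M m"] by simp
  also have "\<dots> = (\<integral>x. ?M (Suc m) x - ?M m (T x) \<partial>M)"
    by (rule Bochner_Integration.integral_diff[symmetric, OF I integrable_T[OF I]])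
  also have "\<dots> \<le> (\<integral>x. f x * indicator ?P x \<partial>M)"
  proof (rule integral_mono)
    show "integrable M (\<lambda>x. ?M (Suc m) x - ?M m (T x))"
      by (rule Bochner_Integration.integrable_diff[OF I integrable_T[OF I]])
    show "integrable M (\<lambda>x. f x * indicator ?P x)"
      by (rule Bochner_Integration.integrable_bound[OF f])
         (measurable, auto simp: indicator_def)
    fix x
    show "?M (Suc m) x - ?M m (T x) \<le> f x * indicator ?P x"
      using max_birkhoff_sum_nonneg[of T f m "T x"] by (auto simp: indicator_def max_def)
  qed
  finally show ?thesis by (simp only: Suc)
qed simp

text \<open>The maximal inequality is applied to \<open>f\<close> cut off outside \<open>B\<close>.
  The sets where the maxima are positive exhaust \<open>B\<close>, so dominated convergence lets
  \<open>n\<close> tend to infinity.\<close>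

lemma integral_invariant_nonneg:
  assumes f: "integrable M f" and B: "B \<inter> space M \<in> sets M"
    and inv: "\<And>x. T x \<in> B \<longleftrightarrow> x \<in> B"
    and pos: "\<And>x. x \<in> B \<Longrightarrow> \<exists>n. 0 < birkhoff_sum T f n x"
  shows "0 \<le> (\<integral>x. f x * indicator B x \<partial>M)"
proof -
  have [measurable]: "f \<in> borel_measurable M" using f by auto
  have [measurable]: "(indicator B :: 'a \<Rightarrow> real) \<in> borel_measurable M"
    using B by (simp add: borel_measurable_indicator_iff)
  let ?g = "\<lambda>x. f x * indicator B x :: real"
  have g: "integrable M ?g"
    by (rule Bochner_Integration.integrable_bound[OF f]) (measurable, auto simp: indicator_def)
  \<comment> \<open>Orbits starting in \<open>B\<close> stay in \<open>B\<close>, so the cut-off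
    does not change their sums.\<close>
  have bs: "birkhoff_sum T f n x = birkhoff_sum T ?g n x" if "x \<in> B" for n x
    using that
  proof (induction n arbitrary: x)
    case (Suc n)
    then show ?case using Suc.IH[of "T x"] by (simp add: birkhoff_sum_Suc inv)
  qed simp
  let ?h = "\<lambda>n x. ?g x * indicator {x. 0 < max_birkhoff_sum T ?g n x} x"
  have "(\<lambda>n. \<integral>x. ?h n x \<partial>M) \<longlonglongrightarrow> (\<integral>x. ?g x \<partial>M)"
  proof (rule integral_dominated_convergence[where w = "\<lambda>x. norm (f x)"])
    show "AE x in M. (\<lambda>n. ?h n x) \<longlonglongrightarrow> ?g x"
    proof (intro AE_I2)
      fix x
      show "(\<lambda>n. ?h n x) \<longlonglongrightarrow> ?g x"
      proof (cases "x \<in> B")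
        case True
        then obtain n where "0 < birkhoff_sum T f n x" using pos by blast
        then have "0 < birkhoff_sum T ?g n x" by (simp only: bs[OF True])
        then have n: "0 < max_birkhoff_sum T ?g n x"
          by (rule less_le_trans[OF _ birkhoff_sum_le_max])
        have "0 < max_birkhoff_sum T ?g m x" if "m \<ge> n" for m
          using that
        proof (induction m rule: dec_induct)
          case (step m)
          then show ?case using max_birkhoff_sum_mono[of T ?g m x] by linarith
        qed (use n in simp)
        then have "\<forall>\<^sub>F m in sequentially. ?h m x = ?g x"
          by (intro eventually_sequentiallyI[of n]) (simp add: indicator_def)
        then show ?thesis by (rule tendsto_eventually)
      qed simp
    qed
    show "integrable M (\<lambda>x. norm (f x))" using f by simp
    show "AE x in M. norm (?h n x) \<le> norm (f x)" for n by (auto simp: indicator_def)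
  qed measurable
  then show ?thesis
    by (rule LIMSEQ_le_const) (use maximal_ergodic_inequality[OF g] in auto)
qed

text \<open>A Markov bound obtained from the sign inequality on the invariant set
  \<open>?U b\<close>: its measure is at most the integral of \<open>\<bar>f x\<bar>\<close> divided
  by \<open>b\<close>. This keeps the upper limit of the averages finite.\<close>

lemma AE_bounded_sums:
  assumes f: "integrable M f"
  shows "AE x in M. \<exists>b. x \<notin> unbounded_sums T (\<lambda>x. f x - b)"
proof -
  have [measurable]: "f \<in> borel_measurable M" using f by auto
  let ?U = "\<lambda>b. unbounded_sums T (\<lambda>x. f x - b) \<inter> space M"
  have U: "?U b \<in> sets M" for b by (rule unbounded_sums_sets) measurable
  have le: "measure M (?U b) \<le> (\<integral>x. \<bar>f x\<bar> \<partial>M) / b" if "b > 0" for b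
  proof -
    have I: "integrable M (\<lambda>x. f x * indicator (?U b) x)"
      by (rule Bochner_Integration.integrable_bound[OF f]) (use U in measurable, auto simp: indicator_def)
    have J: "integrable M (indicator (?U b) :: _ \<Rightarrow> real)"
      using U emeasure_finite[of "?U b"] by (simp add: integrable_indicator_iff less_top[symmetric])
    have "0 \<le> (\<integral>x. (f x - b) * indicator (unbounded_sums T (\<lambda>x. f x - b)) x \<partial>M)"
      by (rule integral_invariant_nonneg)
         (use f U in \<open>auto simp: unbounded_sums_invariant unbounded_sums_pos\<close>)
    also have "\<dots> = (\<integral>x. f x * indicator (?U b) x - b * indicator (?U b) x \<partial>M)"
      by (rule Bochner_Integration.integral_cong) (auto simp: indicator_def)
    also have "\<dots> = (\<integral>x. f x * indicator (?U b) x \<partial>M) - b * measure M (?U b)"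
      using I J U by (subst Bochner_Integration.integral_diff) auto
    also have "(\<integral>x. f x * indicator (?U b) x \<partial>M) \<le> (\<integral>x. \<bar>f x\<bar> \<partial>M)"
      by (rule integral_mono) (use I f in \<open>auto simp: indicator_def\<close>)
    finally show ?thesis using that by (simp add: field_simps)
  qed
  let ?N = "\<Inter>k::nat. ?U (real (Suc k))"
  have N: "?N \<in> sets M" by (rule sets.countable_INT) (use U in auto)
  have "measure M ?N \<le> (\<integral>x. \<bar>f x\<bar> \<partial>M) / real (Suc k)" for k
  proof -
    have "measure M ?N \<le> measure M (?U (real (Suc k)))"
      by (rule finite_measure_mono) (use U in auto)
    also have "\<dots> \<le> (\<integral>x. \<bar>f x\<bar> \<partial>M) / real (Suc k)" by (rule le) simp
    finally show ?thesis .
  qed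
  moreover have "(\<lambda>k. (\<integral>x. \<bar>f x\<bar> \<partial>M) / real (Suc k)) \<longlonglongrightarrow> 0"
    by (intro LIMSEQ_Suc lim_const_over_n)
  ultimately have "measure M ?N \<le> 0" by (intro LIMSEQ_le_const) auto
  with N have null: "?N \<in> null_sets M" by (rule null_sets_measure_le)
  show ?thesis
  proof (rule AE_I'[OF null], rule subsetI)
    fix x assume "x \<in> {x \<in> space M. \<not> (\<exists>b. x \<notin> unbounded_sums T (\<lambda>x. f x - b))}"
    then have "x \<in> ?U b" for b by simp
    then show "x \<in> ?N" by (intro INT_I)
  qed
qed

text \<open>On the invariant set \<open>?D\<close> the sign inequality applies to both
  \<open>a - f\<close> and \<open>f - b\<close>, which forces
  \<open>b * measure M ?D \<le> a * measure M ?D\<close>.\<close>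

lemma AE_no_crossing:
  assumes f: "integrable M f" and "a < b"
  shows "AE x in M. x \<notin> unbounded_sums T (\<lambda>x. a - f x) \<inter> unbounded_sums T (\<lambda>x. f x - b)"
proof -
  have [measurable]: "f \<in> borel_measurable M" using f by auto
  let ?C = "unbounded_sums T (\<lambda>x. a - f x) \<inter> unbounded_sums T (\<lambda>x. f x - b)"
  let ?D = "?C \<inter> space M"
  have AB: "unbounded_sums T (\<lambda>x. a - f x) \<inter> space M \<in> sets M"
    "unbounded_sums T (\<lambda>x. f x - b) \<inter> space M \<in> sets M"
    by (rule unbounded_sums_sets; measurable)+
  moreover have "?D = (unbounded_sums T (\<lambda>x. a - f x) \<inter> space M)
      \<inter> (unbounded_sums T (\<lambda>x. f x - b) \<inter> space M)" by (simp add: Int_ac)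
  ultimately have D: "?D \<in> sets M" by simp
  have J: "integrable M (indicator ?D :: _ \<Rightarrow> real)"
    using D emeasure_finite[of ?D] by (simp add: integrable_indicator_iff less_top[symmetric])
  have I: "integrable M (\<lambda>x. f x * indicator ?D x)"
    by (rule Bochner_Integration.integrable_bound[OF f]) (use D in measurable, auto simp: indicator_def)
  have "0 \<le> (\<integral>x. (a - f x) * indicator ?C x \<partial>M)"
    by (rule integral_invariant_nonneg)
       (use f D in \<open>auto simp: unbounded_sums_invariant unbounded_sums_pos intro!: unbounded_sums_pos\<close>)
  also have "\<dots> = (\<integral>x. a * indicator ?D x - f x * indicator ?D x \<partial>M)"
    by (rule Bochner_Integration.integral_cong) (auto simp: indicator_def)
  also have "\<dots> = a * measure M ?D - (\<integral>x. f x * indicator ?D x \<partial>M)"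
    using I J D by (subst Bochner_Integration.integral_diff) auto
  finally have 1: "(\<integral>x. f x * indicator ?D x \<partial>M) \<le> a * measure M ?D" by simp
  have "0 \<le> (\<integral>x. (f x - b) * indicator ?C x \<partial>M)"
    by (rule integral_invariant_nonneg)
       (use f D in \<open>auto simp: unbounded_sums_invariant unbounded_sums_pos intro!: unbounded_sums_pos\<close>)
  also have "\<dots> = (\<integral>x. f x * indicator ?D x - b * indicator ?D x \<partial>M)"
    by (rule Bochner_Integration.integral_cong) (auto simp: indicator_def)
  also have "\<dots> = (\<integral>x. f x * indicator ?D x \<partial>M) - b * measure M ?D"
    using I J D by (subst Bochner_Integration.integral_diff) auto
  finally have "(b - a) * measure M ?D \<le> 0" using 1 by (simp add: algebra_simps)
  with \<open>a < b\<close> have "measure M ?D \<le> 0" by (simp add: mult_le_0_iff)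
  with D have "?D \<in> null_sets M" by (rule null_sets_measure_le)
  then show ?thesis by (rule AE_I') (simp add: subset_iff)
qed

lemma average_upper_bound:
  assumes "x \<notin> unbounded_sums T (\<lambda>x. f x - b)"
  shows "limsup (\<lambda>n. ereal (birkhoff_sum T f n x / real n)) \<le> ereal b"
proof -
  obtain K where K: "birkhoff_sum T f n x - real n * b \<le> K" for n
    using assms unfolding unbounded_sums_def birkhoff_sum_diff_const by (auto simp: not_less)
  have lim: "(\<lambda>n. ereal (b + K / real n)) \<longlonglongrightarrow> ereal b"
    using tendsto_add[OF tendsto_const lim_const_over_n[of K], of b] by simp
  have "limsup (\<lambda>n. ereal (birkhoff_sum T f n x / real n)) \<le> limsup (\<lambda>n. ereal (b + K / real n))"
  proof (intro Limsup_mono eventually_sequentiallyI[of 1])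
    fix n :: nat assume "1 \<le> n"
    then show "ereal (birkhoff_sum T f n x / real n) \<le> ereal (b + K / real n)"
      using K[of n] by (simp add: field_simps)
  qed
  also have "\<dots> = ereal b" using lim by (rule lim_imp_Limsup[OF sequentially_bot])
  finally show ?thesis .
qed

lemma average_lower_bound:
  assumes "x \<notin> unbounded_sums T (\<lambda>x. a - f x)"
  shows "ereal a \<le> liminf (\<lambda>n. ereal (birkhoff_sum T f n x / real n))"
proof -
  have "limsup (\<lambda>n. ereal (birkhoff_sum T (\<lambda>x. - f x) n x / real n)) \<le> ereal (- a)"
    by (rule average_upper_bound) (use assms in \<open>simp add: algebra_simps\<close>)
  then have "limsup (\<lambda>n. - ereal (birkhoff_sum T f n x / real n)) \<le> - ereal a"
    by (simp add: birkhoff_sum_uminus)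
  then show ?thesis by (simp only: ereal_Limsup_uminus ereal_minus_le_minus)
qed

text \<open>A gap between the lower and the upper limit would contain two rationals
  \<open>a < b\<close>, and all such pairs are excluded at once because they are countable. The
  bounds for \<open>f\<close> and \<open>- f\<close> make the common limit finite.\<close>

theorem birkhoff_convergent:
  assumes f: "integrable M f"
  shows "AE x in M. convergent (\<lambda>n. birkhoff_sum T f n x / real n)"
proof -
  have 1: "AE x in M. \<forall>a b :: rat. a < b \<longrightarrow>
      x \<notin> unbounded_sums T (\<lambda>x. of_rat a - f x) \<inter> unbounded_sums T (\<lambda>x. f x - of_rat b)"
    unfolding AE_all_countable using AE_no_crossing[OF f] by (simp add: of_rat_less)
  have 2: "AE x in M. \<exists>b. x \<notin> unbounded_sums T (\<lambda>x. f x - b)" by (rule AE_bounded_sums[OF f])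
  have "integrable M (\<lambda>x. - f x)" using f by simp
  then have 3: "AE x in M. \<exists>b. x \<notin> unbounded_sums T (\<lambda>x. - f x - b)" by (rule AE_bounded_sums)
  from 1 2 3 show ?thesis
  proof eventually_elim
    case (elim x)
    let ?A = "\<lambda>n. ereal (birkhoff_sum T f n x / real n)"
    from elim(2) obtain b where b: "limsup ?A \<le> ereal b" using average_upper_bound by blast
    from elim(3) obtain c where "x \<notin> unbounded_sums T (\<lambda>x. - f x - c)" by blast
    moreover have "(\<lambda>x. - f x - c) = (\<lambda>x. - c - f x)" by auto
    ultimately have "x \<notin> unbounded_sums T (\<lambda>x. - c - f x)" by simp
    then have c: "ereal (- c) \<le> liminf ?A" by (rule average_lower_bound)
    have le: "liminf ?A \<le> limsup ?A" by (simp add: Liminf_le_Limsup)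
    have "limsup ?A \<le> liminf ?A"
    proof (rule ccontr)
      assume "\<not> limsup ?A \<le> liminf ?A"
      then have "liminf ?A < limsup ?A" by simp
      then obtain p where p: "liminf ?A < ereal p" "ereal p < limsup ?A"
        using ereal_dense2 by blast
      obtain q where q: "ereal p < ereal q" "ereal q < limsup ?A"
        using ereal_dense2[OF p(2)] by blast
      obtain a' where a': "a' \<in> \<rat>" "p < a'" "a' < q" using Rats_dense_in_real[of p q] q by auto
      obtain b' where b': "b' \<in> \<rat>" "a' < b'" "b' < q" using Rats_dense_in_real[of a' q] a' by auto
      obtain a1 b1 :: rat where ab: "a' = of_rat a1" "b' = of_rat b1"
        using a'(1) b'(1) by (auto elim!: Rats_cases)
      then have "a1 < b1" using b'(2) by (simp add: of_rat_less)
      with elim(1) ab consider "x \<notin> unbounded_sums T (\<lambda>x. a' - f x)"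
        | "x \<notin> unbounded_sums T (\<lambda>x. f x - b')" by blast
      then show False
      proof cases
        case 1
        then have "ereal a' \<le> liminf ?A" by (rule average_lower_bound)
        from le_less_trans[OF this p(1)] a'(2) show False by simp
      next
        case 2
        then have "limsup ?A \<le> ereal b'" by (rule average_upper_bound)
        from less_le_trans[OF q(2) this] b'(3) show False by simp
      qed
    qed
    with le have eq: "liminf ?A = limsup ?A" by simp
    have fin: "\<bar>limsup ?A\<bar> \<noteq> \<infinity>" using b c eq by (cases "limsup ?A") auto
    then obtain L where L: "limsup ?A = ereal L" by (cases "limsup ?A") auto
    have "(\<lambda>n. birkhoff_sum T f n x / real n) \<longlonglongrightarrow> L"
      by (rule limsup_le_liminf_real) (use L eq in auto)
    then show ?case by (rule convergentI)
  qed
qed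

end

section \<open>Integrals of Birkhoff limits against invariant functions\<close>

context measure_preserving_map
begin

lemma nn_integral_birkhoff_average:
  fixes R h :: "'a \<Rightarrow> real"
  assumes [measurable]: "R \<in> borel_measurable M" "h \<in> borel_measurable M"
    and R: "\<And>x. 0 \<le> R x" and h: "\<And>x. 0 \<le> h x"
    and inv: "AE x in M. h (T x) = h x" and "n > 0"
  shows "(\<integral>\<^sup>+x. ennreal (h x) * ennreal (birkhoff_sum T R n x / real n) \<partial>M)
    = (\<integral>\<^sup>+x. ennreal (h x) * ennreal (R x) \<partial>M)"
proof -
  let ?I = "\<integral>\<^sup>+x. ennreal (h x) * ennreal (R x) \<partial>M"
  have inv_k: "AE x in M. h ((T ^^ k) x) = h x" for k
  proof (induction k)
    case (Suc k)
    from Suc AE_funpow[OF inv, of k] show ?case by eventually_elim simp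
  qed simp
  have k: "(\<integral>\<^sup>+x. ennreal (h x) * ennreal (R ((T ^^ k) x)) \<partial>M) = ?I" for k
  proof -
    have "(\<integral>\<^sup>+x. ennreal (h x) * ennreal (R ((T ^^ k) x)) \<partial>M)
        = (\<integral>\<^sup>+x. ennreal (h ((T ^^ k) x)) * ennreal (R ((T ^^ k) x)) \<partial>M)"
      by (rule nn_integral_cong_AE) (use inv_k[of k] in eventually_elim, simp)
    also have "\<dots> = ?I"
      by (rule nn_integral_funpow[of "\<lambda>x. ennreal (h x) * ennreal (R x)"]) measurable
    finally show ?thesis .
  qed
  have "(\<integral>\<^sup>+x. ennreal (h x) * ennreal (birkhoff_sum T R n x / real n) \<partial>M)
      = (\<integral>\<^sup>+x. ennreal (1 / real n) * (\<Sum>k<n. ennreal (h x) * ennreal (R ((T ^^ k) x))) \<partial>M)"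
  proof (rule nn_integral_cong)
    fix x
    have "ennreal (birkhoff_sum T R n x / real n)
        = ennreal (1 / real n) * (\<Sum>k<n. ennreal (R ((T ^^ k) x)))"
      using R by (simp add: birkhoff_sum_def sum_nonneg flip: ennreal_mult)
    then show "ennreal (h x) * ennreal (birkhoff_sum T R n x / real n)
        = ennreal (1 / real n) * (\<Sum>k<n. ennreal (h x) * ennreal (R ((T ^^ k) x)))"
      by (simp add: sum_distrib_left mult_ac)
  qed
  also have "\<dots> = ennreal (1 / real n) * (\<Sum>k<n. ?I)"
    by (subst nn_integral_cmult, measurable) (simp add: nn_integral_sum k)
  also have "\<dots> = ennreal (1 / real n) * ennreal (real n) * ?I"
    by (simp add: mult.assoc ennreal_of_nat_eq_real_of_nat)
  also have "ennreal (1 / real n) * ennreal (real n) = 1"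
    using \<open>n > 0\<close> by (simp flip: ennreal_mult)
  finally show ?thesis by simp
qed

lemma tendsto_nn_integral_excess:
  fixes R :: "'a \<Rightarrow> real"
  assumes R: "integrable M R" and pos: "\<And>x. 0 \<le> R x"
  shows "(\<lambda>K::nat. \<integral>\<^sup>+x. ennreal (max 0 (R x - real K)) \<partial>M) \<longlonglongrightarrow> 0"
proof -
  have [measurable]: "R \<in> borel_measurable M" using R by auto
  have "(\<lambda>K::nat. \<integral>\<^sup>+x. ennreal (max 0 (R x - real K)) \<partial>M) \<longlonglongrightarrow> (\<integral>\<^sup>+x. 0 \<partial>M)"
  proof (rule nn_integral_dominated_convergence[where w = "\<lambda>x. ennreal (R x)"])
    show "(\<integral>\<^sup>+x. ennreal (R x) \<partial>M) < \<infinity>"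
      using R pos by (simp add: nn_integral_eq_integral)
    show "AE x in M. (\<lambda>K. ennreal (max 0 (R x - real K))) \<longlonglongrightarrow> 0"
    proof (rule AE_I2)
      fix x
      obtain N :: nat where "R x \<le> real N" using real_arch_simple by blast
      then have "\<forall>\<^sub>F K in sequentially. ennreal (max 0 (R x - real K)) = 0"
        by (intro eventually_sequentiallyI[of N]) (simp add: max_def)
      then show "(\<lambda>K. ennreal (max 0 (R x - real K))) \<longlonglongrightarrow> 0" by (rule tendsto_eventually)
    qed
  qed (use pos in \<open>auto intro!: ennreal_leI\<close>)
  then show ?thesis by simp
qed

text \<open>The limit acts as a conditional expectation of \<open>R\<close>. Testing against
  nonnegative invariant \<open>h\<close> avoids the sigma-algebra of invariant sets and admits
  infinite values. Fatou's lemma gives one inequality; the other rests on the uniform integrability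
  of the averages.\<close>

theorem nn_integral_birkhoff_limit:
  fixes R h \<rho> :: "'a \<Rightarrow> real"
  assumes R: "integrable M R" "\<And>x. 0 \<le> R x"
    and [measurable]: "h \<in> borel_measurable M" and h: "\<And>x. 0 \<le> h x"
    and inv: "AE x in M. h (T x) = h x"
    and [measurable]: "\<rho> \<in> borel_measurable M"
    and lim: "AE x in M. (\<lambda>n. birkhoff_sum T R n x / real n) \<longlonglongrightarrow> \<rho> x"
  shows "(\<integral>\<^sup>+x. ennreal (h x) * ennreal (\<rho> x) \<partial>M) = (\<integral>\<^sup>+x. ennreal (h x) * ennreal (R x) \<partial>M)"
proof (rule antisym)
  have [measurable]: "R \<in> borel_measurable M" using R by auto
  let ?avg = "\<lambda>n x. birkhoff_sum T R n x / real n"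
  have "(\<integral>\<^sup>+x. ennreal (h x) * ennreal (\<rho> x) \<partial>M)
      = (\<integral>\<^sup>+x. liminf (\<lambda>n. ennreal (h x) * ennreal (?avg n x)) \<partial>M)"
  proof (rule nn_integral_cong_AE)
    show "AE x in M. ennreal (h x) * ennreal (\<rho> x)
        = liminf (\<lambda>n. ennreal (h x) * ennreal (?avg n x))"
      using lim
    proof eventually_elim
      case (elim x)
      have "(\<lambda>n. ennreal (h x) * ennreal (?avg n x)) \<longlonglongrightarrow> ennreal (h x) * ennreal (\<rho> x)"
        by (intro ennreal_tendsto_cmult tendsto_ennrealI elim) simp
      then show ?case by (simp add: lim_imp_Liminf)
    qed
  qed
  also have "\<dots> \<le> liminf (\<lambda>n. \<integral>\<^sup>+x. ennreal (h x) * ennreal (?avg n x) \<partial>M)"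
    by (rule nn_integral_liminf) measurable
  also have "\<dots> = (\<integral>\<^sup>+x. ennreal (h x) * ennreal (R x) \<partial>M)"
  proof (rule lim_imp_Liminf[OF sequentially_bot tendsto_eventually])
    show "\<forall>\<^sub>F n in sequentially. (\<integral>\<^sup>+x. ennreal (h x) * ennreal (?avg n x) \<partial>M)
        = (\<integral>\<^sup>+x. ennreal (h x) * ennreal (R x) \<partial>M)"
      by (intro eventually_sequentiallyI[of 1] nn_integral_birkhoff_average R h inv) auto
  qed
  finally show "(\<integral>\<^sup>+x. ennreal (h x) * ennreal (\<rho> x) \<partial>M)
      \<le> (\<integral>\<^sup>+x. ennreal (h x) * ennreal (R x) \<partial>M)" .

  \<comment> \<open>For bounded \<open>h\<close>, cutting the averages at \<open>K\<close> costs at most the \<open>L\<^sup>1\<close> norm of the part of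
    \<open>R\<close> above \<open>K\<close>, uniformly in \<open>n\<close>.\<close>
  have bounded: "(\<integral>\<^sup>+x. ennreal (h' x) * ennreal (R x) \<partial>M)
      \<le> (\<integral>\<^sup>+x. ennreal (h' x) * ennreal (\<rho> x) \<partial>M)"
    if [measurable]: "h' \<in> borel_measurable M" and h': "\<And>x. 0 \<le> h' x" "\<And>x. h' x \<le> C"
      and inv': "AE x in M. h' (T x) = h' x" for h' :: "'a \<Rightarrow> real" and C
  proof -
    have "0 \<le> C" using h' order_trans by blast
    let ?IR = "\<integral>\<^sup>+x. ennreal (h' x) * ennreal (R x) \<partial>M"
    let ?I\<rho> = "\<integral>\<^sup>+x. ennreal (h' x) * ennreal (\<rho> x) \<partial>M"
    let ?e = "\<lambda>K::nat. \<integral>\<^sup>+x. ennreal (max 0 (R x - real K)) \<partial>M"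
    have K: "?IR \<le> ?I\<rho> + ennreal C * ?e K" for K :: nat
    proof -
      have le: "?IR \<le> (\<integral>\<^sup>+x. ennreal (h' x) * ennreal (min (?avg n x) (real K)) \<partial>M)
          + ennreal C * ?e K" if "n > 0" for n
      proof -
        let ?E = "\<lambda>x. max 0 (R x - real K)"
        \<comment> \<open>Since \<open>R\<close> is at most \<open>real K\<close> plus its excess
          over \<open>K\<close>, each average is at most \<open>K\<close> plus the average of the
          excess, whose integral does not depend on \<open>n\<close>.\<close>
        have split: "?avg n x \<le> min (?avg n x) (real K) + birkhoff_sum T ?E n x / real n" for x
        proof -
          have "birkhoff_sum T R n x \<le> birkhoff_sum T (\<lambda>x. ?E x + real K) n x"
            unfolding birkhoff_sum_def by (rule sum_mono) auto
          also have "\<dots> = birkhoff_sum T ?E n x + real n * real K"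
            by (simp add: birkhoff_sum_def sum.distrib)
          finally have "?avg n x \<le> real K + birkhoff_sum T ?E n x / real n"
            using \<open>n > 0\<close> by (simp add: field_simps)
          moreover have "0 \<le> birkhoff_sum T ?E n x / real n"
            by (simp add: birkhoff_sum_nonneg)
          ultimately show ?thesis by linarith
        qed
        have "?IR = (\<integral>\<^sup>+x. ennreal (h' x) * ennreal (?avg n x) \<partial>M)"
          by (rule nn_integral_birkhoff_average[symmetric]) (use R h' inv' that in auto)
        also have "\<dots> \<le> (\<integral>\<^sup>+x. ennreal (h' x) * ennreal (min (?avg n x) (real K))
            + ennreal C * ennreal (birkhoff_sum T ?E n x / real n) \<partial>M)"
        proof (rule nn_integral_mono)
          fix x
          have a: "0 \<le> min (?avg n x) (real K)"
            using birkhoff_sum_nonneg[of R T n x] R(2) by simp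
          have b: "0 \<le> birkhoff_sum T ?E n x / real n"
            by (simp add: birkhoff_sum_nonneg)
          have "h' x * ?avg n x \<le> h' x * (min (?avg n x) (real K) + birkhoff_sum T ?E n x / real n)"
            by (rule mult_left_mono[OF split h'(1)])
          also have "\<dots> \<le> h' x * min (?avg n x) (real K) + C * (birkhoff_sum T ?E n x / real n)"
            using mult_right_mono[OF h'(2) b] by (simp add: distrib_left)
          finally have "ennreal (h' x * ?avg n x)
              \<le> ennreal (h' x * min (?avg n x) (real K) + C * (birkhoff_sum T ?E n x / real n))"
            by (rule ennreal_leI)
          then show "ennreal (h' x) * ennreal (?avg n x)
              \<le> ennreal (h' x) * ennreal (min (?avg n x) (real K))
                + ennreal C * ennreal (birkhoff_sum T ?E n x / real n)"
            by (simp only: ennreal_mult'[OF h'(1)] ennreal_mult'[OF \<open>0 \<le> C\<close>]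
                ennreal_plus[OF mult_nonneg_nonneg[OF h'(1) a] mult_nonneg_nonneg[OF \<open>0 \<le> C\<close> b]])
        qed
        also have "\<dots> = (\<integral>\<^sup>+x. ennreal (h' x) * ennreal (min (?avg n x) (real K)) \<partial>M)
            + (\<integral>\<^sup>+x. ennreal C * ennreal (birkhoff_sum T ?E n x / real n) \<partial>M)"
          by (rule nn_integral_add) measurable
        also have "(\<integral>\<^sup>+x. ennreal C * ennreal (birkhoff_sum T ?E n x / real n) \<partial>M)
            = (\<integral>\<^sup>+x. ennreal C * ennreal (?E x) \<partial>M)"
          by (rule nn_integral_birkhoff_average) (use that \<open>0 \<le> C\<close> in auto)
        also have "\<dots> = ennreal C * ?e K"
          by (rule nn_integral_cmult) measurable
        finally show ?thesis .
      qed
      have fin: "(\<integral>\<^sup>+x. ennreal (C * real K) \<partial>M) < \<infinity>" by (simp add: emeasure_space_1)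
      have "(\<lambda>n. \<integral>\<^sup>+x. ennreal (h' x) * ennreal (min (?avg n x) (real K)) \<partial>M)
          \<longlonglongrightarrow> (\<integral>\<^sup>+x. ennreal (h' x) * ennreal (min (\<rho> x) (real K)) \<partial>M)"
      proof (rule nn_integral_dominated_convergence[where w = "\<lambda>_. ennreal (C * real K)"])
        show "AE x in M. ennreal (h' x) * ennreal (min (?avg n x) (real K)) \<le> ennreal (C * real K)" for n
        proof (rule AE_I2)
          fix x
          have "0 \<le> ?avg n x" using birkhoff_sum_nonneg[of R T n x] R(2) by simp
          then have "h' x * min (?avg n x) (real K) \<le> C * real K"
            using h' \<open>0 \<le> C\<close> by (intro mult_mono) auto
          then show "ennreal (h' x) * ennreal (min (?avg n x) (real K)) \<le> ennreal (C * real K)"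
            using h'(1)[of x] by (simp flip: ennreal_mult' add: ennreal_leI)
        qed
        show "AE x in M. (\<lambda>n. ennreal (h' x) * ennreal (min (?avg n x) (real K)))
            \<longlonglongrightarrow> ennreal (h' x) * ennreal (min (\<rho> x) (real K))"
          using lim
          by eventually_elim (intro ennreal_tendsto_cmult tendsto_ennrealI tendsto_min tendsto_const; simp)
      qed (use fin in measurable)
      then have "(\<lambda>n. (\<integral>\<^sup>+x. ennreal (h' x) * ennreal (min (?avg n x) (real K)) \<partial>M) + ennreal C * ?e K)
          \<longlonglongrightarrow> (\<integral>\<^sup>+x. ennreal (h' x) * ennreal (min (\<rho> x) (real K)) \<partial>M) + ennreal C * ?e K"
        by (intro tendsto_add tendsto_const)
      then have "?IR \<le> (\<integral>\<^sup>+x. ennreal (h' x) * ennreal (min (\<rho> x) (real K)) \<partial>M) + ennreal C * ?e K"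
        by (rule LIMSEQ_le_const) (use le in \<open>auto intro!: exI[of _ 1]\<close>)
      also have "\<dots> \<le> ?I\<rho> + ennreal C * ?e K"
        by (intro add_right_mono nn_integral_mono mult_left_mono ennreal_leI) auto
      finally show ?thesis .
    qed
    have "(\<lambda>K. ?I\<rho> + ennreal C * ?e K) \<longlonglongrightarrow> ?I\<rho> + ennreal C * 0"
      by (intro tendsto_add tendsto_const ennreal_tendsto_cmult tendsto_nn_integral_excess R) auto
    then have "?IR \<le> ?I\<rho> + ennreal C * 0"
      by (rule LIMSEQ_le_const) (use K in auto)
    then show ?thesis by simp
  qed

  \<comment> \<open>Monotone convergence in the truncation level removes the boundedness of
    \<open>h\<close>.\<close>
  let ?h = "\<lambda>K x. min (h x) (real K)"
  have "(\<lambda>K. \<integral>\<^sup>+x. ennreal (?h K x) * ennreal (R x) \<partial>M)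
      \<longlonglongrightarrow> (\<integral>\<^sup>+x. ennreal (h x) * ennreal (R x) \<partial>M)"
  proof (rule nn_integral_LIMSEQ)
    show "incseq (\<lambda>K x. ennreal (?h K x) * ennreal (R x))"
      by (auto simp: incseq_def le_fun_def intro!: mult_right_mono ennreal_leI)
    show "(\<lambda>K. ennreal (?h K x) * ennreal (R x)) \<longlonglongrightarrow> ennreal (h x) * ennreal (R x)" for x
    proof (rule tendsto_eventually)
      obtain N :: nat where "h x \<le> real N" using real_arch_simple by blast
      then show "\<forall>\<^sub>F K in sequentially. ennreal (?h K x) * ennreal (R x) = ennreal (h x) * ennreal (R x)"
        by (intro eventually_sequentiallyI[of N]) (simp add: min_def)
    qed
  qed measurable
  moreover have "(\<integral>\<^sup>+x. ennreal (?h K x) * ennreal (R x) \<partial>M)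
      \<le> (\<integral>\<^sup>+x. ennreal (h x) * ennreal (\<rho> x) \<partial>M)" for K :: nat
  proof -
    have "(\<integral>\<^sup>+x. ennreal (?h K x) * ennreal (R x) \<partial>M)
        \<le> (\<integral>\<^sup>+x. ennreal (?h K x) * ennreal (\<rho> x) \<partial>M)"
      by (rule bounded[of "?h K" "real K"]) (use h inv in auto)
    also have "\<dots> \<le> (\<integral>\<^sup>+x. ennreal (h x) * ennreal (\<rho> x) \<partial>M)"
      by (intro nn_integral_mono mult_right_mono ennreal_leI) auto
    finally show ?thesis .
  qed
  ultimately show "(\<integral>\<^sup>+x. ennreal (h x) * ennreal (R x) \<partial>M)
      \<le> (\<integral>\<^sup>+x. ennreal (h x) * ennreal (\<rho> x) \<partial>M)"
    by (intro LIMSEQ_le_const2) auto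
qed

text \<open>Invariance makes \<open>u (T\<^sup>n x) / n\<close> converge to \<open>0\<close> in measure.\<close>

lemma AE_slow_growth_limit_zero:
  fixes u :: "'a \<Rightarrow> real"
  assumes [measurable]: "u \<in> borel_measurable M"
  shows "AE x in M. \<forall>L. (\<lambda>n. u ((T ^^ n) x) / real n) \<longlonglongrightarrow> L \<longrightarrow> L = 0"
proof -
  define bad where "bad e N = {x \<in> space M. \<forall>n\<ge>N. e * real n < \<bar>u ((T ^^ n) x)\<bar>}" for e and N :: nat
  have bad_sets [measurable]: "bad e N \<in> sets M" for e N
    unfolding bad_def by measurable
  have bad_null: "bad e N \<in> null_sets M" if "e > 0" for e N
  proof -
    let ?S = "\<lambda>n. {x \<in> space M. e * real n < \<bar>u x\<bar>}"
    \<comment> \<open>For every \<open>n \<ge> N\<close> the set \<open>bad e N\<close> lies in the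
      preimage of \<open>?S n\<close> under \<open>T ^^ n\<close>. This preimage has the measure of
      \<open>?S n\<close> itself, which tends to \<open>0\<close> because \<open>u\<close> takes
      only finite values.\<close>
    have le: "measure M (bad e N) \<le> measure M (?S n)" if "n \<ge> N" for n
    proof -
      have "measure M (bad e N) \<le> measure M ((T ^^ n) -` ?S n \<inter> space M)"
      proof (rule finite_measure_mono)
        show "bad e N \<subseteq> (T ^^ n) -` ?S n \<inter> space M"
          using that measurable_space[OF measurable_funpow, of _ n] by (auto simp: bad_def)
        show "(T ^^ n) -` ?S n \<inter> space M \<in> sets M"
          by (rule measurable_sets[OF measurable_funpow]) measurable
      qed
      also have "\<dots> = measure (distr M M (T ^^ n)) (?S n)"
        by (rule measure_distr[symmetric]) measurable
      finally show ?thesis by (simp add: distr_funpow)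
    qed
    have "(\<lambda>n. measure M (?S n)) \<longlonglongrightarrow> measure M (\<Inter>n. ?S n)"
    proof (rule finite_Lim_measure_decseq)
      show "range ?S \<subseteq> sets M" by (intro image_subsetI) measurable
      show "decseq ?S"
        unfolding decseq_def
      proof (intro allI impI subsetI)
        fix k n :: nat and x assume "k \<le> n" and x: "x \<in> ?S n"
        then have "e * real k \<le> e * real n" using \<open>e > 0\<close> by simp
        with x show "x \<in> ?S k" by auto
      qed
    qed
    moreover have "(\<Inter>n. ?S n) = {}"
    proof -
      have False if "\<And>n::nat. e * real n < \<bar>u x\<bar>" for x
      proof -
        obtain n :: nat where "\<bar>u x\<bar> / e < real n" using reals_Archimedean2 by blast
        with that[of n] \<open>e > 0\<close> show False by (simp add: field_simps)
      qed
      then show ?thesis by blast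
    qed
    ultimately have "(\<lambda>n. measure M (?S n)) \<longlonglongrightarrow> 0" by simp
    then have "measure M (bad e N) \<le> 0"
      by (rule LIMSEQ_le_const) (use le in blast)
    with bad_sets show ?thesis by (rule null_sets_measure_le)
  qed
  have "AE x in M. x \<notin> bad (1 / real (Suc k)) N" for k N
    by (rule AE_not_in) (rule bad_null, simp)
  then have "AE x in M. \<forall>k N. x \<notin> bad (1 / real (Suc k)) N" by (simp add: AE_all_countable)
  with AE_space show ?thesis
  proof eventually_elim
    case (elim x)
    show ?case
    proof (intro allI impI, rule ccontr)
      fix L assume L: "(\<lambda>n. u ((T ^^ n) x) / real n) \<longlonglongrightarrow> L" "L \<noteq> 0"
      obtain k where k: "1 / real (Suc k) < \<bar>L\<bar>"
        using L(2) reals_Archimedean[of "\<bar>L\<bar>"] by (auto simp: inverse_eq_divide)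
      have "(\<lambda>n. \<bar>u ((T ^^ n) x) / real n\<bar>) \<longlonglongrightarrow> \<bar>L\<bar>" using L(1) by (rule tendsto_rabs)
      then have "\<forall>\<^sub>F n in sequentially. 1 / real (Suc k) < \<bar>u ((T ^^ n) x) / real n\<bar>"
        using k by (rule order_tendstoD)
      then obtain N where N: "\<And>n. n \<ge> N \<Longrightarrow> 1 / real (Suc k) < \<bar>u ((T ^^ n) x) / real n\<bar>"
        unfolding eventually_sequentially by blast
      \<comment> \<open>\<open>Suc N\<close> in place of \<open>N\<close> keeps \<open>n\<close>
        positive, so that the denominator can be cleared.\<close>
      have "1 / real (Suc k) * real n < \<bar>u ((T ^^ n) x)\<bar>" if "n \<ge> Suc N" for n
        using N[of n] that by (simp add: abs_divide field_simps)
      then have "x \<in> bad (1 / real (Suc k)) (Suc N)" using elim(1) by (simp add: bad_def)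
      with elim(2) show False by blast
    qed
  qed
qed

end

section \<open>Growth rates of families of inner products\<close>

definition inner_form :: "(real^'n \<Rightarrow> real^'n \<Rightarrow> real) \<Rightarrow> bool" where
  "inner_form G \<longleftrightarrow> bilinear G \<and> (\<forall>v w. G v w = G w v) \<and> (\<forall>v. v \<noteq> 0 \<longrightarrow> 0 < G v v)"

lemma inner_form_linear:
  assumes "inner_form G" shows "linear (G v)" "linear (\<lambda>v. G v w)"
  using assms by (auto simp: inner_form_def bilinear_def)

lemma inner_form_rules:
  assumes "inner_form G"
  shows "G (v - v') w = G v w - G v' w" "G w (v - v') = G w v - G w v'"
    "G (c *\<^sub>R v) w = c * G v w" "G w (c *\<^sub>R v) = c * G w v"
    "G (\<Sum>i\<in>I. d i *\<^sub>R u i) w = (\<Sum>i\<in>I. d i * G (u i) w)"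
    "G w (\<Sum>i\<in>I. d i *\<^sub>R u i) = (\<Sum>i\<in>I. d i * G w (u i))"
proof -
  note lin = inner_form_linear[OF assms]
  show "G (v - v') w = G v w - G v' w" by (rule linear_diff[OF lin(2)])
  show "G w (v - v') = G w v - G w v'" by (rule linear_diff[OF lin(1)])
  show 1: "G (c *\<^sub>R v) w = c * G v w" for c v using linear_scale[OF lin(2)] by simp
  show 2: "G w (c *\<^sub>R v) = c * G w v" for c v using linear_scale[OF lin(1)] by simp
  show "G (\<Sum>i\<in>I. d i *\<^sub>R u i) w = (\<Sum>i\<in>I. d i * G (u i) w)"
    by (subst linear_sum[OF lin(2)]) (simp only: 1)
  show "G w (\<Sum>i\<in>I. d i *\<^sub>R u i) = (\<Sum>i\<in>I. d i * G w (u i))"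
    by (subst linear_sum[OF lin(1)]) (simp only: 2)
qed

text \<open>Gram-Schmidt with respect to \<open>G\<close>; a vector outside the span exists as long
  as fewer than \<open>CARD('n)\<close> vectors have been chosen.\<close>

lemma orthonormal_extend:
  fixes G :: "real^'n \<Rightarrow> real^'n::finite \<Rightarrow> real"
  assumes G: "inner_form G" and "k \<le> CARD('n)"
  shows "\<exists>B. finite B \<and> independent B \<and> card B = k \<and>
    (\<forall>b\<in>B. \<forall>c\<in>B. G b c = (if b = c then 1 else 0))"
  using \<open>k \<le> CARD('n)\<close>
proof (induction k)
  case 0
  show ?case by (intro exI[of _ "{}"]) (simp add: independent_empty)
next
  case (Suc k)
  then obtain B where B: "finite B" "independent B" "card B = k"
    and orth: "\<And>b c. b \<in> B \<Longrightarrow> c \<in> B \<Longrightarrow> G b c = (if b = c then 1 else 0)" by auto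
  have sym: "G b e = G e b" for b e using G by (simp add: inner_form_def)
  have "span B \<noteq> UNIV"
  proof
    assume "span B = UNIV"
    then have "dim (UNIV :: (real^'n) set) \<le> k" using B(1,3) dim_le_card[of UNIV B] by simp
    with Suc.prems show False by simp
  qed
  then obtain v where v: "v \<notin> span B" by blast
  define u where "u = v - (\<Sum>b\<in>B. G v b *\<^sub>R b)"
  have S: "(\<Sum>b\<in>B. G v b *\<^sub>R b) \<in> span B" by (intro span_sum span_scale span_base)
  have u: "u \<notin> span B"
    using v span_add[OF _ S, of u] by (auto simp: u_def)
  then have "u \<noteq> 0" using span_zero by blast
  then have pos: "0 < G u u" using G by (simp add: inner_form_def)
  have uc: "G u c = 0" if "c \<in> B" for c
  proof -
    have "G u c = G v c - (\<Sum>b\<in>B. G v b * G b c)"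
      by (simp only: u_def inner_form_rules[OF G])
    also have "(\<Sum>b\<in>B. G v b * G b c) = (\<Sum>b\<in>B. if b = c then G v b else 0)"
      by (rule sum.cong) (use orth that in auto)
    finally show ?thesis using that B(1) by simp
  qed
  define e where "e = (1 / sqrt (G u u)) *\<^sub>R u"
  have ee: "G e e = 1"
    using pos by (simp add: e_def inner_form_rules[OF G] field_simps flip: power2_eq_square)
  have ec: "G e c = 0" if "c \<in> B" for c
    by (simp add: e_def inner_form_rules[OF G] uc[OF that])
  have ce: "G c e = 0" if "c \<in> B" for c using ec[OF that] by (simp only: sym)
  have e: "e \<notin> span B"
  proof
    assume "e \<in> span B"
    then have "sqrt (G u u) *\<^sub>R e \<in> span B" by (rule span_scale)
    with u pos show False by (simp add: e_def)
  qed
  then have "e \<notin> B" using span_base by blast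
  show ?case
  proof (intro exI conjI ballI)
    show "independent (insert e B)" using B(2) e by (simp add: independent_insert)
    fix b c assume "b \<in> insert e B" "c \<in> insert e B"
    then consider "b = e" "c = e" | "b = e" "c \<in> B" "b \<noteq> c" | "b \<in> B" "c = e" "b \<noteq> c" | "b \<in> B" "c \<in> B"
      using \<open>e \<notin> B\<close> by blast
    then show "G b c = (if b = c then 1 else 0)"
      by cases (simp_all add: ee ec ce orth)
  qed (use B \<open>e \<notin> B\<close> in simp_all)
qed

text \<open>\<open>Q\<close> collects the coordinates in a \<open>G\<close>-orthonormal basis.
  Through it, statements on Gram determinants and volumes become statements on matrices and the
  Euclidean norm.\<close>

lemma inner_form_factor:
  fixes G :: "real^'n \<Rightarrow> real^'n::finite \<Rightarrow> real"
  assumes G: "inner_form G"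
  obtains Q :: "real^'n \<Rightarrow> real^'n" where "linear Q" "\<And>v w. G v w = Q v \<bullet> Q w"
proof -
  note lin = inner_form_linear[OF G]
  have sym: "G v w = G w v" for v w using G by (simp add: inner_form_def)
  obtain B where B: "finite B" "independent B" "card B = CARD('n)"
    and orth: "\<And>b c. b \<in> B \<Longrightarrow> c \<in> B \<Longrightarrow> G b c = (if b = c then 1 else 0)"
    using orthonormal_extend[OF G order_refl] by auto
  have span: "span B = UNIV"
    using card_ge_dim_independent[of B UNIV] B by auto
  obtain e :: "'n \<Rightarrow> real^'n" where e: "bij_betw e UNIV B"
    using B by (metis bij_betw_iff_card finite_class.finite_UNIV)
  define Q where "Q v = (\<chi> i. G v (e i))" for v
  have "linear Q"
    by (rule linearI) (simp_all add: Q_def vec_eq_iff linear_add[OF lin(2)] linear_scale[OF lin(2)])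
  moreover have "G v w = Q v \<bullet> Q w" for v w
  proof -
    \<comment> \<open>The remainder of the expansion is orthogonal to a spanning set, hence to
      itself, and so it vanishes.\<close>
    define d where "d = v - (\<Sum>b\<in>B. G v b *\<^sub>R b)"
    have d: "G c d = 0" if "c \<in> B" for c
    proof -
      have "G c d = G c v - (\<Sum>b\<in>B. G v b * G c b)"
        by (simp only: d_def inner_form_rules[OF G])
      also have "(\<Sum>b\<in>B. G v b * G c b) = (\<Sum>b\<in>B. if b = c then G v b else 0)"
        by (rule sum.cong) (use orth that in auto)
      finally show ?thesis using that B(1) sym by simp
    qed
    have "subspace {c. G c d = 0}"
      using linear_subspace_kernel[OF lin(2)] by simp
    then have "span B \<subseteq> {c. G c d = 0}" using d by (intro span_minimal) auto
    then have "G d d = 0" using span by auto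
    then have "d = 0" using G by (auto simp: inner_form_def)
    then have v: "v = (\<Sum>b\<in>B. G v b *\<^sub>R b)" by (simp add: d_def)
    have "G v w = (\<Sum>b\<in>B. G v b * G b w)"
      by (subst v) (simp only: inner_form_rules[OF G])
    also have "\<dots> = (\<Sum>i\<in>UNIV. G v (e i) * G w (e i))"
      using sum.reindex_bij_betw[OF e, of "\<lambda>b. G v b * G b w"] by (simp add: sym)
    finally show ?thesis by (simp add: Q_def inner_vec_def)
  qed
  ultimately show ?thesis by (rule that)
qed

lemma gram_factor:
  fixes Q :: "real^'n \<Rightarrow> real^'n::finite"
  assumes "linear Q" "\<And>v w. g x v w = Q v \<bullet> Q w"
  shows "sqrt (det (gram g x)) = \<bar>det (matrix Q)\<bar>"
proof -
  have "gram g x = transpose (matrix Q) ** matrix Q"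
    by (simp add: gram_def vec_eq_iff matrix_matrix_mult_def transpose_def matrix_def assms(2) inner_vec_def)
  then show ?thesis
    by (simp add: det_mul det_transpose real_sqrt_mult_self flip: power2_eq_square)
qed

lemma inner_form_factor_det:
  fixes Q :: "real^'n \<Rightarrow> real^'n::finite"
  assumes G: "inner_form G" and Q: "linear Q" "\<And>v w. G v w = Q v \<bullet> Q w"
  shows "det (matrix Q) \<noteq> 0"
proof -
  have "inj Q"
    unfolding linear_injective_0[OF Q(1)]
  proof safe
    fix v assume "Q v = 0"
    then have "G v v = 0" by (simp add: Q(2))
    then show "v = 0" using G by (auto simp: inner_form_def)
  qed
  then show ?thesis
    using det_nz_iff_inj[OF Q(1)] by blast
qed

lemma sqrt_det_gram_pos:
  fixes g :: "'a \<Rightarrow> real^'n \<Rightarrow> real^'n::finite \<Rightarrow> real"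
  assumes "inner_form (g x)" shows "0 < sqrt (det (gram g x))"
proof -
  obtain Q :: "real^'n \<Rightarrow> real^'n" where Q: "linear Q" "\<And>v w. g x v w = Q v \<bullet> Q w"
    using inner_form_factor[OF assms] by blast
  show ?thesis
    unfolding gram_factor[of Q g x, OF Q] using inner_form_factor_det[OF assms Q] by simp
qed

lemma riem_norm_pos:
  assumes "inner_form (g x)" "v \<noteq> 0" shows "0 < riem_norm g x v"
  using assms by (simp add: riem_norm_def inner_form_def)

lemma riem_norm_nonneg:
  assumes "inner_form (g x)" shows "0 \<le> riem_norm g x v"
proof (cases "v = 0")
  case True
  then show ?thesis using inner_form_linear(1)[OF assms, of 0] by (simp add: riem_norm_def linear_0)
next
  case False
  with riem_norm_pos[of g x v] assms show ?thesis by simp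
qed

lemma riem_norm_zero: "inner_form (g x) \<Longrightarrow> riem_norm g x 0 = 0"
  using inner_form_linear(1)[of "g x" 0] by (simp add: riem_norm_def linear_0)

lemma riem_norm_scale:
  assumes "inner_form (g x)" shows "riem_norm g x (c *\<^sub>R v) = \<bar>c\<bar> * riem_norm g x v"
  using linear_scale[OF inner_form_linear(1)[OF assms]] linear_scale[OF inner_form_linear(2)[OF assms]]
  by (simp add: riem_norm_def real_sqrt_mult flip: mult.assoc)

lemma riem_norm_triangle:
  fixes g :: "'a \<Rightarrow> real^'n \<Rightarrow> real^'n::finite \<Rightarrow> real"
  assumes "inner_form (g x)"
  shows "riem_norm g x (v + w) \<le> riem_norm g x v + riem_norm g x w"
proof -
  obtain Q :: "real^'n \<Rightarrow> real^'n" where Q: "linear Q" "\<And>v w. g x v w = Q v \<bullet> Q w"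
    using inner_form_factor[OF assms] by blast
  have "riem_norm g x v = norm (Q v)" for v by (simp add: riem_norm_def Q(2) norm_eq_sqrt_inner)
  then show ?thesis by (simp add: linear_add[OF Q(1)] norm_triangle_ineq)
qed

lemma riem_norm_sum_le:
  fixes g :: "'a \<Rightarrow> real^'n \<Rightarrow> real^'n::finite \<Rightarrow> real"
  assumes "inner_form (g x)"
  shows "riem_norm g x (\<Sum>i\<in>I. w i) \<le> (\<Sum>i\<in>I. riem_norm g x (w i))"
proof (induction I rule: infinite_finite_induct)
  case (insert i I)
  then show ?case using riem_norm_triangle[of g x "w i" "sum w I", OF assms] by simp
qed (simp_all add: riem_norm_zero assms)

text \<open>The Leibniz formula gives the factor \<open>fact CARD('n)\<close> where Hadamard's
  inequality has \<open>1\<close>. Constant factors are harmless because only exponential rates are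
  compared.\<close>

lemma abs_det_le_prod_norm:
  fixes A :: "real^'n^'n::finite"
  shows "\<bar>det A\<bar> \<le> fact CARD('n) * (\<Prod>i\<in>UNIV. norm (A $ i))"
proof -
  have "\<bar>det A\<bar> \<le> (\<Sum>p | p permutes (UNIV :: 'n set). \<bar>of_int (sign p) * (\<Prod>i\<in>UNIV. A $ i $ p i)\<bar>)"
    unfolding det_def by (rule sum_abs)
  also have "\<dots> \<le> (\<Sum>p | p permutes (UNIV :: 'n set). \<Prod>i\<in>UNIV. norm (A $ i))"
  proof (rule sum_mono)
    fix p :: "'n \<Rightarrow> 'n"
    have "\<bar>\<Prod>i\<in>UNIV. A $ i $ p i\<bar> \<le> (\<Prod>i\<in>UNIV. norm (A $ i))"
      unfolding abs_prod by (rule prod_mono) (auto intro: component_le_norm_cart)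
    then show "\<bar>of_int (sign p) * (\<Prod>i\<in>UNIV. A $ i $ p i)\<bar> \<le> (\<Prod>i\<in>UNIV. norm (A $ i))"
      by (simp add: abs_mult sign_def)
  qed
  also have "\<dots> = fact CARD('n) * (\<Prod>i\<in>UNIV. norm (A $ i))"
    by (simp add: card_permutations[OF refl])
  finally show ?thesis .
qed

text \<open>The left side is the volume, in the metric \<open>g x\<close>, of the parallelepiped
  spanned by the vectors \<open>w i\<close>. Factoring \<open>g x\<close> reduces the bound to the
  Euclidean one.\<close>

lemma hadamard_gram:
  fixes g :: "'a \<Rightarrow> real^'n \<Rightarrow> real^'n::finite \<Rightarrow> real" and w :: "'n \<Rightarrow> real^'n"
  assumes "inner_form (g x)"
  shows "\<bar>det (\<chi> i. w i)\<bar> * sqrt (det (gram g x)) \<le> fact CARD('n) * (\<Prod>i\<in>UNIV. riem_norm g x (w i))"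
proof -
  obtain Q :: "real^'n \<Rightarrow> real^'n" where Q: "linear Q" "\<And>v w. g x v w = Q v \<bullet> Q w"
    using inner_form_factor[OF assms] by blast
  have n: "riem_norm g x v = norm (Q v)" for v by (simp add: riem_norm_def Q(2) norm_eq_sqrt_inner)
  have "(\<chi> i. Q (w i)) = (\<chi> i. w i) ** transpose (matrix Q)"
  proof -
    have "Q (w i) = matrix Q *v w i" for i using matrix_works[of Q] Q(1) by (simp add: linear_def)
    then show ?thesis
      by (simp add: vec_eq_iff matrix_matrix_mult_def transpose_def matrix_vector_mult_def mult.commute)
  qed
  then have "\<bar>det (\<chi> i. w i)\<bar> * sqrt (det (gram g x)) = \<bar>det (\<chi> i. Q (w i))\<bar>"
    by (simp add: gram_factor[of Q g x, OF Q] det_mul det_transpose abs_mult)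
  also have "\<dots> \<le> fact CARD('n) * (\<Prod>i\<in>UNIV. norm (Q (w i)))"
    using abs_det_le_prod_norm[of "\<chi> i. Q (w i)"] by simp
  finally show ?thesis by (simp add: n)
qed

lemma gram_pullback:
  fixes M :: "real^'n \<Rightarrow> real^'n::finite"
  assumes "linear M" "inner_form (g x)" "\<And>v w. h y v w = g x (M v) (M w)"
  shows "sqrt (det (gram h y)) = \<bar>det (matrix M)\<bar> * sqrt (det (gram g x))"
proof -
  obtain Q :: "real^'n \<Rightarrow> real^'n" where Q: "linear Q" "\<And>v w. g x v w = Q v \<bullet> Q w"
    using inner_form_factor[OF assms(2)] by blast
  have "sqrt (det (gram h y)) = \<bar>det (matrix (Q \<circ> M))\<bar>"
    by (rule gram_factor) (use Q assms in \<open>auto intro: linear_compose\<close>)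
  also have "matrix (Q \<circ> M) = matrix Q ** matrix M"
    by (rule matrix_compose) (use Q assms in \<open>auto simp: linear_def\<close>)
  finally show ?thesis
    by (simp add: gram_factor[of Q g x, OF Q] det_mul abs_mult)
qed

lemma inner_form_pullback:
  assumes "inner_form G" "linear M" "inj M"
  shows "inner_form (\<lambda>v w. G (M v) (M w))"
proof -
  have "M v \<noteq> 0" if "v \<noteq> 0" for v
    using that assms(2,3) linear_injective_0 by blast
  then show ?thesis
    using assms(1) linear_compose[OF assms(2) inner_form_linear(1)[OF assms(1)]]
      linear_compose[OF assms(2) inner_form_linear(2)[OF assms(1)]]
    by (auto simp: inner_form_def bilinear_def comp_def)
qed

lemma spanning_family_expand:
  fixes b :: "'n::finite \<Rightarrow> 'v::real_vector"
  assumes "span (range b) = UNIV"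
  obtains x where "v = (\<Sum>i\<in>UNIV. x i *\<^sub>R b i)"
proof -
  let ?S = "{v. \<exists>x. v = (\<Sum>i\<in>UNIV. x i *\<^sub>R b i)}"
  have "subspace ?S"
  proof (rule subspaceI)
    show "0 \<in> ?S" by (auto intro!: exI[of _ "\<lambda>_. 0"])
    fix v w assume "v \<in> ?S" "w \<in> ?S"
    then obtain x y where "v = (\<Sum>i\<in>UNIV. x i *\<^sub>R b i)" "w = (\<Sum>i\<in>UNIV. y i *\<^sub>R b i)" by blast
    then have "v + w = (\<Sum>i\<in>UNIV. (x i + y i) *\<^sub>R b i)"
      by (simp add: scaleR_add_left sum.distrib)
    then show "v + w \<in> ?S" by (auto intro!: exI[of _ "\<lambda>i. x i + y i"])
  next
    fix c v assume "v \<in> ?S"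
    then obtain x where "v = (\<Sum>i\<in>UNIV. x i *\<^sub>R b i)" by blast
    then have "c *\<^sub>R v = (\<Sum>i\<in>UNIV. (c * x i) *\<^sub>R b i)" by (simp add: scaleR_sum_right)
    then show "c *\<^sub>R v \<in> ?S" by (auto intro!: exI[of _ "\<lambda>i. c * x i"])
  qed
  moreover have "range b \<subseteq> ?S"
  proof safe
    fix j
    have "b j = (\<Sum>i\<in>UNIV. (if i = j then 1 else 0) *\<^sub>R b i)"
      by (simp add: if_distrib[of "\<lambda>c. c *\<^sub>R _"] cong: if_cong)
    then show "\<exists>x. b j = (\<Sum>i\<in>UNIV. x i *\<^sub>R b i)" by (rule exI[of _ "\<lambda>i. if i = j then 1 else 0"])
  qed
  ultimately have "span (range b) \<subseteq> ?S" by (rule span_minimal[rotated])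
  moreover have "v \<in> span (range b)" using assms by simp
  ultimately have "v \<in> ?S" by (rule subsetD)
  then obtain x where "v = (\<Sum>i\<in>UNIV. x i *\<^sub>R b i)" by (elim CollectE exE)
  then show ?thesis by (rule that)
qed

lemma spanning_family_det:
  fixes b :: "'n::finite \<Rightarrow> real^'n"
  assumes "span (range b) = UNIV"
  shows "det (\<chi> i. b i) \<noteq> 0"
proof -
  let ?A = "transpose (\<chi> i. b i)"
  have "surj (\<lambda>x. ?A *v x)"
  proof (rule surjI[where f = "\<lambda>v. \<chi> i. (SOME x. v = (\<Sum>i\<in>UNIV. x i *\<^sub>R b i)) i"])
    fix v
    have "\<exists>x. v = (\<Sum>i\<in>UNIV. x i *\<^sub>R b i)"
      using spanning_family_expand[OF assms] by metis
    then have "v = (\<Sum>i\<in>UNIV. (SOME x. v = (\<Sum>i\<in>UNIV. x i *\<^sub>R b i)) i *\<^sub>R b i)"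
      by (rule someI_ex)
    then show "?A *v (\<chi> i. (SOME x. v = (\<Sum>i\<in>UNIV. x i *\<^sub>R b i)) i) = v"
      by (simp add: matrix_mult_sum column_transpose row_def scalar_mult_eq_scaleR)
  qed
  then have "invertible ?A"
    unfolding invertible_right_inverse matrix_right_invertible_surjective .
  then show ?thesis by (simp add: invertible_det_nz)
qed

lemma spanning_family_independent:
  fixes b :: "'n::finite \<Rightarrow> real^'n"
  assumes "span (range b) = UNIV"
  shows "inj b" "independent (range b)"
proof -
  have "CARD('n) \<le> card (range b)"
    using dim_le_card[of UNIV "range b"] assms by simp
  then have "card (range b) = CARD('n)" using card_image_le[of UNIV b] by simp
  then show "inj b" by (intro eq_card_imp_inj_on) auto
  show "independent (range b)"
    by (rule card_le_dim_spanning[of _ UNIV]) (use assms \<open>card (range b) = _\<close> in auto)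
qed

section \<open>Exponents determined by growth modulo one direction\<close>

lemma eventually_le_exp:
  fixes C e :: real
  assumes "e > 0"
  shows "\<forall>\<^sub>F n in sequentially. C \<le> exp (e * real n)"
proof (rule eventually_sequentiallyI)
  fix n assume "nat \<lceil>C / e\<rceil> \<le> n"
  then have "C / e \<le> real n" by linarith
  then have "C \<le> 1 + e * real n" using assms by (simp add: field_simps)
  also have "\<dots> \<le> exp (e * real n)" by (rule exp_ge_add_one_self)
  finally show "C \<le> exp (e * real n)" .
qed

lemma eventually_le_exp_rate:
  fixes a :: "nat \<Rightarrow> real"
  assumes "(\<lambda>n. ln (a n) / real n) \<longlonglongrightarrow> k" "k < c" "\<And>n. 0 < a n"
  shows "\<forall>\<^sub>F n in sequentially. a n \<le> exp (c * real n)"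
  using order_tendstoD(2)[OF assms(1,2)] eventually_gt_at_top[of 0]
proof eventually_elim
  case (elim n)
  then have "ln (a n) \<le> c * real n" by (simp add: field_simps)
  then have "exp (ln (a n)) \<le> exp (c * real n)" by simp
  then show ?case using assms(3)[of n] by simp
qed

text \<open>The abstract form of a basis adapted to an Oseledets splitting, with \<open>G n\<close>
  the metric pulled back from the \<open>n\<close>-th time. The last condition is the volume part of
  regularity: the vectors become parallel at most subexponentially, so a combination of them cannot
  grow more slowly than its fastest term.\<close>

definition adapted_frame ::
  "(nat \<Rightarrow> real^'n \<Rightarrow> real^'n \<Rightarrow> real) \<Rightarrow> ('n::finite \<Rightarrow> real^'n) \<Rightarrow> ('n \<Rightarrow> real) \<Rightarrow> bool" where
  "adapted_frame G b k \<longleftrightarrow> (\<forall>n. inner_form (G n)) \<and> span (range b) = UNIV \<and>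
     (\<forall>i. (\<lambda>n. ln (riem_norm G n (b i)) / real n) \<longlonglongrightarrow> k i) \<and>
     (\<lambda>n. ln (sqrt (det (gram G n))) / real n) \<longlonglongrightarrow> (\<Sum>i\<in>UNIV. k i)"

text \<open>The vectors of growth rate at most \<open>c\<close> in the quotient by the line through
  \<open>f\<close>, since minimizing over \<open>a\<close> gives the quotient norm. The coefficient
  may change with \<open>n\<close>, so nothing is required of the component along
  \<open>f\<close>.\<close>

definition slow_mod ::
  "(nat \<Rightarrow> real^'n \<Rightarrow> real^'n \<Rightarrow> real) \<Rightarrow> real^'n::finite \<Rightarrow> real \<Rightarrow> (real^'n) set" where
  "slow_mod G f c = {v. \<forall>e>0. \<forall>\<^sub>F n in sequentially. \<exists>a. riem_norm G n (v + a *\<^sub>R f) \<le> exp ((c + e) * real n)}"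

lemma subspace_slow_mod:
  assumes G: "\<And>n. inner_form (G n)"
  shows "subspace (slow_mod G f c)"
proof (rule subspaceI)
  show "0 \<in> slow_mod G f c"
    unfolding slow_mod_def
    by (auto intro!: always_eventually exI[of _ 0] simp: riem_norm_zero[of G, OF G])
next
  fix v w assume vw: "v \<in> slow_mod G f c" "w \<in> slow_mod G f c"
  show "v + w \<in> slow_mod G f c"
    unfolding slow_mod_def
  proof (intro CollectI allI impI)
    fix e :: real assume "e > 0"
    then have e: "e / 2 > 0" by simp
    have v: "\<forall>\<^sub>F n in sequentially. \<exists>a. riem_norm G n (v + a *\<^sub>R f) \<le> exp ((c + e / 2) * real n)"
      and w: "\<forall>\<^sub>F n in sequentially. \<exists>a. riem_norm G n (w + a *\<^sub>R f) \<le> exp ((c + e / 2) * real n)"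
      using vw e unfolding slow_mod_def by blast+
    from v w eventually_le_exp[OF e, of 2]
    show "\<forall>\<^sub>F n in sequentially. \<exists>a. riem_norm G n (v + w + a *\<^sub>R f) \<le> exp ((c + e) * real n)"
    proof eventually_elim
      case (elim n)
      then obtain a a' where a: "riem_norm G n (v + a *\<^sub>R f) \<le> exp ((c + e / 2) * real n)"
        "riem_norm G n (w + a' *\<^sub>R f) \<le> exp ((c + e / 2) * real n)" by blast
      have "riem_norm G n (v + w + (a + a') *\<^sub>R f)
          = riem_norm G n ((v + a *\<^sub>R f) + (w + a' *\<^sub>R f))"
        by (simp add: algebra_simps)
      also have "\<dots> \<le> riem_norm G n (v + a *\<^sub>R f) + riem_norm G n (w + a' *\<^sub>R f)"
        by (rule riem_norm_triangle[of G, OF G])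
      also have "\<dots> \<le> 2 * exp ((c + e / 2) * real n)" using a by simp
      also have "\<dots> \<le> exp (e / 2 * real n) * exp ((c + e / 2) * real n)"
        by (rule mult_right_mono[OF elim(3)]) simp
      also have "\<dots> = exp ((c + e) * real n)"
        by (simp add: algebra_simps flip: exp_add)
      finally show ?case by blast
    qed
  qed
next
  fix r :: real and v assume v: "v \<in> slow_mod G f c"
  show "r *\<^sub>R v \<in> slow_mod G f c"
    unfolding slow_mod_def
  proof (intro CollectI allI impI)
    fix e :: real assume "e > 0"
    then have e: "e / 2 > 0" by simp
    have "\<forall>\<^sub>F n in sequentially. \<exists>a. riem_norm G n (v + a *\<^sub>R f) \<le> exp ((c + e / 2) * real n)"
      using v e unfolding slow_mod_def by blast
    with eventually_le_exp[OF e, of "\<bar>r\<bar>"]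
    show "\<forall>\<^sub>F n in sequentially. \<exists>a. riem_norm G n (r *\<^sub>R v + a *\<^sub>R f) \<le> exp ((c + e) * real n)"
    proof eventually_elim
      case (elim n)
      then obtain a where a: "riem_norm G n (v + a *\<^sub>R f) \<le> exp ((c + e / 2) * real n)" by blast
      have "riem_norm G n (r *\<^sub>R v + (r * a) *\<^sub>R f) = \<bar>r\<bar> * riem_norm G n (v + a *\<^sub>R f)"
        using riem_norm_scale[of G n r "v + a *\<^sub>R f", OF G] by (simp add: algebra_simps)
      also have "\<dots> \<le> exp (e / 2 * real n) * exp ((c + e / 2) * real n)"
        by (intro mult_mono elim(1) a riem_norm_nonneg[of G, OF G]) auto
      also have "\<dots> = exp ((c + e) * real n)"
        by (simp add: algebra_simps flip: exp_add)
      finally show ?case by blast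
    qed
  qed
qed

text \<open>Exchange \<open>b j\<close> for \<open>v + a *\<^sub>R b i0\<close>. Up to the factor
  \<open>x j\<close> the frame keeps its volume, while in Hadamard's inequality the rate
  \<open>k j\<close> of one length is replaced by \<open>c + e\<close>. As the volume has the rate
  \<open>\<Sum>i\<in>UNIV. k i\<close>, this leaves \<open>k j \<le> c + e\<close>.\<close>

lemma slow_mod_frame_le:
  fixes b :: "'n::finite \<Rightarrow> real^'n"
  assumes fr: "adapted_frame G b k" and x: "v = (\<Sum>i\<in>UNIV. x i *\<^sub>R b i)" "x j \<noteq> 0" "j \<noteq> i0"
    and v: "v \<in> slow_mod G (b i0) c"
  shows "k j \<le> c"
proof (rule field_le_epsilon)
  fix e :: real assume "e > 0"
  have G: "inner_form (G n)" for n using fr by (simp add: adapted_frame_def)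
  have sp: "span (range b) = UNIV" using fr by (simp add: adapted_frame_def)
  have k: "(\<lambda>n. ln (riem_norm G n (b i)) / real n) \<longlonglongrightarrow> k i" for i
    using fr by (simp add: adapted_frame_def)
  have V: "(\<lambda>n. ln (sqrt (det (gram G n))) / real n) \<longlonglongrightarrow> (\<Sum>i\<in>UNIV. k i)"
    using fr by (simp add: adapted_frame_def)
  have Vpos: "0 < sqrt (det (gram G n))" for n by (rule sqrt_det_gram_pos[of G, OF G])
  have b0: "b i \<noteq> 0" for i
    using spanning_family_independent(2)[OF sp] dependent_zero by (metis rangeI)
  have pos: "0 < riem_norm G n (b i)" for n i by (rule riem_norm_pos[of G, OF G b0])
  define D where "D = \<bar>x j\<bar> * \<bar>det (\<chi> i. b i)\<bar>"
  have D: "0 < D" using x(2) spanning_family_det[OF sp] by (simp add: D_def)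
  define F :: real where "F = fact CARD('n)"
  have "0 < F" by (simp add: F_def)
  have ineq: "ln D / real n + ln (sqrt (det (gram G n))) / real n
      \<le> ln F / real n + (c + e) + (\<Sum>i\<in>UNIV - {j}. ln (riem_norm G n (b i)) / real n)"
    if n: "riem_norm G n (v + a *\<^sub>R b i0) \<le> exp ((c + e) * real n)" "n > 0" for n a
  proof -
    define y where "y = (\<chi> i. x i + (if i = i0 then a else 0))"
    define w where "w i = (if i = j then v + a *\<^sub>R b i0 else b i)" for i
    have ya: "v + a *\<^sub>R b i0 = (\<Sum>i\<in>UNIV. y $ i *\<^sub>R b i)"
    proof -
      have "(\<Sum>i\<in>UNIV. (if i = i0 then a else 0) *\<^sub>R b i) = a *\<^sub>R b i0"
        by (simp add: if_distrib[of "\<lambda>c. c *\<^sub>R _"] cong: if_cong)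
      then show ?thesis by (simp add: x(1) y_def scaleR_add_left sum.distrib)
    qed
    have "(\<chi> i. w i) = (\<chi> i. if i = j then sum (\<lambda>i. y $ i *s row i (\<chi> i. b i)) UNIV else row i (\<chi> i. b i))"
      by (simp add: vec_eq_iff w_def ya row_def scalar_mult_eq_scaleR)
    \<comment> \<open>By Cramer's rule the exchange multiplies the determinant by the
      \<open>j\<close>-th coordinate, and \<open>j \<noteq> i0\<close> makes this coordinate
      independent of \<open>a\<close>.\<close>
    then have "det (\<chi> i. w i) = x j * det (\<chi> i. b i)"
      using cramer_lemma_transpose[of j y "\<chi> i. b i"] x(3) by (simp add: y_def)
    then have "D * sqrt (det (gram G n)) \<le> F * (\<Prod>i\<in>UNIV. riem_norm G n (w i))"
      using hadamard_gram[of G n w, OF G] by (simp add: D_def F_def abs_mult)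
    also have "(\<Prod>i\<in>UNIV. riem_norm G n (w i))
        = riem_norm G n (w j) * (\<Prod>i\<in>UNIV - {j}. riem_norm G n (w i))"
      by (rule prod.remove) auto
    also have "(\<Prod>i\<in>UNIV - {j}. riem_norm G n (w i)) = (\<Prod>i\<in>UNIV - {j}. riem_norm G n (b i))"
      by (rule prod.cong) (auto simp: w_def)
    also have "F * (riem_norm G n (w j) * (\<Prod>i\<in>UNIV - {j}. riem_norm G n (b i)))
        \<le> F * (exp ((c + e) * real n) * (\<Prod>i\<in>UNIV - {j}. riem_norm G n (b i)))"
      using n(1) pos \<open>0 < F\<close>
      by (intro mult_left_mono mult_right_mono prod_nonneg) (auto simp: w_def less_imp_le)
    finally have "ln (D * sqrt (det (gram G n)))
        \<le> ln (F * (exp ((c + e) * real n) * (\<Prod>i\<in>UNIV - {j}. riem_norm G n (b i))))"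
      using D Vpos[of n] by (subst ln_le_cancel_iff) (auto intro!: mult_pos_pos prod_pos \<open>0 < F\<close> pos)
    also have "\<dots> = ln F + ((c + e) * real n + (\<Sum>i\<in>UNIV - {j}. ln (riem_norm G n (b i))))"
      using \<open>0 < F\<close> pos
      by (simp add: ln_mult_pos prod_pos) (rule ln_prod, use pos in \<open>auto simp: less_imp_neq[symmetric]\<close>)
    also have "ln (D * sqrt (det (gram G n))) = ln D + ln (sqrt (det (gram G n)))"
      by (rule ln_mult_pos[OF D Vpos])
    finally have "(ln D + ln (sqrt (det (gram G n)))) / real n
        \<le> (ln F + ((c + e) * real n + (\<Sum>i\<in>UNIV - {j}. ln (riem_norm G n (b i))))) / real n"
      by (rule divide_right_mono) simp
    then show ?thesis using n(2) by (simp add: add_divide_distrib sum_divide_distrib)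
  qed
  have ev: "\<forall>\<^sub>F n in sequentially. ln D / real n + ln (sqrt (det (gram G n))) / real n
      \<le> ln F / real n + (c + e) + (\<Sum>i\<in>UNIV - {j}. ln (riem_norm G n (b i)) / real n)"
  proof -
    have "\<forall>\<^sub>F n in sequentially. \<exists>a. riem_norm G n (v + a *\<^sub>R b i0) \<le> exp ((c + e) * real n)"
      using v \<open>e > 0\<close> unfolding slow_mod_def by blast
    with eventually_gt_at_top[of 0] show ?thesis by eventually_elim (use ineq in blast)
  qed
  have "0 + (\<Sum>i\<in>UNIV. k i) \<le> 0 + (c + e) + (\<Sum>i\<in>UNIV - {j}. k i)"
  proof (rule tendsto_le[OF sequentially_bot _ _ ev])
    show "(\<lambda>n. ln F / real n + (c + e) + (\<Sum>i\<in>UNIV - {j}. ln (riem_norm G n (b i)) / real n))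
        \<longlonglongrightarrow> 0 + (c + e) + (\<Sum>i\<in>UNIV - {j}. k i)"
      by (intro tendsto_add tendsto_const lim_const_over_n tendsto_sum k)
    show "(\<lambda>n. ln D / real n + ln (sqrt (det (gram G n))) / real n) \<longlonglongrightarrow> 0 + (\<Sum>i\<in>UNIV. k i)"
      by (intro tendsto_add lim_const_over_n V)
  qed
  moreover have "(\<Sum>i\<in>UNIV. k i) = k j + (\<Sum>i\<in>UNIV - {j}. k i)"
    by (rule sum.remove) auto
  ultimately show "k j \<le> c + e" by simp
qed

text \<open>A slow vector has nonzero coordinates only at slow frame vectors and at
  \<open>i0\<close>. The direction \<open>b i0\<close> belongs to the space for every
  \<open>c\<close> because \<open>a = - 1\<close> cancels it.\<close>

lemma slow_mod_frame:
  fixes b :: "'n::finite \<Rightarrow> real^'n"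
  assumes fr: "adapted_frame G b k"
  shows "slow_mod G (b i0) c = span (b ` {i. k i \<le> c \<or> i = i0})"
proof
  have G: "inner_form (G n)" for n using fr by (simp add: adapted_frame_def)
  have sp: "span (range b) = UNIV" using fr by (simp add: adapted_frame_def)
  have b0: "b i \<noteq> 0" for i
    using spanning_family_independent(2)[OF sp] dependent_zero by (metis rangeI)
  show "slow_mod G (b i0) c \<subseteq> span (b ` {i. k i \<le> c \<or> i = i0})"
  proof
    fix v assume v: "v \<in> slow_mod G (b i0) c"
    obtain x where x: "v = (\<Sum>i\<in>UNIV. x i *\<^sub>R b i)"
      by (rule spanning_family_expand[OF sp])
    have "x i *\<^sub>R b i \<in> span (b ` {i. k i \<le> c \<or> i = i0})" for i
    proof (cases "x i = 0 \<or> i = i0")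
      case True
      then show ?thesis by (auto intro: span_zero span_scale span_base)
    next
      case False
      then have "k i \<le> c" using slow_mod_frame_le[OF fr x _ _ v] by blast
      then show ?thesis by (auto intro: span_scale span_base)
    qed
    then show "v \<in> span (b ` {i. k i \<le> c \<or> i = i0})"
      unfolding x by (rule span_sum)
  qed
  show "span (b ` {i. k i \<le> c \<or> i = i0}) \<subseteq> slow_mod G (b i0) c"
  proof (rule span_minimal[OF _ subspace_slow_mod[OF G]], safe)
    fix i assume i: "k i \<le> c"
    have *: "\<forall>\<^sub>F n in sequentially. riem_norm G n (b i) \<le> exp ((c + e) * real n)" if "e > 0" for e
    proof (rule eventually_le_exp_rate)
      show "(\<lambda>n. ln (riem_norm G n (b i)) / real n) \<longlonglongrightarrow> k i"
        using fr by (simp add: adapted_frame_def)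
      show "0 < riem_norm G n (b i)" for n by (rule riem_norm_pos[of G, OF G b0])
    qed (use i that in simp)
    show "b i \<in> slow_mod G (b i0) c"
      unfolding slow_mod_def
    proof (intro CollectI allI impI)
      fix e :: real assume "e > 0"
      with * have "\<forall>\<^sub>F n in sequentially. riem_norm G n (b i) \<le> exp ((c + e) * real n)" .
      then show "\<forall>\<^sub>F n in sequentially. \<exists>a. riem_norm G n (b i + a *\<^sub>R b i0) \<le> exp ((c + e) * real n)"
        by eventually_elim (rule exI[of _ 0], simp)
    qed
  next
    show "b i0 \<in> slow_mod G (b i0) c"
      unfolding slow_mod_def
      by (auto intro!: always_eventually exI[of _ "-1"] simp: riem_norm_zero[of G, OF G])
  qed
qed

lemma multiset_eq_lower_counts:
  fixes M N :: "'b::linorder multiset"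
  assumes "\<And>a. size {#x \<in># M. x \<le> a#} = size {#x \<in># N. x \<le> a#}"
  shows "M = N"
proof (rule multiset_eqI)
  fix a
  have split: "size {#x \<in># X. x \<le> a#} = size {#x \<in># X. x < a#} + count X a" for X :: "'b multiset"
  proof -
    have "{#x \<in># X. x \<le> a#} = {#x \<in># X. x < a#} + {#x \<in># X. x = a#}"
      by (rule multiset_eqI) (auto simp: le_less)
    then have "size {#x \<in># X. x \<le> a#} = size {#x \<in># X. x < a#} + size {#x \<in># X. x = a#}"
      by (metis size_union)
    moreover have "{#x \<in># X. x = a#} = replicate_mset (count X a) a"
      by (rule multiset_eqI) auto
    ultimately show ?thesis by simp
  qed
  \<comment> \<open>The entries below \<open>a\<close> are those up to the largest value below
    \<open>a\<close> that occurs in either multiset, so the hypothesis applies at that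
    value.\<close>
  define S where "S = {x \<in> set_mset M \<union> set_mset N. x < a}"
  have "finite S" by (simp add: S_def)
  have "size {#x \<in># M. x < a#} = size {#x \<in># N. x < a#}"
  proof (cases "S = {}")
    case True
    then have "filter_mset (\<lambda>x. x < a) M = {#}" "filter_mset (\<lambda>x. x < a) N = {#}"
      by (auto simp: S_def)
    then show ?thesis by (simp only:)
  next
    case False
    then have max: "Max S \<in> S" "\<And>x. x \<in> S \<Longrightarrow> x \<le> Max S" using \<open>finite S\<close> by auto
    then have "Max S < a" by (simp add: S_def)
    then have "{#x \<in># M. x < a#} = {#x \<in># M. x \<le> Max S#}" "{#x \<in># N. x < a#} = {#x \<in># N. x \<le> Max S#}"
      using max(2) by (auto intro!: filter_mset_cong simp: S_def)
    then show ?thesis using assms by simp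
  qed
  then show "count M a = count N a" using assms[of a] by (simp add: split)
qed

text \<open>The dimension of \<open>slow_mod G f c\<close> counts the exponents up to
  \<open>c\<close>, except that the direction \<open>f\<close> is counted for every
  \<open>c\<close>. As \<open>f\<close> has exponent \<open>0\<close> in both frames, the surplus is
  one for \<open>c < 0\<close> and none otherwise, on both sides. The remaining counts determine the
  multiset.\<close>

theorem adapted_frames_same_exponents:
  fixes b b' :: "'n::finite \<Rightarrow> real^'n"
  assumes fr: "adapted_frame G b k" and fr': "adapted_frame G' b' k'"
    and f: "b i0 = f" "b' j0 = f" "k i0 = 0" "k' j0 = 0"
    and slow: "\<And>c. slow_mod G f c = slow_mod G' f c"
  shows "image_mset k (mset_set UNIV) = image_mset k' (mset_set UNIV)"
proof (rule multiset_eq_lower_counts)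
  fix c
  have dim: "dim (slow_mod G (b i0) c) = card {i. k i \<le> c \<or> i = i0}"
    if "adapted_frame G b k" for G and b :: "'n \<Rightarrow> real^'n" and k i0
  proof -
    have sp: "span (range b) = UNIV" using that by (simp add: adapted_frame_def)
    have "independent (b ` {i. k i \<le> c \<or> i = i0})"
      by (rule independent_mono[OF spanning_family_independent(2)[OF sp]]) auto
    then have "dim (slow_mod G (b i0) c) = card (b ` {i. k i \<le> c \<or> i = i0})"
      unfolding slow_mod_frame[OF that] by (simp add: dim_eq_card_independent)
    also have "\<dots> = card {i. k i \<le> c \<or> i = i0}"
      by (rule card_image) (use spanning_family_independent(1)[OF sp] in \<open>auto intro: inj_on_subset\<close>)
    finally show ?thesis .
  qed
  have count: "card {i. k i \<le> c \<or> i = i0} = card {i. k i \<le> c} + (if c < 0 then 1 else 0)"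
    if "k i0 = 0" for k :: "'n \<Rightarrow> real" and i0
  proof (cases "c < 0")
    case True
    have "{i. k i \<le> c \<or> i = i0} = insert i0 {i. k i \<le> c}" by auto
    then show ?thesis using True that by simp
  next
    case False
    then have "{i. k i \<le> c \<or> i = i0} = {i. k i \<le> c}" using that by auto
    then show ?thesis using False by simp
  qed
  have "card {i. k i \<le> c \<or> i = i0} = card {i. k' i \<le> c \<or> i = j0}"
    using dim[OF fr, of i0] dim[OF fr', of j0] slow[of c] f by simp
  then have "card {i. k i \<le> c} = card {i. k' i \<le> c}"
    using count[of k i0] count[of k' j0] f by simp
  then show "size {#x \<in># image_mset k (mset_set UNIV). x \<le> c#} = size {#x \<in># image_mset k' (mset_set UNIV). x \<le> c#}"
    by (simp add: filter_mset_image_mset)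
qed

lemma slow_mod_mono:
  assumes "\<And>n v. \<exists>a. riem_norm G' n (v + a *\<^sub>R f) = riem_norm G n v"
  shows "slow_mod G f c \<subseteq> slow_mod G' f c"
proof
  fix v assume v: "v \<in> slow_mod G f c"
  show "v \<in> slow_mod G' f c"
    unfolding slow_mod_def
  proof (intro CollectI allI impI)
    fix e :: real assume "e > 0"
    then have "\<forall>\<^sub>F n in sequentially. \<exists>a. riem_norm G n (v + a *\<^sub>R f) \<le> exp ((c + e) * real n)"
      using v unfolding slow_mod_def by blast
    then show "\<forall>\<^sub>F n in sequentially. \<exists>a. riem_norm G' n (v + a *\<^sub>R f) \<le> exp ((c + e) * real n)"
    proof eventually_elim
      case (elim n)
      then obtain a where a: "riem_norm G n (v + a *\<^sub>R f) \<le> exp ((c + e) * real n)" by blast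
      obtain a' where "riem_norm G' n (v + a *\<^sub>R f + a' *\<^sub>R f) = riem_norm G n (v + a *\<^sub>R f)"
        using assms by blast
      then have "riem_norm G' n (v + (a + a') *\<^sub>R f) \<le> exp ((c + e) * real n)"
        using a by (simp add: algebra_simps)
      then show ?case by blast
    qed
  qed
qed

text \<open>The strict maximum makes every other term exponentially small compared with
  \<open>w m\<close>. The sum therefore cannot cancel, and its norm divided by that of
  \<open>w m\<close> tends to \<open>1\<close>.\<close>

lemma rate_dominant_sum:
  fixes G :: "nat \<Rightarrow> real^'n \<Rightarrow> real^'n::finite \<Rightarrow> real" and w :: "'k \<Rightarrow> real^'n"
  assumes G: "\<And>n. inner_form (G n)" and K: "finite K" "m \<in> K"
    and w: "\<And>i. i \<in> K \<Longrightarrow> w i \<noteq> 0"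
    and rate: "\<And>i. i \<in> K \<Longrightarrow> (\<lambda>n. ln (riem_norm G n (w i)) / real n) \<longlonglongrightarrow> e i"
    and max: "\<And>i. i \<in> K \<Longrightarrow> i \<noteq> m \<Longrightarrow> e i < e m"
  shows "(\<lambda>n. ln (riem_norm G n (\<Sum>i\<in>K. w i)) / real n) \<longlonglongrightarrow> e m"
proof -
  have pos: "0 < riem_norm G n (w i)" if "i \<in> K" for i n
    by (rule riem_norm_pos[of G, OF G w[OF that]])
  define R where "R n v = riem_norm G n v / riem_norm G n (w m)" for n v
  have small: "(\<lambda>n. R n (w i)) \<longlonglongrightarrow> 0" if i: "i \<in> K" "i \<noteq> m" for i
  proof -
    have "(\<lambda>n. ln (R n (w i)) / real n) \<longlonglongrightarrow> e i - e m"
    proof -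
      have "(\<lambda>n. ln (riem_norm G n (w i)) / real n - ln (riem_norm G n (w m)) / real n) \<longlonglongrightarrow> e i - e m"
        by (intro tendsto_diff rate i K)
      moreover have "ln (riem_norm G n (w i)) / real n - ln (riem_norm G n (w m)) / real n
          = ln (R n (w i)) / real n" for n
        using pos[OF i(1), of n] pos[OF K(2), of n] by (simp add: R_def ln_divide_pos diff_divide_distrib)
      ultimately show ?thesis by simp
    qed
    \<comment> \<open>Half of the gap between the exponents leaves room for passing from a limit
      rate to an exponential bound.\<close>
    moreover define d where "d = (e m - e i) / 2"
    have d: "d > 0" "e i - e m < - d" using max[OF i] by (auto simp: d_def field_simps)
    ultimately have ev: "\<forall>\<^sub>F n in sequentially. R n (w i) \<le> exp (- d * real n)"
      by (intro eventually_le_exp_rate) (use pos i K in \<open>auto simp: R_def\<close>)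
    have "filterlim (\<lambda>n. d * real n) at_top sequentially"
      using d(1) by (intro filterlim_tendsto_pos_mult_at_top[OF tendsto_const] filterlim_real_sequentially)
    then have "(\<lambda>n. exp (- (d * real n))) \<longlonglongrightarrow> 0"
      by (intro filterlim_compose[OF exp_at_bot] filterlim_compose[OF filterlim_uminus_at_bot_at_top])
    then have "(\<lambda>n. exp (- d * real n)) \<longlonglongrightarrow> 0" by simp
    then show ?thesis
      by (rule tendsto_sandwich[OF _ ev tendsto_const, rotated])
         (use pos i K in \<open>auto simp: R_def less_imp_le\<close>)
  qed
  define s where "s = (\<Sum>i\<in>K. w i)"
  have s: "s = w m + (\<Sum>i\<in>K - {m}. w i)" unfolding s_def by (rule sum.remove[OF K])
  have dist: "\<bar>R n s - 1\<bar> \<le> (\<Sum>i\<in>K - {m}. R n (w i))" for n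
  proof -
    have N: "0 < riem_norm G n (w m)" by (rule pos[OF K(2)])
    have r: "riem_norm G n (\<Sum>i\<in>K - {m}. w i) \<le> (\<Sum>i\<in>K - {m}. riem_norm G n (w i))"
      by (rule riem_norm_sum_le[of G, OF G])
    have up: "riem_norm G n s \<le> riem_norm G n (w m) + riem_norm G n (\<Sum>i\<in>K - {m}. w i)"
      unfolding s by (rule riem_norm_triangle[of G, OF G])
    have "w m = s + (- 1) *\<^sub>R (\<Sum>i\<in>K - {m}. w i)" by (simp add: s)
    then have lo: "riem_norm G n (w m) \<le> riem_norm G n s + riem_norm G n (\<Sum>i\<in>K - {m}. w i)"
      using riem_norm_triangle[of G n s "(- 1) *\<^sub>R (\<Sum>i\<in>K - {m}. w i)", OF G]
        riem_norm_scale[of G n "- 1" "\<Sum>i\<in>K - {m}. w i", OF G] by simp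
    have "\<bar>riem_norm G n s - riem_norm G n (w m)\<bar> \<le> (\<Sum>i\<in>K - {m}. riem_norm G n (w i))"
      using up lo r by linarith
    then have "\<bar>riem_norm G n s - riem_norm G n (w m)\<bar> / riem_norm G n (w m)
        \<le> (\<Sum>i\<in>K - {m}. riem_norm G n (w i)) / riem_norm G n (w m)"
      by (rule divide_right_mono) (use N in simp)
    moreover have "\<bar>R n s - 1\<bar> = \<bar>riem_norm G n s - riem_norm G n (w m)\<bar> / riem_norm G n (w m)"
    proof -
      have "R n s - 1 = (riem_norm G n s - riem_norm G n (w m)) / riem_norm G n (w m)"
        using N by (simp add: R_def diff_divide_distrib)
      then show ?thesis using N by simp
    qed
    ultimately show ?thesis by (simp add: R_def sum_divide_distrib)
  qed
  have "(\<lambda>n. \<Sum>i\<in>K - {m}. R n (w i)) \<longlonglongrightarrow> (\<Sum>i\<in>K - {m}. 0)"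
    by (rule tendsto_sum) (use small in auto)
  then have sum0: "(\<lambda>n. \<Sum>i\<in>K - {m}. R n (w i)) \<longlonglongrightarrow> 0" by simp
  have "(\<lambda>n. R n s - 1) \<longlonglongrightarrow> 0"
    by (rule Lim_null_comparison[OF _ sum0]) (simp add: dist)
  then have R1: "(\<lambda>n. R n s) \<longlonglongrightarrow> 1"
    using tendsto_add[OF _ tendsto_const, of "\<lambda>n. R n s - 1" 0 sequentially 1] by simp
  then have "(\<lambda>n. ln (R n s)) \<longlonglongrightarrow> ln 1" by (rule tendsto_ln) simp
  then have "(\<lambda>n. ln (R n s) * (1 / real n)) \<longlonglongrightarrow> ln 1 * 0"
    by (intro tendsto_mult lim_1_over_n)
  then have "(\<lambda>n. ln (riem_norm G n (w m)) / real n + ln (R n s) * (1 / real n)) \<longlonglongrightarrow> e m + ln 1 * 0"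
    by (intro tendsto_add rate K)
  moreover have "\<forall>\<^sub>F n in sequentially. ln (riem_norm G n (w m)) / real n + ln (R n s) * (1 / real n)
      = ln (riem_norm G n s) / real n"
  proof -
    have "\<forall>\<^sub>F n in sequentially. 0 < R n s" using R1 by (rule order_tendstoD) simp
    then show ?thesis
    proof eventually_elim
      case (elim n)
      have N: "0 < riem_norm G n (w m)" by (rule pos[OF K(2)])
      have "riem_norm G n s = riem_norm G n (w m) * R n s" using N by (simp add: R_def)
      then have "ln (riem_norm G n s) = ln (riem_norm G n (w m)) + ln (R n s)"
        using N elim by (simp add: ln_mult_pos)
      then show ?case by (simp add: add_divide_distrib)
    qed
  qed
  ultimately show ?thesis unfolding s_def by (simp add: tendsto_cong)
qed

text \<open>A fixed isomorphism changes the Gram determinants by a constant factor, whose logarithm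
  vanishes after division by \<open>n\<close>. This serves to move a frame along an orbit.\<close>

lemma adapted_frame_push:
  fixes b :: "'n::finite \<Rightarrow> real^'n" and M :: "real^'n \<Rightarrow> real^'n"
  assumes fr: "adapted_frame G b k" and M: "linear M" "bij M"
    and G': "\<And>n. inner_form (G' n)" "\<And>n v w. G n v w = G' n (M v) (M w)"
  shows "adapted_frame G' (\<lambda>i. M (b i)) k"
  unfolding adapted_frame_def
proof (intro conjI allI)
  show "inner_form (G' n)" for n by (rule G')
  have "span (range (\<lambda>i. M (b i))) = M ` span (range b)"
    using linear_span_image[OF M(1), of "range b"] by (simp add: image_image)
  then show "span (range (\<lambda>i. M (b i))) = UNIV"
    using fr M by (simp add: adapted_frame_def bij_is_surj)
  have "riem_norm G' n (M v) = riem_norm G n v" for n v by (simp add: riem_norm_def G')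
  then show "(\<lambda>n. ln (riem_norm G' n (M (b i))) / real n) \<longlonglongrightarrow> k i" for i
    using fr by (simp add: adapted_frame_def)
  define D where "D = \<bar>det (matrix M)\<bar>"
  have "D > 0" using det_nz_iff_inj[OF M(1)] M(2) by (simp add: D_def bij_is_inj)
  have "ln (sqrt (det (gram G n))) / real n - ln D / real n = ln (sqrt (det (gram G' n))) / real n" for n
  proof -
    have "sqrt (det (gram G n)) = D * sqrt (det (gram G' n))"
      unfolding D_def by (rule gram_pullback[of M G' n G n, OF M(1) G'])
    then have "ln (sqrt (det (gram G n))) = ln D + ln (sqrt (det (gram G' n)))"
      using \<open>D > 0\<close> sqrt_det_gram_pos[of G', OF G'(1)] by (simp add: ln_mult_pos)
    then show ?thesis by (simp add: diff_divide_distrib[symmetric])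
  qed
  moreover have "(\<lambda>n. ln (sqrt (det (gram G n))) / real n - ln D / real n) \<longlonglongrightarrow> (\<Sum>i\<in>UNIV. k i) - 0"
    using fr by (intro tendsto_diff lim_const_over_n) (simp add: adapted_frame_def)
  ultimately show "(\<lambda>n. ln (sqrt (det (gram G' n))) / real n) \<longlonglongrightarrow> (\<Sum>i\<in>UNIV. k i)" by simp
qed

section \<open>Bases and growth rates from an Oseledets splitting\<close>

lemma dim_direct_sum:
  fixes E :: "'k \<Rightarrow> (real^'n::finite) set"
  assumes "finite K" and sub: "\<And>i. i \<in> K \<Longrightarrow> subspace (E i)"
    and ind: "\<And>w. (\<And>i. i \<in> K \<Longrightarrow> w i \<in> E i) \<Longrightarrow> (\<Sum>i\<in>K. w i) = 0 \<Longrightarrow> \<forall>i\<in>K. w i = 0"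
  shows "subspace {\<Sum>i\<in>K. w i |w. \<forall>i\<in>K. w i \<in> E i}
    \<and> dim {\<Sum>i\<in>K. w i |w. \<forall>i\<in>K. w i \<in> E i} = (\<Sum>i\<in>K. dim (E i))"
  using assms
proof (induction K rule: finite_induct)
  case empty
  show ?case by simp
next
  case (insert j K)
  let ?S = "{\<Sum>i\<in>K. w i |w. \<forall>i\<in>K. w i \<in> E i}"
  \<comment> \<open>A family on \<open>K\<close> is extended by \<open>0\<close> at
    \<open>j\<close>, so independence passes from \<open>insert j K\<close> to
    \<open>K\<close>.\<close>
  have ind: "\<forall>i\<in>K. w i = 0" if w: "\<And>i. i \<in> K \<Longrightarrow> w i \<in> E i" "(\<Sum>i\<in>K. w i) = 0" for w
  proof -
    have "\<forall>i\<in>insert j K. (w(j := 0)) i = 0"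
    proof (rule insert.prems(2))
      show "(w(j := 0)) i \<in> E i" if "i \<in> insert j K" for i
        using that w(1) insert.prems(1)[of j] insert.hyps(2) by (auto simp: subspace_0)
      have "(\<Sum>i\<in>K. (w(j := 0)) i) = (\<Sum>i\<in>K. w i)"
        by (rule sum.cong) (use insert.hyps(2) in auto)
      then show "(\<Sum>i\<in>insert j K. (w(j := 0)) i) = 0" using insert.hyps w(2) by simp
    qed
    then show ?thesis using insert.hyps(2) by (metis fun_upd_other insertCI)
  qed
  have IH: "subspace ?S" "dim ?S = (\<Sum>i\<in>K. dim (E i))"
    using insert.IH insert.prems(1) ind by auto
  have Ej: "subspace (E j)" using insert.prems(1) by simp
  have eq: "{\<Sum>i\<in>insert j K. w i |w. \<forall>i\<in>insert j K. w i \<in> E i} = {x + y |x y. x \<in> E j \<and> y \<in> ?S}"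
  proof safe
    fix w assume "\<forall>i\<in>insert j K. w i \<in> E i"
    then show "\<exists>x y. (\<Sum>i\<in>insert j K. w i) = x + y \<and> x \<in> E j \<and> y \<in> ?S"
      using insert.hyps by (intro exI[of _ "w j"] exI[of _ "\<Sum>i\<in>K. w i"]) auto
  next
    fix x w assume x: "x \<in> E j" and w: "\<forall>i\<in>K. w i \<in> E i"
    have "(\<Sum>i\<in>K. (w(j := x)) i) = (\<Sum>i\<in>K. w i)"
      by (rule sum.cong) (use insert.hyps(2) in auto)
    then have "x + (\<Sum>i\<in>K. w i) = (\<Sum>i\<in>insert j K. (w(j := x)) i)" using insert.hyps by simp
    moreover have "\<forall>i\<in>insert j K. (w(j := x)) i \<in> E i" using x w insert.hyps(2) by auto
    ultimately show "\<exists>w'. x + (\<Sum>i\<in>K. w i) = (\<Sum>i\<in>insert j K. w' i) \<and> (\<forall>i\<in>insert j K. w' i \<in> E i)"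
      by blast
  qed
  have "E j \<inter> ?S \<subseteq> {0}"
  proof safe
    fix w assume x: "(\<Sum>i\<in>K. w i) \<in> E j" and w: "\<forall>i\<in>K. w i \<in> E i"
    let ?x = "\<Sum>i\<in>K. w i"
    have s: "(\<Sum>i\<in>K. (w(j := - ?x)) i) = ?x"
      by (rule sum.cong) (use insert.hyps(2) in auto)
    have "\<forall>i\<in>insert j K. (w(j := - ?x)) i = 0"
    proof (rule insert.prems(2))
      show "(w(j := - ?x)) i \<in> E i" if "i \<in> insert j K" for i
        using that w x Ej insert.hyps(2) by (auto simp: subspace_neg)
      show "(\<Sum>i\<in>insert j K. (w(j := - ?x)) i) = 0" using insert.hyps s by simp
    qed
    then have "(w(j := - ?x)) j = 0" by blast
    then show "?x = 0" by simp
  qed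
  then have "E j \<inter> ?S = {0}" using subspace_0[OF Ej] subspace_0[OF IH(1)] by blast
  then have "dim {x + y |x y. x \<in> E j \<and> y \<in> ?S} = dim (E j) + dim ?S"
    using dim_sums_Int[OF Ej IH(1)] by simp
  then show ?case
    unfolding eq using subspace_sums[OF Ej IH(1)] insert.hyps IH(2) by simp
qed

definition exponent_list :: "real set \<Rightarrow> (real \<Rightarrow> (real^'n) set) \<Rightarrow> real list" where
  "exponent_list \<Lambda> E = concat (map (\<lambda>\<kappa>. replicate (dim (E \<kappa>)) \<kappa>) (sorted_list_of_set \<Lambda>))"

lemma count_exponent_list:
  assumes "finite \<Lambda>"
  shows "count (mset (exponent_list \<Lambda> E)) a = (if a \<in> \<Lambda> then dim (E a) else 0)"
proof -
  have "count (mset (concat (map (\<lambda>\<kappa>. replicate (dim (E \<kappa>)) \<kappa>) xs))) a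
      = (if a \<in> set xs then dim (E a) else 0)" if "distinct xs" for xs
    using that by (induction xs) auto
  then show ?thesis using assms by (simp add: exponent_list_def)
qed

lemma sorted_exponent_list: "sorted (exponent_list \<Lambda> E)"
proof -
  have "sorted (concat (map (\<lambda>\<kappa>. replicate (dim (E \<kappa>)) \<kappa>) xs))" if "sorted xs" for xs :: "real list"
    using that by (induction xs) (auto simp: sorted_append)
  then show ?thesis by (simp add: exponent_list_def)
qed

lemma sum_list_exponent_list:
  assumes "finite \<Lambda>"
  shows "sum_list (exponent_list \<Lambda> E) = (\<Sum>\<kappa>\<in>\<Lambda>. \<kappa> * real (dim (E \<kappa>)))"
proof -
  have "sum_list (concat (map (\<lambda>\<kappa>. replicate (dim (E \<kappa>)) \<kappa>) xs)) = (\<Sum>\<kappa>\<in>set xs. \<kappa> * real (dim (E \<kappa>)))"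
    if "distinct xs" for xs
    using that by (induction xs) (auto simp: sum_list_replicate mult.commute)
  then show ?thesis using assms by (simp add: exponent_list_def)
qed

lemma splitting_independent:
  fixes E :: "real \<Rightarrow> (real^'n::finite) set"
  assumes sub: "\<And>\<kappa>. \<kappa> \<in> \<Lambda> \<Longrightarrow> subspace (E \<kappa>)"
    and dec: "\<And>v. \<exists>!w. w \<in> Pi\<^sub>E \<Lambda> E \<and> v = (\<Sum>\<kappa>\<in>\<Lambda>. w \<kappa>)"
    and w: "\<And>\<kappa>. \<kappa> \<in> \<Lambda> \<Longrightarrow> w \<kappa> \<in> E \<kappa>" "(\<Sum>\<kappa>\<in>\<Lambda>. w \<kappa>) = 0"
  shows "\<forall>\<kappa>\<in>\<Lambda>. w \<kappa> = 0"
proof -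
  have "restrict w \<Lambda> \<in> Pi\<^sub>E \<Lambda> E \<and> 0 = (\<Sum>\<kappa>\<in>\<Lambda>. restrict w \<Lambda> \<kappa>)" using w by simp
  moreover have "restrict (\<lambda>_. 0) \<Lambda> \<in> Pi\<^sub>E \<Lambda> E \<and> 0 = (\<Sum>\<kappa>\<in>\<Lambda>. restrict (\<lambda>_. 0) \<Lambda> \<kappa>)"
    using sub by (simp add: subspace_0)
  ultimately have "restrict w \<Lambda> = restrict (\<lambda>_. 0) \<Lambda>" using dec[of 0] by blast
  then show ?thesis by (metis restrict_apply')
qed

lemma splitting_decomposition:
  assumes "\<exists>!w. w \<in> Pi\<^sub>E \<Lambda> E \<and> v = (\<Sum>\<kappa>\<in>\<Lambda>. w \<kappa>)"
  obtains w where "\<And>\<kappa>. \<kappa> \<in> \<Lambda> \<Longrightarrow> w \<kappa> \<in> E \<kappa>" "v = (\<Sum>\<kappa>\<in>\<Lambda>. w \<kappa>)"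
  using assms by (metis PiE_mem)

lemma splitting_dim:
  fixes E :: "real \<Rightarrow> (real^'n::finite) set"
  assumes fin: "finite \<Lambda>" and sub: "\<And>\<kappa>. \<kappa> \<in> \<Lambda> \<Longrightarrow> subspace (E \<kappa>)"
    and dec: "\<And>v. \<exists>!w. w \<in> Pi\<^sub>E \<Lambda> E \<and> v = (\<Sum>\<kappa>\<in>\<Lambda>. w \<kappa>)"
  shows "(\<Sum>\<kappa>\<in>\<Lambda>. dim (E \<kappa>)) = CARD('n)"
proof -
  have "v \<in> {\<Sum>\<kappa>\<in>\<Lambda>. w \<kappa> |w. \<forall>\<kappa>\<in>\<Lambda>. w \<kappa> \<in> E \<kappa>}" for v
    by (rule splitting_decomposition[OF dec[of v]]) blast
  then have "{\<Sum>\<kappa>\<in>\<Lambda>. w \<kappa> |w. \<forall>\<kappa>\<in>\<Lambda>. w \<kappa> \<in> E \<kappa>} = UNIV" by blast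
  moreover have "subspace {\<Sum>\<kappa>\<in>\<Lambda>. w \<kappa> |w. \<forall>\<kappa>\<in>\<Lambda>. w \<kappa> \<in> E \<kappa>}
      \<and> dim {\<Sum>\<kappa>\<in>\<Lambda>. w \<kappa> |w. \<forall>\<kappa>\<in>\<Lambda>. w \<kappa> \<in> E \<kappa>} = (\<Sum>\<kappa>\<in>\<Lambda>. dim (E \<kappa>))"
    by (rule dim_direct_sum[OF fin sub splitting_independent[OF sub dec]])
  ultimately show ?thesis
    by (simp only: dim_UNIV DIM_cart DIM_real mult_1_right)
qed

lemma length_exponent_list:
  assumes "oseledets_splitting A g \<Phi> x (\<Lambda>, E)"
  shows "length (exponent_list \<Lambda> (E :: real \<Rightarrow> (real^'n::finite) set)) = CARD('n)"
proof -
  have fin: "finite \<Lambda>" and sub: "\<And>\<kappa>. \<kappa> \<in> \<Lambda> \<Longrightarrow> subspace (E \<kappa>)"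
    and dec: "\<And>v. \<exists>!w. w \<in> Pi\<^sub>E \<Lambda> E \<and> v = (\<Sum>\<kappa>\<in>\<Lambda>. w \<kappa>)"
    using assms unfolding oseledets_splitting_def by auto
  have "length (concat (map (\<lambda>\<kappa>. replicate (dim (E \<kappa>)) \<kappa>) xs)) = (\<Sum>\<kappa>\<in>set xs. dim (E \<kappa>))"
    if "distinct xs" for xs :: "real list"
    using that by (induction xs) auto
  then show ?thesis using fin splitting_dim[OF fin sub dec] by (simp add: exponent_list_def)
qed

text \<open>Bases of the spaces \<open>E \<kappa>\<close> are joined into one indexed by
  \<open>'n\<close>. The basis of \<open>E 0\<close> is extended from \<open>f\<close>, because
  growth modulo the flow direction is read off from a frame that contains this direction.\<close>

lemma splitting_basis:
  fixes E :: "real \<Rightarrow> (real^'n::finite) set"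
  assumes fin: "finite \<Lambda>" and sub: "\<And>\<kappa>. \<kappa> \<in> \<Lambda> \<Longrightarrow> subspace (E \<kappa>)"
    and dec: "\<And>v. \<exists>!w. w \<in> Pi\<^sub>E \<Lambda> E \<and> v = (\<Sum>\<kappa>\<in>\<Lambda>. w \<kappa>)"
    and f: "0 \<in> \<Lambda>" "f \<in> E 0" "f \<noteq> 0"
  obtains b :: "'n \<Rightarrow> real^'n" and k i0 where "span (range b) = UNIV"
    "\<And>i. k i \<in> \<Lambda>" "\<And>i. b i \<in> E (k i)" "b i0 = f" "k i0 = 0"
    "image_mset k (mset_set UNIV) = mset (exponent_list \<Lambda> E)"
proof -
  have "\<exists>B. B \<subseteq> E \<kappa> \<and> independent B \<and> E \<kappa> \<subseteq> span B \<and> (\<kappa> = 0 \<longrightarrow> f \<in> B)" if "\<kappa> \<in> \<Lambda>" for \<kappa>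
  proof (cases "\<kappa> = 0")
    case True
    have "{f} \<subseteq> E \<kappa>" "independent {f}" using f True by auto
    then obtain B where "{f} \<subseteq> B" "B \<subseteq> E \<kappa>" "independent B" "E \<kappa> \<subseteq> span B"
      by (rule maximal_independent_subset_extend)
    then show ?thesis by blast
  next
    case False
    then show ?thesis using basis_exists[of "E \<kappa>"] by metis
  qed
  then obtain B where B: "\<And>\<kappa>. \<kappa> \<in> \<Lambda> \<Longrightarrow> B \<kappa> \<subseteq> E \<kappa>" "\<And>\<kappa>. \<kappa> \<in> \<Lambda> \<Longrightarrow> independent (B \<kappa>)"
    "\<And>\<kappa>. \<kappa> \<in> \<Lambda> \<Longrightarrow> E \<kappa> \<subseteq> span (B \<kappa>)" and fB: "f \<in> B 0"
    using f(1) by metis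
  have cardB: "card (B \<kappa>) = dim (E \<kappa>)" if "\<kappa> \<in> \<Lambda>" for \<kappa>
    using basis_card_eq_dim[of "B \<kappa>" "E \<kappa>"] B that by blast
  have finB: "finite (B \<kappa>)" if "\<kappa> \<in> \<Lambda>" for \<kappa>
    using B(2)[OF that] by (rule independent_imp_finite)
  have dims: "(\<Sum>\<kappa>\<in>\<Lambda>. dim (E \<kappa>)) = CARD('n)" by (rule splitting_dim[OF fin sub dec])
  \<comment> \<open>Tagging the vectors with their exponents makes the union disjoint by
    construction and turns the first component into the exponent function.\<close>
  define I where "I = Sigma \<Lambda> B"
  have "finite I" using fin finB by (auto simp: I_def)
  have "card I = CARD('n)"
    unfolding I_def using fin finB cardB dims by (simp add: card_SigmaI)
  then obtain h where h: "bij_betw h (UNIV :: 'n set) I"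
    using \<open>finite I\<close> by (metis bij_betw_iff_card finite_class.finite_UNIV)
  have hI: "h i \<in> I" for i using h by (auto simp: bij_betw_def)
  have "(0, f) \<in> I" using f fB by (auto simp: I_def)
  then obtain i0 where i0: "h i0 = (0, f)" using h by (metis bij_betw_imp_surj_on imageE)
  show ?thesis
  proof (rule that[of "snd \<circ> h" "fst \<circ> h" i0])
    show "(fst \<circ> h) i \<in> \<Lambda>" for i using hI[of i] by (auto simp: I_def)
    show "(snd \<circ> h) i \<in> E ((fst \<circ> h) i)" for i
      using hI[of i] subsetD[OF B(1)] by (auto simp: I_def)
    show "(snd \<circ> h) i0 = f" "(fst \<circ> h) i0 = 0" using i0 by auto
    have rb: "B \<kappa> \<subseteq> range (snd \<circ> h)" if "\<kappa> \<in> \<Lambda>" for \<kappa>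
    proof
      fix u assume "u \<in> B \<kappa>"
      then have "(\<kappa>, u) \<in> h ` UNIV" using h that by (auto simp: bij_betw_def I_def)
      then show "u \<in> range (snd \<circ> h)" by (metis comp_apply imageE rangeI snd_conv)
    qed
    have "v \<in> span (range (snd \<circ> h))" for v
    proof -
      obtain w where w: "\<And>\<kappa>. \<kappa> \<in> \<Lambda> \<Longrightarrow> w \<kappa> \<in> E \<kappa>" "v = (\<Sum>\<kappa>\<in>\<Lambda>. w \<kappa>)"
        by (rule splitting_decomposition[OF dec[of v]]) (rule that)
      have "w \<kappa> \<in> span (range (snd \<circ> h))" if "\<kappa> \<in> \<Lambda>" for \<kappa>
        using w(1)[OF that] B(3)[OF that] span_mono[OF rb[OF that]] by blast
      then show ?thesis unfolding w(2) by (rule span_sum)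
    qed
    then show "span (range (snd \<circ> h)) = UNIV" by blast
    show "image_mset (fst \<circ> h) (mset_set UNIV) = mset (exponent_list \<Lambda> E)"
    proof (rule multiset_eqI)
      fix a
      have "image_mset (fst \<circ> h) (mset_set UNIV) = image_mset fst (mset_set I)"
        using h image_mset_mset_set[of h UNIV] by (auto simp: bij_betw_def image_mset.compositionality[symmetric])
      then have "count (image_mset (fst \<circ> h) (mset_set UNIV)) a = card {p \<in> I. fst p = a}"
        using \<open>finite I\<close> by (auto simp: count_image_mset' intro!: arg_cong[of _ _ card])
      also have "{p \<in> I. fst p = a} = (if a \<in> \<Lambda> then Pair a ` B a else {})"
        by (auto simp: I_def)
      also have "card \<dots> = (if a \<in> \<Lambda> then dim (E a) else 0)"
        by (simp add: card_image inj_on_def cardB)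
      finally show "count (image_mset (fst \<circ> h) (mset_set UNIV)) a = count (mset (exponent_list \<Lambda> E)) a"
        by (simp only: count_exponent_list[OF fin])
    qed
  qed
qed

text \<open>The sign of \<open>\<sigma>\<close> decides whether \<open>s\<close> tends to plus or
  minus infinity. The quotient \<open>h t / t\<close> has the same limit \<open>k\<close> at both
  ends, so one formula covers forward and backward times.\<close>

lemma rate_along_sequence:
  fixes s :: "nat \<Rightarrow> real" and h :: "real \<Rightarrow> real"
  assumes top: "((\<lambda>t. 1 / t * h t) \<longlongrightarrow> k) at_top" and bot: "((\<lambda>t. 1 / t * h t) \<longlongrightarrow> k) at_bot"
    and s: "(\<lambda>n. s n / real n) \<longlonglongrightarrow> \<sigma>" and "\<sigma> \<noteq> 0"
  shows "(\<lambda>n. h (s n) / real n) \<longlonglongrightarrow> \<sigma> * k"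
proof -
  have eq: "\<forall>\<^sub>F n in sequentially. s n / real n * real n = s n"
    using eventually_gt_at_top[of 0] by eventually_elim simp
  have lim: "(\<lambda>n. 1 / s n * h (s n)) \<longlonglongrightarrow> k"
  proof (cases "\<sigma> > 0")
    case True
    have "filterlim (\<lambda>n. s n / real n * real n) at_top sequentially"
      by (rule filterlim_tendsto_pos_mult_at_top[OF s True filterlim_real_sequentially])
    then have "filterlim s at_top sequentially"
      using eq by (simp add: filterlim_cong)
    then show ?thesis by (rule filterlim_compose[OF top])
  next
    case False
    with \<open>\<sigma> \<noteq> 0\<close> have "\<sigma> < 0" by simp
    have "filterlim (\<lambda>n. s n / real n * real n) at_bot sequentially"
      by (rule filterlim_tendsto_neg_mult_at_bot[OF s \<open>\<sigma> < 0\<close> filterlim_real_sequentially])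
    then have "filterlim s at_bot sequentially"
      using eq by (simp add: filterlim_cong)
    then show ?thesis by (rule filterlim_compose[OF bot])
  qed
  have ne: "\<forall>\<^sub>F n in sequentially. s n / real n \<noteq> 0"
    using s \<open>\<sigma> \<noteq> 0\<close> by (rule tendsto_imp_eventually_ne)
  have "(\<lambda>n. s n / real n * (1 / s n * h (s n))) \<longlonglongrightarrow> \<sigma> * k"
    by (rule tendsto_mult[OF s lim])
  moreover have "\<forall>\<^sub>F n in sequentially. s n / real n * (1 / s n * h (s n)) = h (s n) / real n"
    using ne by eventually_elim auto
  ultimately show ?thesis by (simp add: tendsto_cong)
qed

text \<open>All times are compared on the single tangent space at \<open>x\<close>. Time takes the
  place of the base point, so \<open>riem_norm\<close> and \<open>gram\<close> apply to the family
  as they stand.\<close>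

definition pulled_metric ::
  "('a, 'n::finite) chart set \<Rightarrow> ('a \<Rightarrow> real^'n \<Rightarrow> real^'n \<Rightarrow> real) \<Rightarrow> (real \<Rightarrow> 'a \<Rightarrow> 'a) \<Rightarrow> 'a \<Rightarrow>
     real \<Rightarrow> real^'n \<Rightarrow> real^'n \<Rightarrow> real" where
  "pulled_metric A g \<Phi> x t v w = g (\<Phi> t x) (tangent_map A (\<Phi> t) x v) (tangent_map A (\<Phi> t) x w)"

lemma riem_norm_pulled_metric:
  "riem_norm (pulled_metric A g \<Phi> x) t v = riem_norm g (\<Phi> t x) (tangent_map A (\<Phi> t) x v)"
  by (simp add: riem_norm_def pulled_metric_def)

lemma riem_norm_reindex: "riem_norm (\<lambda>n. G (s n)) n v = riem_norm G (s n) v"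
  by (simp add: riem_norm_def)

lemma gram_reindex: "gram (\<lambda>n. G (s n)) n = gram G (s n)"
  by (simp add: gram_def)

lemma splitting_rates:
  assumes os: "oseledets_splitting A g \<Phi> x (\<Lambda>, E)"
    and s: "(\<lambda>n. s n / real n) \<longlonglongrightarrow> \<sigma>" "\<sigma> \<noteq> 0"
  shows "\<kappa> \<in> \<Lambda> \<Longrightarrow> v \<in> E \<kappa> \<Longrightarrow> v \<noteq> 0 \<Longrightarrow>
      (\<lambda>n. ln (riem_norm (\<lambda>n. pulled_metric A g \<Phi> x (s n)) n v) / real n) \<longlonglongrightarrow> \<sigma> * \<kappa>"
    and "(\<lambda>n. ln (riem_det g x (\<Phi> (s n) x) (tangent_map A (\<Phi> (s n)) x)) / real n)
      \<longlonglongrightarrow> \<sigma> * (\<Sum>\<kappa>\<in>\<Lambda>. \<kappa> * real (dim (E \<kappa>)))"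
proof -
  assume "\<kappa> \<in> \<Lambda>" "v \<in> E \<kappa>" "v \<noteq> 0"
  then have "((\<lambda>t. 1 / t * ln (riem_norm g (\<Phi> t x) (tangent_map A (\<Phi> t) x v))) \<longlongrightarrow> \<kappa>) at_top"
    "((\<lambda>t. 1 / t * ln (riem_norm g (\<Phi> t x) (tangent_map A (\<Phi> t) x v))) \<longlongrightarrow> \<kappa>) at_bot"
    using os unfolding oseledets_splitting_def by auto
  from rate_along_sequence[OF this s]
  show "(\<lambda>n. ln (riem_norm (\<lambda>n. pulled_metric A g \<Phi> x (s n)) n v) / real n) \<longlonglongrightarrow> \<sigma> * \<kappa>"
    by (simp add: riem_norm_reindex riem_norm_pulled_metric)
next
  have "((\<lambda>t. 1 / t * ln (riem_det g x (\<Phi> t x) (tangent_map A (\<Phi> t) x))) \<longlongrightarrow> (\<Sum>\<kappa>\<in>\<Lambda>. \<kappa> * real (dim (E \<kappa>)))) at_top"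
    "((\<lambda>t. 1 / t * ln (riem_det g x (\<Phi> t x) (tangent_map A (\<Phi> t) x))) \<longlongrightarrow> (\<Sum>\<kappa>\<in>\<Lambda>. \<kappa> * real (dim (E \<kappa>)))) at_bot"
    using os unfolding oseledets_splitting_def by auto
  from rate_along_sequence[OF this s]
  show "(\<lambda>n. ln (riem_det g x (\<Phi> (s n) x) (tangent_map A (\<Phi> (s n)) x)) / real n)
      \<longlonglongrightarrow> \<sigma> * (\<Sum>\<kappa>\<in>\<Lambda>. \<kappa> * real (dim (E \<kappa>)))" .
qed

text \<open>By \<open>gram_pullback\<close> the square root of the Gram determinant of the pulled
  back metric is \<open>riem_det\<close> up to a factor that depends only on \<open>x\<close>, so
  the determinant condition of regularity becomes the volume condition of a frame. The factor
  \<open>\<sigma>\<close> accounts for times that grow like \<open>\<sigma> * n\<close>.\<close>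

lemma splitting_adapted_frame:
  fixes A :: "('a, 'n::finite) chart set"
  assumes os: "oseledets_splitting A g \<Phi> x (\<Lambda>, E)"
    and g: "\<And>y. inner_form (g y)"
    and T: "\<And>t. linear (tangent_map A (\<Phi> t) x)" "\<And>t. bij (tangent_map A (\<Phi> t) x)"
    and f: "0 \<in> \<Lambda>" "f \<in> E 0" "f \<noteq> 0"
    and s: "(\<lambda>n. s n / real n) \<longlonglongrightarrow> \<sigma>" "\<sigma> \<noteq> 0"
  obtains b :: "'n \<Rightarrow> real^'n" and k i0 where
    "adapted_frame (\<lambda>n. pulled_metric A g \<Phi> x (s n)) b (\<lambda>i. \<sigma> * k i)"
    "b i0 = f" "k i0 = 0" "image_mset k (mset_set UNIV) = mset (exponent_list \<Lambda> E)"
proof -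
  have fin: "finite \<Lambda>" and sub: "\<And>\<kappa>. \<kappa> \<in> \<Lambda> \<Longrightarrow> subspace (E \<kappa>)"
    and dec: "\<And>v. \<exists>!w. w \<in> Pi\<^sub>E \<Lambda> E \<and> v = (\<Sum>\<kappa>\<in>\<Lambda>. w \<kappa>)"
    using os unfolding oseledets_splitting_def by auto
  obtain b :: "'n \<Rightarrow> real^'n" and k i0 where b: "span (range b) = UNIV"
    "\<And>i. k i \<in> \<Lambda>" "\<And>i. b i \<in> E (k i)" "b i0 = f" "k i0 = 0"
    and ms: "image_mset k (mset_set UNIV) = mset (exponent_list \<Lambda> E)"
    using splitting_basis[OF fin sub dec f] by blast
  have b0: "b i \<noteq> 0" for i
    using spanning_family_independent(2)[OF b(1)] dependent_zero by (metis rangeI)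
  have "(\<Sum>i\<in>UNIV. k i) = sum_mset (image_mset k (mset_set UNIV))"
    by (simp add: sum_unfold_sum_mset)
  then have sumk: "(\<Sum>i\<in>UNIV. k i) = (\<Sum>\<kappa>\<in>\<Lambda>. \<kappa> * real (dim (E \<kappa>)))"
    by (simp add: ms sum_mset_sum_list sum_list_exponent_list[OF fin])
  have pm: "inner_form (pulled_metric A g \<Phi> x t)" for t
    using inner_form_pullback[OF g T(1) bij_is_inj[OF T(2)], of "\<Phi> t x" t]
    by (simp add: pulled_metric_def[abs_def])
  show ?thesis
  proof (rule that[of b k i0, OF _ b(4,5) ms])
    show "adapted_frame (\<lambda>n. pulled_metric A g \<Phi> x (s n)) b (\<lambda>i. \<sigma> * k i)"
      unfolding adapted_frame_def
    proof (intro conjI allI)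
      show "inner_form (pulled_metric A g \<Phi> x (s n))" for n by (rule pm)
      show "span (range b) = UNIV" by (rule b)
      show "(\<lambda>n. ln (riem_norm (\<lambda>n. pulled_metric A g \<Phi> x (s n)) n (b i)) / real n) \<longlonglongrightarrow> \<sigma> * k i" for i
        by (rule splitting_rates(1)[OF os s b(2,3) b0])
      define D where "D = sqrt (det (gram g x))"
      have D: "D > 0" unfolding D_def by (rule sqrt_det_gram_pos) (rule g)
      have eq: "ln (sqrt (det (gram (\<lambda>n. pulled_metric A g \<Phi> x (s n)) n)))
          = ln (riem_det g x (\<Phi> (s n) x) (tangent_map A (\<Phi> (s n)) x)) + ln D" for n
      proof -
        let ?L = "tangent_map A (\<Phi> (s n)) x"
        have "sqrt (det (gram (pulled_metric A g \<Phi> x) (s n)))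
            = \<bar>det (matrix ?L)\<bar> * sqrt (det (gram g (\<Phi> (s n) x)))"
          by (rule gram_pullback[OF T(1)]) (simp_all add: g pulled_metric_def)
        also have "\<dots> = riem_det g x (\<Phi> (s n) x) ?L * D"
          using D by (simp add: riem_det_def D_def)
        finally have e: "sqrt (det (gram (pulled_metric A g \<Phi> x) (s n))) = riem_det g x (\<Phi> (s n) x) ?L * D" .
        moreover have "0 < sqrt (det (gram (pulled_metric A g \<Phi> x) (s n)))"
          by (rule sqrt_det_gram_pos) (rule pm)
        ultimately have "0 < riem_det g x (\<Phi> (s n) x) ?L" using D by (simp add: zero_less_mult_iff)
        with D e show ?thesis by (simp add: gram_reindex ln_mult_pos)
      qed
      have "(\<lambda>n. ln (riem_det g x (\<Phi> (s n) x) (tangent_map A (\<Phi> (s n)) x)) / real n + ln D / real n)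
          \<longlonglongrightarrow> \<sigma> * (\<Sum>\<kappa>\<in>\<Lambda>. \<kappa> * real (dim (E \<kappa>))) + 0"
        by (intro tendsto_add lim_const_over_n splitting_rates(2)[OF os s])
      then show "(\<lambda>n. ln (sqrt (det (gram (\<lambda>n. pulled_metric A g \<Phi> x (s n)) n))) / real n)
          \<longlonglongrightarrow> (\<Sum>i\<in>UNIV. \<sigma> * k i)"
        unfolding eq by (simp add: add_divide_distrib sumk flip: sum_distrib_left)
    qed
  qed
qed

text \<open>For \<open>\<sigma> < 0\<close> the dominant exponent \<open>m\<close> is the smallest one that occurs.\<close>

lemma splitting_limit:
  fixes A :: "('a, 'n::finite) chart set"
  assumes os: "oseledets_splitting A g \<Phi> x (\<Lambda>, E)"
    and pm: "\<And>t. inner_form (pulled_metric A g \<Phi> x t)"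
    and w: "\<And>\<kappa>. \<kappa> \<in> \<Lambda> \<Longrightarrow> w \<kappa> \<in> E \<kappa>" "f = (\<Sum>\<kappa>\<in>\<Lambda>. w \<kappa>)" "f \<noteq> 0"
    and s: "(\<lambda>n. s n / real n) \<longlonglongrightarrow> \<sigma>" "\<sigma> \<noteq> 0"
  obtains m where "m \<in> \<Lambda>" "w m \<noteq> 0" "\<And>\<kappa>. \<kappa> \<in> \<Lambda> \<Longrightarrow> w \<kappa> \<noteq> 0 \<Longrightarrow> \<sigma> * \<kappa> \<le> \<sigma> * m"
    "(\<lambda>n. ln (riem_norm (\<lambda>n. pulled_metric A g \<Phi> x (s n)) n f) / real n) \<longlonglongrightarrow> \<sigma> * m"
proof -
  have fin: "finite \<Lambda>" using os unfolding oseledets_splitting_def by auto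
  define K where "K = {\<kappa> \<in> \<Lambda>. w \<kappa> \<noteq> 0}"
  have "finite K" using fin by (simp add: K_def)
  have fK: "f = (\<Sum>\<kappa>\<in>K. w \<kappa>)"
    unfolding w(2) K_def by (rule sum.mono_neutral_right[OF fin]) auto
  have "K \<noteq> {}" using fK w(3) by auto
  then obtain m where m: "m \<in> K" "\<And>\<kappa>. \<kappa> \<in> K \<Longrightarrow> \<sigma> * \<kappa> \<le> \<sigma> * m"
  proof -
    have "Max ((*) \<sigma> ` K) \<in> (*) \<sigma> ` K" using \<open>finite K\<close> \<open>K \<noteq> {}\<close> by (intro Max_in) auto
    then obtain m where "m \<in> K" "Max ((*) \<sigma> ` K) = \<sigma> * m" by auto
    moreover have "\<sigma> * \<kappa> \<le> Max ((*) \<sigma> ` K)" if "\<kappa> \<in> K" for \<kappa>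
      using \<open>finite K\<close> that by (intro Max_ge) auto
    ultimately show ?thesis using that by metis
  qed
  show ?thesis
  proof (rule that)
    show "m \<in> \<Lambda>" "w m \<noteq> 0" using m(1) by (auto simp: K_def)
    show "\<sigma> * \<kappa> \<le> \<sigma> * m" if "\<kappa> \<in> \<Lambda>" "w \<kappa> \<noteq> 0" for \<kappa> using m(2) that by (simp add: K_def)
    show "(\<lambda>n. ln (riem_norm (\<lambda>n. pulled_metric A g \<Phi> x (s n)) n f) / real n) \<longlonglongrightarrow> \<sigma> * m"
      unfolding fK
    proof (rule rate_dominant_sum[OF pm \<open>finite K\<close> m(1)])
      show "w \<kappa> \<noteq> 0" if "\<kappa> \<in> K" for \<kappa> using that by (simp add: K_def)
      show "(\<lambda>n. ln (riem_norm (\<lambda>n. pulled_metric A g \<Phi> x (s n)) n (w \<kappa>)) / real n) \<longlonglongrightarrow> \<sigma> * \<kappa>"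
        if "\<kappa> \<in> K" for \<kappa>
        by (rule splitting_rates(1)[OF os s]) (use that w(1) in \<open>auto simp: K_def\<close>)
      show "\<sigma> * \<kappa> < \<sigma> * m" if "\<kappa> \<in> K" "\<kappa> \<noteq> m" for \<kappa>
        using m(2)[OF that(1)] that(2) s(2) by (auto simp: less_le)
    qed
  qed
qed

section \<open>Tangent maps in charts\<close>

lemma Ck_on_imp_continuous_on: "Ck_on k f S \<Longrightarrow> continuous_on S f"
  by (cases k) (auto intro!: continuous_at_imp_continuous_on differentiable_imp_continuous_within)

lemma Ck_on_imp_differentiable: "Ck_on k f S \<Longrightarrow> 1 \<le> k \<Longrightarrow> x \<in> S \<Longrightarrow> f differentiable (at x)"
  by (cases k) auto

locale Ck_manifold_atlas =
  fixes A :: "('a::{t2_space,second_countable_topology}, 'n::finite) chart set" and m :: nat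
  assumes manifold: "Ck_manifold m A"
begin

lemma chart_at:
  shows "chart_at A x \<in> A" "x \<in> fst (chart_at A x)"
  using manifold someI_ex[of "\<lambda>c. c \<in> A \<and> x \<in> fst c"]
  unfolding chart_at_def Ck_manifold_def by blast+

lemma chart:
  assumes "c \<in> A"
  shows "open (fst c)" "open (snd c ` fst c)" "continuous_on (fst c) (snd c)"
    "continuous_on (snd c ` fst c) (chart_inv c)"
    "y \<in> fst c \<Longrightarrow> chart_inv c (snd c y) = y"
    "u \<in> snd c ` fst c \<Longrightarrow> chart_inv c u \<in> fst c"
    "u \<in> snd c ` fst c \<Longrightarrow> snd c (chart_inv c u) = u"
  using assms manifold unfolding Ck_manifold_def is_chart_def homeomorphism_def by auto

lemma isCont_chart_inv:
  assumes "c \<in> A" "x \<in> fst c" shows "isCont (chart_inv c) (snd c x)"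
  using continuous_on_eq_continuous_at[OF chart(2)[OF assms(1)]] chart(4)[OF assms(1)] assms by blast

text \<open>\<open>tangent_map\<close> is a chosen derivative and carries no information where none
  exists; this predicate also asserts differentiability.\<close>

definition has_tangent :: "('a \<Rightarrow> 'a) \<Rightarrow> 'a \<Rightarrow> (real^'n \<Rightarrow> real^'n) \<Rightarrow> bool" where
  "has_tangent F x L \<longleftrightarrow>
    ((\<lambda>u. snd (chart_at A (F x)) (F (chart_inv (chart_at A x) u))) has_derivative L)
      (at (snd (chart_at A x) x))"

lemma has_tangent_imp_tangent_map: "has_tangent F x L \<Longrightarrow> tangent_map A F x = L"
  unfolding has_tangent_def tangent_map_def by (rule frechet_derivative_at[symmetric])

lemma has_tangent_id: "has_tangent (\<lambda>x. x) x (\<lambda>v. v)"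
  unfolding has_tangent_def
proof (rule has_derivative_transform_within_open[where f = "\<lambda>u. u"])
  let ?c = "chart_at A x"
  show "((\<lambda>u. u) has_derivative (\<lambda>v. v)) (at (snd ?c x))" by (rule has_derivative_ident)
  show "open (snd ?c ` fst ?c)" by (rule chart(2)[OF chart_at(1)])
  show "snd ?c x \<in> snd ?c ` fst ?c" using chart_at(2) by (rule imageI)
  show "u = snd ?c (chart_inv ?c u)" if "u \<in> snd ?c ` fst ?c" for u
    using chart(7)[OF chart_at(1) that] by simp
qed

lemma eventually_in_chart:
  assumes "isCont F z"
  shows "\<forall>\<^sub>F u in at z. F u \<in> fst (chart_at A (F z))"
  using assms topological_tendstoD[OF _ chart(1)[OF chart_at(1)] chart_at(2)]
  unfolding isCont_def by blast

lemma has_tangent_compose: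
  assumes F: "isCont F x" "has_tangent F x L" and G: "has_tangent G (F x) M"
  shows "has_tangent (\<lambda>z. G (F z)) x (\<lambda>v. M (L v))"
proof -
  let ?c = "chart_at A x" let ?d = "chart_at A (F x)" let ?e = "chart_at A (G (F x))"
  let ?F = "\<lambda>u. F (chart_inv ?c u)"
  have cx: "chart_inv ?c (snd ?c x) = x" by (rule chart(5)[OF chart_at(1) chart_at(2)])
  have "isCont (chart_inv ?c) (snd ?c x)" by (rule isCont_chart_inv[OF chart_at])
  then have "isCont ?F (snd ?c x)"
    using F(1) cx by (intro isCont_o2[of "snd ?c x" "chart_inv ?c" F]) auto
  \<comment> \<open>Near the base point \<open>F\<close> stays in the chart domain, where the
    inserted chart and its inverse cancel.\<close>
  from eventually_in_chart[OF this]
  have ev: "\<forall>\<^sub>F u in at (snd ?c x). ?F u \<in> fst ?d" by (simp add: cx)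
  have "((\<lambda>w. snd ?e (G (chart_inv ?d w))) has_derivative M) (at (snd ?d (?F (snd ?c x))))"
    using G by (simp add: has_tangent_def cx)
  from has_derivative_compose[OF F(2)[unfolded has_tangent_def] this]
  have "((\<lambda>u. snd ?e (G (chart_inv ?d (snd ?d (?F u))))) has_derivative (\<lambda>v. M (L v))) (at (snd ?c x))" .
  then have "((\<lambda>u. snd ?e (G (?F u))) has_derivative (\<lambda>v. M (L v))) (at (snd ?c x))"
  proof (rule has_derivative_transform_eventually)
    show "\<forall>\<^sub>F u in at (snd ?c x). snd ?e (G (chart_inv ?d (snd ?d (?F u)))) = snd ?e (G (?F u))"
      using ev by eventually_elim (simp add: chart(5)[OF chart_at(1)])
    show "snd ?e (G (chart_inv ?d (snd ?d (?F (snd ?c x))))) = snd ?e (G (?F (snd ?c x)))"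
      by (simp add: cx chart(5)[OF chart_at(1) chart_at(2)])
  qed simp
  then show ?thesis by (simp add: has_tangent_def)
qed

definition has_velocity :: "(real \<Rightarrow> 'a) \<Rightarrow> real \<Rightarrow> real^'n \<Rightarrow> bool" where
  "has_velocity \<gamma> s v \<longleftrightarrow> ((\<lambda>t. snd (chart_at A (\<gamma> s)) (\<gamma> t)) has_vector_derivative v) (at s)"

lemma has_velocity_unique: "has_velocity \<gamma> s v \<Longrightarrow> has_velocity \<gamma> s w \<Longrightarrow> v = w"
  unfolding has_velocity_def by (rule vector_derivative_unique_at)

lemma has_velocity_compose:
  assumes \<gamma>: "isCont \<gamma> s" "has_velocity \<gamma> s v" and F: "has_tangent F (\<gamma> s) L"
  shows "has_velocity (\<lambda>t. F (\<gamma> t)) s (L v)"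
proof -
  let ?c = "chart_at A (\<gamma> s)" let ?d = "chart_at A (F (\<gamma> s))"
  have L: "linear L" using F unfolding has_tangent_def by (rule has_derivative_linear)
  have "((\<lambda>t. snd ?d (F (chart_inv ?c (snd ?c (\<gamma> t))))) has_derivative (\<lambda>h. L (h *\<^sub>R v))) (at s)"
    by (rule has_derivative_compose[OF \<gamma>(2)[unfolded has_velocity_def has_vector_derivative_def]
          F[unfolded has_tangent_def]])
  then have "((\<lambda>t. snd ?d (F (\<gamma> t))) has_derivative (\<lambda>h. L (h *\<^sub>R v))) (at s)"
  proof (rule has_derivative_transform_eventually)
    show "\<forall>\<^sub>F t in at s. snd ?d (F (chart_inv ?c (snd ?c (\<gamma> t)))) = snd ?d (F (\<gamma> t))"
      using eventually_in_chart[OF \<gamma>(1)] by eventually_elim (simp add: chart(5)[OF chart_at(1)])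
    show "snd ?d (F (chart_inv ?c (snd ?c (\<gamma> s)))) = snd ?d (F (\<gamma> s))"
      by (simp add: chart(5)[OF chart_at(1) chart_at(2)])
  qed simp
  then show ?thesis by (simp add: has_velocity_def has_vector_derivative_def linear_scale[OF L])
qed

end

text \<open>Implicit differentiation without a differentiable implicit time: \<open>H\<close> agrees
  with \<open>G\<close> at times \<open>s n\<close> that tend to \<open>t0\<close> at an unknown
  rate. Dividing the increments of time and space by their total size gives a nontrivial linear
  relation between \<open>w\<close> and the discrepancy \<open>z\<close> in the limit, and
  \<open>w \<noteq> 0\<close> turns it into \<open>z\<close> being a multiple of
  \<open>w\<close>.\<close>

lemma increments_in_direction:
  fixes G :: "real \<times> 'v::real_normed_vector \<Rightarrow> 'w::euclidean_space" and H :: "'v::real_normed_vector \<Rightarrow> 'w"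
  assumes G: "(G has_derivative D) (at (t0, u0))" and H: "(H has_derivative K) (at u0)"
    and w: "D (1, 0) = w" "w \<noteq> 0" and s: "s \<longlonglongrightarrow> t0"
    and e: "e \<longlonglongrightarrow> 0" "\<And>n. 0 < e n"
    and eq: "\<And>n. G (s n, u0 + e n *\<^sub>R v) = H (u0 + e n *\<^sub>R v)" "G (t0, u0) = H u0"
  shows "\<exists>c::real. K v = D (0, v) + c *\<^sub>R w"
proof -
  define z where "z = K v - D (0, v)"
  define q where "q n = \<bar>s n - t0\<bar> + e n" for n
  have q: "0 < q n" for n using e(2)[of n] by (simp add: q_def add_nonneg_pos)
  have linD: "linear D" and linK: "linear K" using G H by (auto intro: has_derivative_linear)
  define \<alpha> where "\<alpha> n = (s n - t0) / q n" for n
  define \<beta> where "\<beta> n = e n / q n" for n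
  have ab: "\<bar>\<alpha> n\<bar> + \<bar>\<beta> n\<bar> = 1" for n
    using q[of n] e(2)[of n] by (simp add: \<alpha>_def \<beta>_def q_def flip: add_divide_distrib)

  \<comment> \<open>Dividing the two first order expansions by \<open>q\<close> shows \<open>\<alpha> n w - \<beta> n z \<rightarrow> 0\<close>.\<close>
  define p where "p n = (s n, u0 + e n *\<^sub>R v)" for n
  have p: "p \<longlonglongrightarrow> (t0, u0)"
  proof -
    have "p \<longlonglongrightarrow> (t0, u0 + 0 *\<^sub>R v)"
      unfolding p_def by (intro tendsto_Pair s tendsto_add tendsto_const tendsto_scaleR e(1))
    then show ?thesis by simp
  qed
  have pne: "p n \<noteq> (t0, u0)" if "v \<noteq> 0" for n
    using that e(2)[of n] by (simp add: p_def)
  show ?thesis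
  proof (cases "v = 0")
    case True
    then show ?thesis
      using linear_0[OF linK] linear_0[OF linD] by (intro exI[of _ 0]) (simp add: zero_prod_def)
  next
    case False
    define RG where "RG n = G (p n) - G (t0, u0) - D (p n - (t0, u0))" for n
    define RH where "RH n = H (u0 + e n *\<^sub>R v) - H u0 - K (e n *\<^sub>R v)" for n
    have "(\<lambda>n. norm (RG n) / norm (p n - (t0, u0))) \<longlonglongrightarrow> 0"
    proof -
      have "((\<lambda>y. norm (G y - G (t0, u0) - D (y - (t0, u0))) / norm (y - (t0, u0))) \<longlongrightarrow> 0) (at (t0, u0))"
        using G by (simp add: has_derivative_iff_norm)
      moreover have "filterlim p (at (t0, u0)) sequentially"
        using p pne[OF False] by (simp add: filterlim_at)
      ultimately show ?thesis unfolding RG_def by (rule filterlim_compose)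
    qed
    moreover have "(\<lambda>n. norm (RG n /\<^sub>R q n)) \<longlonglongrightarrow> 0" if "(\<lambda>n. norm (RG n) / norm (p n - (t0, u0))) \<longlonglongrightarrow> 0"
    proof (rule Lim_null_comparison)
      define C where "C = 1 + norm v"
      have "norm (p n - (t0, u0)) \<le> C * q n" for n
      proof -
        have "norm (p n - (t0, u0)) \<le> norm (s n - t0) + norm (e n *\<^sub>R v)"
          using norm_Pair_le[of "s n - t0" "e n *\<^sub>R v"] by (simp add: p_def)
        also have "\<dots> = \<bar>s n - t0\<bar> + e n * norm v" using e(2)[of n] by simp
        also have "\<dots> \<le> C * \<bar>s n - t0\<bar> + C * e n"
          using e(2)[of n] by (simp add: C_def distrib_right)
        finally show ?thesis by (simp add: q_def distrib_left)
      qed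
      then have "norm (RG n) / q n \<le> C * (norm (RG n) / norm (p n - (t0, u0)))" for n
      proof -
        have "0 < norm (p n - (t0, u0))" using pne[OF False] by simp
        moreover have "norm (RG n) * norm (p n - (t0, u0)) \<le> norm (RG n) * (C * q n)"
          by (rule mult_left_mono) (use \<open>\<And>n. norm (p n - (t0, u0)) \<le> C * q n\<close> in auto)
        ultimately show ?thesis using q[of n] by (simp add: field_simps)
      qed
      then show "\<forall>\<^sub>F n in sequentially. norm (norm (RG n /\<^sub>R q n))
          \<le> C * (norm (RG n) / norm (p n - (t0, u0)))"
        using q by (simp add: less_imp_le divide_inverse mult.commute)
      show "(\<lambda>n. C * (norm (RG n) / norm (p n - (t0, u0)))) \<longlonglongrightarrow> 0"
        using tendsto_mult_right_zero[OF that] .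
    qed
    ultimately have RG0: "(\<lambda>n. RG n /\<^sub>R q n) \<longlonglongrightarrow> 0" using tendsto_norm_zero_iff by blast
    have "(\<lambda>n. norm (RH n) / norm (u0 + e n *\<^sub>R v - u0)) \<longlonglongrightarrow> 0"
    proof -
      have "((\<lambda>y. norm (H y - H u0 - K (y - u0)) / norm (y - u0)) \<longlongrightarrow> 0) (at u0)"
        using H by (simp add: has_derivative_iff_norm)
      moreover have "filterlim (\<lambda>n. u0 + e n *\<^sub>R v) (at u0) sequentially"
      proof -
        have "(\<lambda>n. u0 + e n *\<^sub>R v) \<longlonglongrightarrow> u0 + 0 *\<^sub>R v"
          by (intro tendsto_add tendsto_const tendsto_scaleR e(1))
        moreover have "e n \<noteq> 0" for n using e(2)[of n] by simp
        ultimately show ?thesis using False by (simp add: filterlim_at)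
      qed
      ultimately show ?thesis unfolding RH_def by (auto dest: filterlim_compose)
    qed
    then have RH': "(\<lambda>n. norm v * (norm (RH n) / norm (u0 + e n *\<^sub>R v - u0))) \<longlonglongrightarrow> 0"
      by (rule tendsto_mult_right_zero)
    have RH0: "(\<lambda>n. RH n /\<^sub>R q n) \<longlonglongrightarrow> 0"
    proof (rule Lim_null_comparison[OF always_eventually RH'], rule allI)
      fix n
      have "norm (RH n) / q n \<le> norm (RH n) / e n"
        using e(2)[of n] by (intro divide_left_mono) (auto simp: q_def)
      also have "\<dots> = norm v * (norm (RH n) / norm (u0 + e n *\<^sub>R v - u0))"
        using e(2)[of n] False by simp
      finally show "norm (RH n /\<^sub>R q n) \<le> norm v * (norm (RH n) / norm (u0 + e n *\<^sub>R v - u0))"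
        using q[of n] by (simp add: divide_inverse mult.commute)
    qed
    have diff: "RH n /\<^sub>R q n - RG n /\<^sub>R q n = \<alpha> n *\<^sub>R w - \<beta> n *\<^sub>R z" for n
    proof -
      have "p n - (t0, u0) = (s n - t0) *\<^sub>R (1, 0) + e n *\<^sub>R (0, v)" by (simp add: p_def)
      then have "D (p n - (t0, u0)) = (s n - t0) *\<^sub>R w + e n *\<^sub>R D (0, v)"
        using w(1) by (simp only: linear_add[OF linD] linear_scale[OF linD])
      then have "RH n - RG n = (s n - t0) *\<^sub>R w - e n *\<^sub>R z"
        using eq unfolding RH_def RG_def p_def z_def
        by (simp add: linear_scale[OF linK] scaleR_diff_right)
      then have "(RH n - RG n) /\<^sub>R q n = ((s n - t0) *\<^sub>R w - e n *\<^sub>R z) /\<^sub>R q n" by simp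
      then show ?thesis by (simp add: \<alpha>_def \<beta>_def scaleR_diff_right divide_inverse mult.commute)
    qed
    have lim: "(\<lambda>n. \<alpha> n *\<^sub>R w - \<beta> n *\<^sub>R z) \<longlonglongrightarrow> 0"
      using tendsto_diff[OF RH0 RG0] by (simp add: diff)
    \<comment> \<open>The normalized increments lie in a compact square, and a limit
      \<open>(a, b)\<close> keeps \<open>\<bar>a\<bar> + \<bar>b\<bar> = 1\<close>. If
      \<open>b\<close> vanished, then \<open>a *\<^sub>R w = 0\<close> with
      \<open>\<bar>a\<bar> = 1\<close> would contradict \<open>w \<noteq> 0\<close>.\<close>
    have "(\<alpha> n, \<beta> n) \<in> {-1..1} \<times> {-1..1}" for n using ab[of n] by auto
    moreover have "seq_compact ({-1..1::real} \<times> {-1..1::real})"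
      by (intro compact_imp_seq_compact compact_Times compact_Icc)
    ultimately obtain l r where r: "strict_mono r" "((\<lambda>n. (\<alpha> n, \<beta> n)) \<circ> r) \<longlonglongrightarrow> l"
      unfolding seq_compact_def by meson
    obtain a b where l: "l = (a, b)" by fastforce
    have a: "(\<lambda>n. \<alpha> (r n)) \<longlonglongrightarrow> a" and b: "(\<lambda>n. \<beta> (r n)) \<longlonglongrightarrow> b"
      using tendsto_fst[OF r(2)] tendsto_snd[OF r(2)] by (auto simp: l comp_def)
    have "(\<lambda>n. \<alpha> (r n) *\<^sub>R w - \<beta> (r n) *\<^sub>R z) \<longlonglongrightarrow> 0"
      using LIMSEQ_subseq_LIMSEQ[OF lim r(1)] by (simp add: comp_def)
    moreover have "(\<lambda>n. \<alpha> (r n) *\<^sub>R w - \<beta> (r n) *\<^sub>R z) \<longlonglongrightarrow> a *\<^sub>R w - b *\<^sub>R z"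
      by (intro tendsto_diff tendsto_scaleR a b tendsto_const)
    ultimately have wz: "a *\<^sub>R w = b *\<^sub>R z" using LIMSEQ_unique by fastforce
    have "(\<lambda>n. \<bar>\<alpha> (r n)\<bar> + \<bar>\<beta> (r n)\<bar>) \<longlonglongrightarrow> \<bar>a\<bar> + \<bar>b\<bar>" by (intro tendsto_add tendsto_rabs a b)
    then have one: "\<bar>a\<bar> + \<bar>b\<bar> = 1" by (simp add: ab LIMSEQ_const_iff)
    have "b \<noteq> 0" using wz one w(2) by auto
    then have "z = (a / b) *\<^sub>R w"
      using arg_cong[OF wz, of "\<lambda>x. (1 / b) *\<^sub>R x"] by simp
    then have "K v = D (0, v) + (a / b) *\<^sub>R w" by (simp add: z_def algebra_simps)
    then show ?thesis ..
  qed
qed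

section \<open>Flows and their clocks\<close>

locale continuous_flow =
  fixes \<Phi> :: "real \<Rightarrow> 'a::{t2_space,second_countable_topology} \<Rightarrow> 'a"
  assumes flow_0 [simp]: "\<Phi> 0 x = x" and flow_add: "\<Phi> (s + t) x = \<Phi> s (\<Phi> t x)"
    and flow_continuous: "continuous_on UNIV (\<lambda>(t, x). \<Phi> t x)"
begin

lemma tendsto_flow:
  assumes "(t \<longlongrightarrow> t0) F" "(z \<longlongrightarrow> z0) F"
  shows "((\<lambda>n. \<Phi> (t n) (z n)) \<longlongrightarrow> \<Phi> t0 z0) F"
  using continuous_on_tendsto_compose[OF flow_continuous tendsto_Pair[OF assms]] by simp

lemma isCont_flow: "isCont (\<Phi> t) x"
  unfolding isCont_def by (rule tendsto_flow) (rule tendsto_const, rule tendsto_ident_at)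

lemma isCont_orbit: "isCont (\<lambda>t. \<Phi> t x) s"
  unfolding isCont_def by (rule tendsto_flow) (rule tendsto_ident_at, rule tendsto_const)

lemma flow_minus [simp]: "\<Phi> (- t) (\<Phi> t x) = x" "\<Phi> t (\<Phi> (- t) x) = x"
  using flow_add[of "- t" t x] flow_add[of t "- t" x] by auto

lemma flow_commute: "\<Phi> s (\<Phi> t x) = \<Phi> t (\<Phi> s x)"
  by (metis add.commute flow_add)

lemma flow_eq_iff: "\<Phi> s x = \<Phi> t x \<longleftrightarrow> \<Phi> (s - t) x = x"
  by (metis add.commute add_uminus_conv_diff flow_add flow_minus(1) flow_0 diff_add_cancel)

lemma flow_power: "(\<Phi> t ^^ n) x = \<Phi> (real n * t) x"
  by (induction n) (simp_all add: distrib_right flow_add)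

lemma nonfixed_flow: "x \<in> nonfixed \<Phi> \<longleftrightarrow> \<Phi> t x \<in> nonfixed \<Phi>"
proof -
  have "\<Phi> t x \<in> nonfixed \<Phi>" if nf: "x \<in> nonfixed \<Phi>" for t x
  proof -
    obtain s where "\<Phi> s x \<noteq> x" using nf by (auto simp: nonfixed_def)
    then have "\<Phi> s (\<Phi> t x) \<noteq> \<Phi> t x" by (metis flow_commute flow_minus(1))
    then show ?thesis by (auto simp: nonfixed_def)
  qed
  from this[of x t] this[of "\<Phi> t x" "- t"] show ?thesis by auto
qed

text \<open>If every time in \<open>{0..e}\<close> fixed \<open>x\<close>, any time could be divided
  into equal steps of this kind, and \<open>x\<close> would be a fixed point.\<close>

lemma nonfixed_small_nonperiod:
  assumes "x \<in> nonfixed \<Phi>" "e > 0"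
  shows "\<exists>d. 0 < d \<and> d \<le> e \<and> \<Phi> d x \<noteq> x"
proof (rule ccontr)
  assume "\<not> ?thesis"
  then have per: "\<Phi> d x = x" if "0 \<le> d" "d \<le> e" for d
    using that by (cases "d = 0") auto
  obtain t where t: "\<Phi> t x \<noteq> x" using assms(1) by (auto simp: nonfixed_def)
  have pos: "\<Phi> \<bar>t\<bar> x \<noteq> x" using t by (cases "0 \<le> t") (auto, metis flow_minus(2))
  obtain n :: nat where n: "\<bar>t\<bar> / e < real n" using reals_Archimedean2 by blast
  have "0 < real n" using n assms(2) by (smt (verit) divide_nonneg_pos)
  then have "\<bar>t\<bar> / real n \<le> e" using n assms(2) by (simp add: field_simps)
  then have 1: "\<Phi> (\<bar>t\<bar> / real n) x = x" by (intro per) auto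
  have "(\<Phi> (\<bar>t\<bar> / real n) ^^ k) x = x" for k by (induction k) (simp_all add: 1)
  then have "\<Phi> (real n * (\<bar>t\<bar> / real n)) x = x" by (simp only: flow_power)
  with pos \<open>0 < real n\<close> show False by simp
qed

text \<open>The range of \<open>p\<close> is connected and contains \<open>0\<close>. A nonzero
  value would bring all smaller times into the range up to sign, among them one that does not fix
  \<open>x\<close>.\<close>

lemma nonfixed_continuous_period_zero:
  assumes x: "x \<in> nonfixed \<Phi>" and p: "continuous_on UNIV p" "p 0 = 0" "\<And>\<tau>::real. \<Phi> (p \<tau>) x = x"
  shows "p \<tau> = 0"
proof (rule ccontr)
  assume "p \<tau> \<noteq> 0"
  then obtain d where d: "0 < d" "d \<le> \<bar>p \<tau>\<bar>" "\<Phi> d x \<noteq> x"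
    using nonfixed_small_nonperiod[OF x, of "\<bar>p \<tau>\<bar>"] by auto
  have conn: "connected (range p)" using p(1) by (intro connected_continuous_image) auto
  have "d \<in> range p \<or> - d \<in> range p"
  proof (cases "0 \<le> p \<tau>")
    case True
    then have "d \<in> range p"
      using connected_contains_Icc[OF conn, of 0 "p \<tau>"] d p(2)
      by (metis abs_of_nonneg atLeastAtMost_iff less_imp_le rangeI subsetD)
    then show ?thesis ..
  next
    case False
    then have "- d \<in> range p"
      using connected_contains_Icc[OF conn, of "p \<tau>" 0] d p(2)
      by (smt (verit) atLeastAtMost_iff rangeI subsetD)
    then show ?thesis ..
  qed
  then have "\<Phi> d x = x"
  proof
    assume "d \<in> range p" then show ?thesis using p(3) by auto
  next
    assume "- d \<in> range p"
    then have "\<Phi> (- d) x = x" using p(3) by auto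
    then show ?thesis by (metis flow_minus(2))
  qed
  with d(3) show False by simp
qed

text \<open>The difference of two time changes is continuous and takes its values among the periods
  of \<open>x\<close>.\<close>

lemma time_change_unique:
  assumes x: "x \<in> nonfixed \<Phi>" and "time_change \<Phi> \<Psi> x \<theta>" "time_change \<Phi> \<Psi> x \<theta>'"
  shows "\<theta> = \<theta>'"
proof
  fix \<tau>
  have "\<theta> \<tau> - \<theta>' \<tau> = 0"
  proof (rule nonfixed_continuous_period_zero[of x "\<lambda>\<tau>. \<theta> \<tau> - \<theta>' \<tau>", OF x])
    show "continuous_on UNIV (\<lambda>\<tau>. \<theta> \<tau> - \<theta>' \<tau>)" "\<theta> 0 - \<theta>' 0 = 0"
      using assms(2,3) by (auto simp: time_change_def intro: continuous_on_diff)
    show "\<Phi> (\<theta> \<tau> - \<theta>' \<tau>) x = x" for \<tau>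
      using assms(2,3) unfolding time_change_def by (metis flow_eq_iff)
  qed
  then show "\<theta> \<tau> = \<theta>' \<tau>" by simp
qed

end

locale reparameterized_flow = continuous_flow \<Phi> + rep: continuous_flow \<Psi>
  for \<Phi> \<Psi> :: "real \<Rightarrow> 'a::{t2_space,second_countable_topology} \<Rightarrow> 'a" +
  assumes reparam: "time_reparameterization \<Phi> \<Psi>"
begin

definition clock :: "'a \<Rightarrow> real \<Rightarrow> real" where
  "clock x = (SOME \<theta>. time_change \<Phi> \<Psi> x \<theta>)"

lemma clock: "time_change \<Phi> \<Psi> x (clock x)"
  using reparam unfolding clock_def time_reparameterization_def by (metis someI_ex)

lemma clock_0 [simp]: "clock x 0 = 0" and continuous_clock: "continuous_on UNIV (clock x)"
  and strict_mono_clock: "strict_mono (clock x)" and clock_eq: "\<Psi> \<tau> x = \<Phi> (clock x \<tau>) x"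
  using clock[of x] by (auto simp: time_change_def)

lemma nonfixed_reparam: "nonfixed \<Psi> = nonfixed \<Phi>"
proof -
  have "range (\<lambda>\<tau>. \<Psi> \<tau> x) = range (\<lambda>t. \<Phi> t x)" for x
    using reparam by (auto simp: time_reparameterization_def)
  moreover have "x \<notin> nonfixed F \<longleftrightarrow> range (\<lambda>t. F t x) \<subseteq> {x}" for F :: "real \<Rightarrow> 'a \<Rightarrow> 'a" and x
    by (auto simp: nonfixed_def)
  ultimately show ?thesis by blast
qed

text \<open>The clock of \<open>x\<close> restarted at time \<open>\<tau>\<close> is a time change
  at \<open>\<Psi> \<tau> x\<close>, and uniqueness identifies it with the clock of that
  point.\<close>

lemma clock_add:
  assumes "x \<in> nonfixed \<Phi>"
  shows "clock x (\<tau> + \<sigma>) = clock x \<tau> + clock (\<Psi> \<tau> x) \<sigma>"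
proof -
  let ?y = "\<Psi> \<tau> x"
  have y: "?y \<in> nonfixed \<Phi>" using assms rep.nonfixed_flow[of x \<tau>] by (simp add: nonfixed_reparam)
  have "time_change \<Phi> \<Psi> ?y (\<lambda>\<sigma>. clock x (\<tau> + \<sigma>) - clock x \<tau>)"
    unfolding time_change_def
  proof (intro conjI allI)
    show "continuous_on UNIV (\<lambda>\<sigma>. clock x (\<tau> + \<sigma>) - clock x \<tau>)"
      by (intro continuous_intros continuous_on_compose2[OF continuous_clock]) auto
    show "strict_mono (\<lambda>\<sigma>. clock x (\<tau> + \<sigma>) - clock x \<tau>)"
      using strict_mono_clock[of x] by (auto simp: strict_mono_def)
    fix \<sigma>
    have "\<Psi> \<sigma> ?y = \<Phi> (clock x (\<tau> + \<sigma>)) x" by (metis add.commute clock_eq rep.flow_add)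
    also have "\<dots> = \<Phi> (clock x (\<tau> + \<sigma>) - clock x \<tau>) (\<Phi> (clock x \<tau>) x)"
      by (simp flip: flow_add)
    finally show "\<Psi> \<sigma> ?y = \<Phi> (clock x (\<tau> + \<sigma>) - clock x \<tau>) ?y" by (simp add: clock_eq)
  qed simp
  from time_change_unique[OF y this clock[of ?y]] show ?thesis by (metis add_diff_cancel_left' diff_add_cancel add.commute)
qed

text \<open>If the clock converged, the orbit would converge to a fixed point of \<open>\<Psi>\<close> on the same orbit.\<close>

lemma clock_no_limit:
  assumes x: "x \<in> nonfixed \<Phi>" and F: "\<And>\<sigma>. filterlim (\<lambda>\<tau>::real. \<sigma> + \<tau>) F F" "F \<noteq> bot"
    and lim: "(clock x \<longlongrightarrow> T) F"
  shows False
proof -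
  let ?y = "\<Phi> T x"
  have y: "((\<lambda>\<tau>. \<Psi> \<tau> x) \<longlongrightarrow> ?y) F"
    using tendsto_flow[OF lim tendsto_const, of x] by (simp only: clock_eq)
  have "\<Psi> \<sigma> ?y = ?y" for \<sigma>
  proof (rule tendsto_unique[OF F(2)])
    show "((\<lambda>\<tau>. \<Psi> (\<sigma> + \<tau>) x) \<longlongrightarrow> ?y) F" by (rule filterlim_compose[OF y F(1)])
    show "((\<lambda>\<tau>. \<Psi> (\<sigma> + \<tau>) x) \<longlongrightarrow> \<Psi> \<sigma> ?y) F"
      using rep.tendsto_flow[OF tendsto_const y, of \<sigma>] by (simp only: rep.flow_add)
  qed
  then have "?y \<notin> nonfixed \<Psi>" by (simp add: nonfixed_def)
  with x show False using nonfixed_flow[of x T] by (simp add: nonfixed_reparam)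
qed

text \<open>A clock bounded on one side would, being monotone, converge at that end of the line. The
  filter in \<open>clock_no_limit\<close> is a parameter so that both ends are covered.\<close>

lemma surj_clock:
  assumes x: "x \<in> nonfixed \<Phi>" shows "surj (clock x)"
proof -
  have mono: "mono (clock x)" using strict_mono_clock by (rule strict_mono_mono)
  have top: "filterlim (\<lambda>\<tau>::real. \<sigma> + \<tau>) at_top at_top" for \<sigma>
    by (rule filterlim_tendsto_add_at_top[OF tendsto_const filterlim_ident])
  have bot: "filterlim (\<lambda>\<tau>::real. \<sigma> + \<tau>) at_bot at_bot" for \<sigma>
    unfolding filterlim_at_bot eventually_at_bot_linorder
  proof
    fix Z show "\<exists>N. \<forall>\<tau>\<le>N. \<sigma> + \<tau> \<le> Z" by (rule exI[of _ "Z - \<sigma>"]) auto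
  qed
  have up: "\<exists>\<tau>. t < clock x \<tau>" for t
  proof (rule ccontr)
    assume "\<nexists>\<tau>. t < clock x \<tau>"
    then have "bdd_above (range (clock x))" by (auto simp: bdd_above_def not_less)
    then have lub: "clock x \<tau> \<le> Sup (range (clock x))" for \<tau> by (intro cSup_upper) auto
    have "(clock x \<longlongrightarrow> Sup (range (clock x))) at_top"
    proof (rule order_tendstoI)
      fix a assume "a < Sup (range (clock x))"
      then obtain \<tau> where "a < clock x \<tau>"
        using less_cSup_iff[OF _ \<open>bdd_above _\<close>] by auto
      then show "\<forall>\<^sub>F \<tau> in at_top. a < clock x \<tau>"
        unfolding eventually_at_top_linorder using mono by (meson less_le_trans monoD)
    next
      fix a assume "Sup (range (clock x)) < a"
      then show "\<forall>\<^sub>F \<tau> in at_top. clock x \<tau> < a" using lub by (auto intro: always_eventually le_less_trans)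
    qed
    from clock_no_limit[OF x top _ this] show False by simp
  qed
  have down: "\<exists>\<tau>. clock x \<tau> < t" for t
  proof (rule ccontr)
    assume "\<nexists>\<tau>. clock x \<tau> < t"
    then have "bdd_below (range (clock x))" by (auto simp: bdd_below_def not_less)
    then have glb: "Inf (range (clock x)) \<le> clock x \<tau>" for \<tau> by (intro cInf_lower) auto
    have "(clock x \<longlongrightarrow> Inf (range (clock x))) at_bot"
    proof (rule order_tendstoI)
      fix a assume "Inf (range (clock x)) < a"
      then obtain \<tau> where "clock x \<tau> < a"
        using cInf_less_iff[OF _ \<open>bdd_below _\<close>] by auto
      then show "\<forall>\<^sub>F \<tau> in at_bot. clock x \<tau> < a"
        unfolding eventually_at_bot_linorder using mono by (meson le_less_trans monoD)
    next
      fix a assume "a < Inf (range (clock x))"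
      then show "\<forall>\<^sub>F \<tau> in at_bot. a < clock x \<tau>" using glb by (auto intro: always_eventually less_le_trans)
    qed
    from clock_no_limit[OF x bot _ this] show False by simp
  qed
  show ?thesis
  proof (rule surjI)
    fix t
    obtain \<tau>1 \<tau>2 where "clock x \<tau>1 < t" "t < clock x \<tau>2" using up down by blast
    moreover have "\<tau>1 \<le> \<tau>2"
      using calculation strict_mono_less[OF strict_mono_clock, of x] by (meson less_trans less_imp_le)
    ultimately have "\<exists>\<tau>. clock x \<tau> = t"
      using IVT'[of "clock x" \<tau>1 t \<tau>2] continuous_on_subset[OF continuous_clock] by (metis less_imp_le top_greatest)
    then show "clock x (SOME \<tau>. clock x \<tau> = t) = t" by (rule someI_ex)
  qed
qed

text \<open>A jump of the clocks would leave a short time \<open>d\<close> with \<open>\<Phi> d x = x\<close>; \<open>d\<close> is chosen to exclude it.\<close>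

lemma tendsto_clock:
  assumes x: "x \<in> nonfixed \<Phi>" and z: "z \<longlonglongrightarrow> x"
  shows "(\<lambda>n. clock (z n) \<tau>) \<longlonglongrightarrow> clock x \<tau>"
proof (rule ccontr)
  assume "\<not> ?thesis"
  then obtain e where e: "e > 0" "\<exists>\<^sub>F n in sequentially. e \<le> \<bar>clock (z n) \<tau> - clock x \<tau>\<bar>"
    unfolding tendsto_iff dist_real_def by (auto simp: not_eventually not_less)
  obtain d where d: "0 < d" "d \<le> e" "\<Phi> d x \<noteq> x" using nonfixed_small_nonperiod[OF x e(1)] by blast
  have "\<exists>\<^sub>F n in sequentially. d \<le> \<bar>clock (z n) \<tau> - clock x \<tau>\<bar>"
    using e(2) by (rule frequently_elim1) (use d(2) in auto)
  then have "infinite {n. d \<le> \<bar>clock (z n) \<tau> - clock x \<tau>\<bar>}"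
    unfolding frequently_cofinite[symmetric] cofinite_eq_sequentially .
  then obtain r0 :: "nat \<Rightarrow> nat" where r0: "strict_mono r0" "\<And>n. d \<le> \<bar>clock (z (r0 n)) \<tau> - clock x \<tau>\<bar>"
    using infinite_enumerate by blast
  define J where "J = closed_segment 0 \<tau>"
  \<comment> \<open>The discrepancy of the clocks starts at \<open>0\<close> and reaches at least
    \<open>d\<close>, so it equals \<open>d\<close> at some time in \<open>J\<close>. Fixing its
    size prepares the compactness argument.\<close>
  have "\<exists>\<sigma>\<in>J. \<bar>clock (z (r0 n)) \<sigma> - clock x \<sigma>\<bar> = d" for n
  proof -
    let ?h = "\<lambda>\<sigma>. \<bar>clock (z (r0 n)) \<sigma> - clock x \<sigma>\<bar>"
    have "continuous_on J ?h"
      by (intro continuous_intros continuous_on_subset[OF continuous_clock]) auto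
    then have "connected (?h ` J)" by (intro connected_continuous_image) (auto simp: J_def)
    moreover have "?h 0 \<in> ?h ` J" "?h \<tau> \<in> ?h ` J" by (rule imageI, simp add: J_def)+
    ultimately have "{?h 0..?h \<tau>} \<subseteq> ?h ` J" by (rule connected_contains_Icc)
    moreover have "d \<in> {?h 0..?h \<tau>}" using r0(2)[of n] d(1) by simp
    ultimately have "d \<in> ?h ` J" by (rule subsetD)
    then obtain \<sigma> where "\<sigma> \<in> J" "d = ?h \<sigma>" by (rule imageE)
    then show ?thesis by (intro bexI[of _ \<sigma>]) simp_all
  qed
  then have "\<exists>s. \<forall>n. s n \<in> J \<and> \<bar>clock (z (r0 n)) (s n) - clock x (s n)\<bar> = d"
    by (intro choice) (simp add: Bex_def)
  then obtain s where s: "\<And>n. s n \<in> J" "\<And>n. \<bar>clock (z (r0 n)) (s n) - clock x (s n)\<bar> = d" by auto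
  define \<delta> where "\<delta> n = clock (z (r0 n)) (s n) - clock x (s n)" for n
  \<comment> \<open>The signed discrepancies take only the values \<open>d\<close> and
    \<open>- d\<close>, so their limit along a subsequence cannot be \<open>0\<close>.\<close>
  have "(s n, \<delta> n) \<in> J \<times> {- d, d}" for n using s[of n] by (auto simp: \<delta>_def abs_if split: if_splits)
  moreover have "seq_compact (J \<times> {- d, d})"
    by (intro compact_imp_seq_compact compact_Times) (auto simp: J_def)
  ultimately obtain l r where lr: "l \<in> J \<times> {- d, d}" "strict_mono r" "((\<lambda>n. (s n, \<delta> n)) \<circ> r) \<longlonglongrightarrow> l"
    unfolding seq_compact_def by meson
  obtain s0 \<delta>0 where l: "l = (s0, \<delta>0)" by fastforce
  have s0: "(\<lambda>n. s (r n)) \<longlonglongrightarrow> s0" and \<delta>0: "(\<lambda>n. \<delta> (r n)) \<longlonglongrightarrow> \<delta>0"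
    using tendsto_fst[OF lr(3)] tendsto_snd[OF lr(3)] by (auto simp: l comp_def)
  have z': "(\<lambda>n. z (r0 (r n))) \<longlonglongrightarrow> x"
    using LIMSEQ_subseq_LIMSEQ[OF z strict_mono_o[OF r0(1) lr(2)]] by (simp add: comp_def)
  have "(\<lambda>n. \<Psi> (s (r n)) (z (r0 (r n)))) \<longlonglongrightarrow> \<Psi> s0 x" by (rule rep.tendsto_flow[OF s0 z'])
  moreover have "\<Psi> (s (r n)) (z (r0 (r n))) = \<Phi> (clock x (s (r n)) + \<delta> (r n)) (z (r0 (r n)))" for n
    by (simp add: clock_eq \<delta>_def)
  moreover have "(\<lambda>n. \<Phi> (clock x (s (r n)) + \<delta> (r n)) (z (r0 (r n)))) \<longlonglongrightarrow> \<Phi> (clock x s0 + \<delta>0) x"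
  proof (rule tendsto_flow[OF tendsto_add[OF _ \<delta>0] z'])
    have "isCont (clock x) s0" using continuous_clock[of x] by (simp add: continuous_on_eq_continuous_at)
    then show "(\<lambda>n. clock x (s (r n))) \<longlonglongrightarrow> clock x s0" using s0 by (rule isCont_tendsto_compose)
  qed
  ultimately have "\<Psi> s0 x = \<Phi> (clock x s0 + \<delta>0) x" using LIMSEQ_unique by simp
  then have "\<Phi> (clock x s0) x = \<Phi> (clock x s0 + \<delta>0) x" by (simp add: clock_eq)
  then have per: "\<Phi> \<delta>0 x = x" by (metis flow_eq_iff add_diff_cancel_left')
  have "\<delta>0 = d \<or> \<delta>0 = - d" using lr(1) l by auto
  then show False using per d(3) by (metis flow_minus(2))
qed

text \<open>The \<open>S x t\<close> of the overview. The inverse is meaningful at nonfixed points,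
  where the clock is a bijection of the line.\<close>

definition elapsed :: "'a \<Rightarrow> real \<Rightarrow> real" where
  "elapsed x = inv (clock x)"

lemma
  assumes "x \<in> nonfixed \<Phi>"
  shows clock_elapsed: "clock x (elapsed x t) = t" and elapsed_clock: "elapsed x (clock x \<tau>) = \<tau>"
    and elapsed_0: "elapsed x 0 = 0" and flow_elapsed: "\<Psi> (elapsed x t) x = \<Phi> t x"
proof -
  show 1: "clock x (elapsed x t) = t" for t
    unfolding elapsed_def by (rule surj_f_inv_f[OF surj_clock[OF assms]])
  show 2: "elapsed x (clock x \<tau>) = \<tau>" for \<tau>
    unfolding elapsed_def by (rule inv_f_f[OF strict_mono_imp_inj_on[OF strict_mono_clock]])
  show "elapsed x 0 = 0" using 2[of 0] by simp
  show "\<Psi> (elapsed x t) x = \<Phi> t x" by (simp add: clock_eq 1)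
qed

text \<open>The associated function prescribes the derivative at time \<open>0\<close> only; the
  cocycle identity \<open>clock_add\<close> carries it to \<open>\<tau>\<close>.\<close>

lemma clock_derivative:
  assumes x: "x \<in> nonfixed \<Phi>"
    and r: "\<And>y. y \<in> nonfixed \<Phi> \<Longrightarrow>
      \<exists>\<theta> D. time_change \<Phi> \<Psi> y \<theta> \<and> (\<theta> has_real_derivative D) (at 0) \<and> r y = inverse D"
  shows "(clock x has_real_derivative inverse (r (\<Psi> \<tau> x))) (at \<tau>)"
proof -
  let ?y = "\<Psi> \<tau> x"
  have y: "?y \<in> nonfixed \<Phi>" using x rep.nonfixed_flow[of x \<tau>] by (simp add: nonfixed_reparam)
  have "(clock ?y has_real_derivative inverse (r ?y)) (at 0)"
    using r[OF y] time_change_unique[OF y clock] by auto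
  then have "(clock ?y has_real_derivative inverse (r ?y)) (at (\<tau> - \<tau>))" by simp
  then have "((\<lambda>\<sigma>. clock ?y (\<sigma> - \<tau>)) has_real_derivative inverse (r ?y) * 1) (at \<tau>)"
    by (rule DERIV_chain2) (auto intro!: derivative_eq_intros)
  then have "((\<lambda>\<sigma>. clock x \<tau> + clock ?y (\<sigma> - \<tau>)) has_real_derivative inverse (r ?y)) (at \<tau>)"
    by (auto intro!: derivative_eq_intros)
  moreover have "(\<lambda>\<sigma>. clock x \<tau> + clock ?y (\<sigma> - \<tau>)) = clock x"
  proof
    fix \<sigma>
    show "clock x \<tau> + clock ?y (\<sigma> - \<tau>) = clock x \<sigma>"
      using clock_add[OF x, of \<tau> "\<sigma> - \<tau>"] by simp
  qed
  ultimately show ?thesis by (rule subst[rotated])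
qed

lemma elapsed_derivative:
  assumes x: "x \<in> nonfixed \<Phi>"
    and r: "\<And>y. y \<in> nonfixed \<Phi> \<Longrightarrow> 0 < r y \<and>
      (\<exists>\<theta> D. time_change \<Phi> \<Psi> y \<theta> \<and> (\<theta> has_real_derivative D) (at 0) \<and> r y = inverse D)"
  shows "(elapsed x has_real_derivative r (\<Phi> t x)) (at t)"
proof -
  have pos: "0 < r (\<Phi> t x)" using r x nonfixed_flow[of x t] by simp
  have der: "(clock x has_real_derivative inverse (r (\<Phi> t x))) (at (elapsed x t))"
    using clock_derivative[OF x, of r "elapsed x t"] r flow_elapsed[OF x] by auto
  have cont: "isCont (elapsed x) t"
  proof -
    have "isCont (elapsed x) (clock x (elapsed x t))"
      by (rule isCont_inverse_function[of 1])
         (use elapsed_clock[OF x] continuous_clock[of x] in \<open>auto simp: continuous_on_eq_continuous_at\<close>)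
    then show ?thesis by (simp add: clock_elapsed[OF x])
  qed
  have "(elapsed x has_real_derivative inverse (inverse (r (\<Phi> t x)))) (at t)"
    by (rule DERIV_inverse_function[OF der _ _ _ _ cont, of "t - 1" "t + 1"])
       (use pos clock_elapsed[OF x] in auto)
  then show ?thesis by simp
qed

lemma elapsed_strict_mono:
  assumes x: "x \<in> nonfixed \<Phi>" shows "strict_mono (elapsed x)"
proof (rule strict_monoI)
  fix s t :: real assume "s < t"
  then have "clock x (elapsed x s) < clock x (elapsed x t)" by (simp add: clock_elapsed[OF x])
  then show "elapsed x s < elapsed x t" by (simp add: strict_mono_less[OF strict_mono_clock])
qed

end

section \<open>Lyapunov exponents under a time change\<close>

locale Ck_flow_on_manifold = Ck_manifold_atlas A m
  for A :: "('a::{t2_space,second_countable_topology}, 'n::finite) chart set" and m :: nat +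
  fixes l :: nat and \<Phi> :: "real \<Rightarrow> 'a \<Rightarrow> 'a"
  assumes l_pos: "1 \<le> l" and flow: "Ck_flow A l \<Phi>"
begin

sublocale continuous_flow \<Phi>
  using flow by unfold_locales (simp_all add: Ck_flow_def)

text \<open>Joint differentiability in time and space yields a single \<open>D\<close> whose partial
  derivatives are the tangent map and the velocity, which is the form that
  \<open>increments_in_direction\<close> asks for.\<close>

lemma flow_in_charts_derivative:
  obtains D where
    "((\<lambda>(t, u). snd (chart_at A (\<Phi> t0 x)) (\<Phi> t (chart_inv (chart_at A x) u))) has_derivative D)
      (at (t0, snd (chart_at A x) x))"
    "has_tangent (\<Phi> t0) x (\<lambda>v. D (0, v))"
    "has_velocity (\<lambda>t. \<Phi> t x) t0 (D (1, 0))"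
proof -
  let ?c = "chart_at A x" let ?d = "chart_at A (\<Phi> t0 x)"
  let ?G = "\<lambda>(t, u). snd ?d (\<Phi> t (chart_inv ?c u))"
  let ?u = "snd ?c x"
  have cx: "chart_inv ?c ?u = x" by (rule chart(5)[OF chart_at(1) chart_at(2)])
  have "Ck_on l ?G {(t, u). u \<in> snd ?c ` fst ?c \<and> \<Phi> t (chart_inv ?c u) \<in> fst ?d}"
    using flow chart_at(1) by (simp add: Ck_flow_def)
  then have "?G differentiable (at (t0, ?u))"
    by (rule Ck_on_imp_differentiable[OF _ l_pos]) (simp add: cx chart_at(2))
  then obtain D where D: "(?G has_derivative D) (at (t0, ?u))"
    by (auto simp: differentiable_def)
  have linD: "linear D" using D by (rule has_derivative_linear)
  have "((\<lambda>u. ?G (t0, u)) has_derivative (\<lambda>v. D (0, v))) (at ?u)"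
    by (rule has_derivative_compose[of "\<lambda>u. (t0, u)" "\<lambda>v. (0, v)", OF _ D])
       (intro has_derivative_Pair has_derivative_const has_derivative_ident)
  then have 1: "has_tangent (\<Phi> t0) x (\<lambda>v. D (0, v))" by (simp add: has_tangent_def)
  have "((\<lambda>t. ?G (t, ?u)) has_derivative (\<lambda>h. D (h, 0))) (at t0)"
    by (rule has_derivative_compose[of "\<lambda>t. (t, ?u)" "\<lambda>h. (h, 0)", OF _ D])
       (intro has_derivative_Pair has_derivative_const has_derivative_ident)
  moreover have "(\<lambda>h. D (h, 0)) = (\<lambda>h. h *\<^sub>R D (1, 0))"
  proof
    fix h show "D (h, 0) = h *\<^sub>R D (1, 0)" using linear_scale[OF linD, of h "(1, 0)"] by simp
  qed
  ultimately have "((\<lambda>t. ?G (t, ?u)) has_derivative (\<lambda>h. h *\<^sub>R D (1, 0))) (at t0)" by (simp only:)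
  then have 2: "has_velocity (\<lambda>t. \<Phi> t x) t0 (D (1, 0))"
    by (simp add: has_velocity_def has_vector_derivative_def cx)
  show ?thesis by (rule that[OF D 1 2])
qed

lemma has_tangent_flow: "has_tangent (\<Phi> t) x (tangent_map A (\<Phi> t) x)"
  by (rule flow_in_charts_derivative[of t x]) (simp add: has_tangent_imp_tangent_map)

lemma linear_tangent_flow: "linear (tangent_map A (\<Phi> t) x)"
  using has_tangent_flow[of t x] unfolding has_tangent_def by (rule has_derivative_linear)

lemma tangent_flow_0: "tangent_map A (\<Phi> 0) x v = v"
proof -
  have "\<Phi> 0 = (\<lambda>x. x)" by (rule ext) simp
  then show ?thesis using has_tangent_imp_tangent_map[OF has_tangent_id, of x] by simp
qed

lemma tangent_flow_add:
  "tangent_map A (\<Phi> (s + t)) x v = tangent_map A (\<Phi> s) (\<Phi> t x) (tangent_map A (\<Phi> t) x v)"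
proof -
  have "has_tangent (\<lambda>z. \<Phi> s (\<Phi> t z)) x (\<lambda>v. tangent_map A (\<Phi> s) (\<Phi> t x) (tangent_map A (\<Phi> t) x v))"
    by (rule has_tangent_compose[OF isCont_flow has_tangent_flow has_tangent_flow])
  moreover have "(\<lambda>z. \<Phi> s (\<Phi> t z)) = \<Phi> (s + t)" by (rule ext) (simp add: flow_add)
  ultimately show ?thesis by (simp add: has_tangent_imp_tangent_map)
qed

lemma bij_tangent_flow: "bij (tangent_map A (\<Phi> t) x)"
proof (rule bij_betw_byWitness[where f' = "tangent_map A (\<Phi> (- t)) (\<Phi> t x)"])
  show "\<forall>v\<in>UNIV. tangent_map A (\<Phi> (- t)) (\<Phi> t x) (tangent_map A (\<Phi> t) x v) = v"
    using tangent_flow_add[of "- t" t x] by (simp add: tangent_flow_0)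
  show "\<forall>v\<in>UNIV. tangent_map A (\<Phi> t) x (tangent_map A (\<Phi> (- t)) (\<Phi> t x) v) = v"
    using tangent_flow_add[of t "- t" "\<Phi> t x"] by (simp add: tangent_flow_0)
qed auto

lemma inner_form_pulled_metric:
  assumes "\<And>y. inner_form (g y)" shows "inner_form (pulled_metric A g \<Phi> x t)"
  using inner_form_pullback[OF assms linear_tangent_flow bij_is_inj[OF bij_tangent_flow], of "\<Phi> t x" t x]
  by (simp add: pulled_metric_def[abs_def])

text \<open>Times commute, so \<open>\<Phi> t\<close> carries the orbit curve through
  \<open>x\<close> to the orbit curve through \<open>\<Phi> t x\<close>, and hence velocity to
  velocity.\<close>

lemma tangent_flow_velocity:
  assumes "has_velocity (\<lambda>s. \<Phi> s x) 0 v" "has_velocity (\<lambda>s. \<Phi> s (\<Phi> t x)) 0 w"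
  shows "tangent_map A (\<Phi> t) x v = w"
proof -
  have "has_velocity (\<lambda>s. \<Phi> t (\<Phi> s x)) 0 (tangent_map A (\<Phi> t) x v)"
    by (rule has_velocity_compose[OF isCont_orbit assms(1)]) (simp add: has_tangent_flow)
  moreover have "(\<lambda>s. \<Phi> t (\<Phi> s x)) = (\<lambda>s. \<Phi> s (\<Phi> t x))" by (rule ext) (rule flow_commute)
  ultimately show ?thesis using assms(2) has_velocity_unique by simp
qed

end

locale Ck_reparameterization = Ck_flow_on_manifold A m l \<Phi> + rep: Ck_flow_on_manifold A m l \<Psi>
  for A :: "('a::{t2_space,second_countable_topology}, 'n::finite) chart set" and m l :: nat
    and \<Phi> \<Psi> :: "real \<Rightarrow> 'a \<Rightarrow> 'a" +
  assumes time_reparameterization: "time_reparameterization \<Phi> \<Psi>"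
begin

sublocale reparameterized_flow \<Phi> \<Psi>
  by unfold_locales (rule time_reparameterization)

text \<open>\<open>\<Psi> \<tau>\<close> is \<open>\<Phi>\<close> at a time read from the clock of
  the moving point. By \<open>tendsto_clock\<close> this time is continuous in the point, which
  suffices for \<open>increments_in_direction\<close>; the unknown variation of the clock enters
  through the multiple \<open>a\<close> of the velocity.\<close>

lemma tangent_reparam:
  assumes x: "x \<in> nonfixed \<Phi>" and w: "has_velocity (\<lambda>t. \<Phi> t x) (clock x \<tau>) w" "w \<noteq> 0"
  shows "\<exists>a::real. tangent_map A (\<Psi> \<tau>) x v = tangent_map A (\<Phi> (clock x \<tau>)) x v + a *\<^sub>R w"
proof -
  let ?c = "chart_at A x" let ?d = "chart_at A (\<Psi> \<tau> x)" let ?u = "snd ?c x"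
  have cx: "chart_inv ?c ?u = x" by (rule chart(5)[OF chart_at(1) chart_at(2)])
  have eq: "\<Psi> \<tau> x = \<Phi> (clock x \<tau>) x" by (rule clock_eq)
  obtain D where D: "((\<lambda>(t, u). snd ?d (\<Phi> t (chart_inv ?c u))) has_derivative D) (at (clock x \<tau>, ?u))"
    "has_tangent (\<Phi> (clock x \<tau>)) x (\<lambda>v. D (0, v))" "has_velocity (\<lambda>t. \<Phi> t x) (clock x \<tau>) (D (1, 0))"
    using flow_in_charts_derivative[of "clock x \<tau>" x] unfolding eq by blast
  have D1: "D (1, 0) = w" by (rule has_velocity_unique[OF D(3) w(1)])
  have K: "((\<lambda>u. snd ?d (\<Psi> \<tau> (chart_inv ?c u))) has_derivative tangent_map A (\<Psi> \<tau>) x) (at ?u)"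
    using rep.has_tangent_flow[of \<tau> x] by (simp add: has_tangent_def)
  define e where "e n = 1 / real (Suc n)" for n
  define z where "z n = chart_inv ?c (?u + e n *\<^sub>R v)" for n
  have e: "e \<longlonglongrightarrow> 0" "\<And>n. 0 < e n"
    unfolding e_def by (rule LIMSEQ_Suc[OF lim_1_over_n]) simp
  have "(\<lambda>n. ?u + e n *\<^sub>R v) \<longlonglongrightarrow> ?u + 0 *\<^sub>R v"
    by (intro tendsto_add tendsto_const tendsto_scaleR e(1))
  then have "z \<longlonglongrightarrow> chart_inv ?c ?u"
    unfolding z_def by (intro isCont_tendsto_compose[OF isCont_chart_inv[OF chart_at]]) simp
  then have z: "z \<longlonglongrightarrow> x" by (simp add: cx)
  have "\<exists>a::real. tangent_map A (\<Psi> \<tau>) x v = D (0, v) + a *\<^sub>R w"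
  proof (rule increments_in_direction[OF D(1) K D1 w(2) tendsto_clock[OF x z] e])
    show "(case (clock (z n) \<tau>, ?u + e n *\<^sub>R v) of (t, u) \<Rightarrow> snd ?d (\<Phi> t (chart_inv ?c u)))
        = snd ?d (\<Psi> \<tau> (chart_inv ?c (?u + e n *\<^sub>R v)))" for n
      using clock_eq[of \<tau> "z n"] by (simp add: z_def)
    show "(case (clock x \<tau>, ?u) of (t, u) \<Rightarrow> snd ?d (\<Phi> t (chart_inv ?c u)))
        = snd ?d (\<Psi> \<tau> (chart_inv ?c ?u))"
      by (simp add: cx eq)
  qed
  then show ?thesis using has_tangent_imp_tangent_map[OF D(2)] by simp
qed

end

lemma inner_form_riemannian_metric: "Ck_riemannian_metric A k g \<Longrightarrow> inner_form (g x)"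
  unfolding Ck_riemannian_metric_def inner_form_def by blast

locale generated_reparameterization = Ck_reparameterization A m l \<Phi> \<Psi>
  for A :: "('a::{t2_space,second_countable_topology}, 'n::finite) chart set" and m l :: nat
    and \<Phi> \<Psi> :: "real \<Rightarrow> 'a \<Rightarrow> 'a" +
  fixes g :: "'a \<Rightarrow> real^'n \<Rightarrow> real^'n \<Rightarrow> real" and f :: "'a \<Rightarrow> real^'n" and r :: "'a \<Rightarrow> real"
  assumes form: "\<And>x. inner_form (g x)" and generates: "generates A f \<Phi>"
    and associated: "associated_function A l \<Phi> \<Psi> r"
begin

lemma velocity_flow: "has_velocity (\<lambda>s. \<Phi> s x) t (f (\<Phi> t x))"
  using generates by (simp add: generates_def has_velocity_def)

lemma tangent_flow_field: "tangent_map A (\<Phi> t) x (f x) = f (\<Phi> t x)"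
  by (rule tangent_flow_velocity) (use velocity_flow[of x 0] velocity_flow[of "\<Phi> t x" 0] in simp_all)

lemma field_nonzero_flow: "f x \<noteq> 0 \<Longrightarrow> f (\<Phi> t x) \<noteq> 0"
  using tangent_flow_field[of t x] bij_tangent_flow[of t x] linear_0[OF linear_tangent_flow, of t x]
  by (metis bij_is_inj injD)

lemma nonfixed_field: "f x \<noteq> 0 \<Longrightarrow> x \<in> nonfixed \<Phi>"
proof (rule ccontr)
  assume "f x \<noteq> 0" "x \<notin> nonfixed \<Phi>"
  then have c: "(\<lambda>s. \<Phi> s x) = (\<lambda>s. x)" by (auto simp: nonfixed_def)
  have "has_velocity (\<lambda>s. x) 0 (f x)" using velocity_flow[of x 0] by (simp add: c)
  moreover have "has_velocity (\<lambda>s. x) 0 0"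
    unfolding has_velocity_def by (rule has_vector_derivative_const)
  ultimately show False using has_velocity_unique \<open>f x \<noteq> 0\<close> by blast
qed

lemma r_nonfixed: "x \<in> nonfixed \<Phi> \<Longrightarrow> 0 < r x \<and>
    (\<exists>\<theta> D. time_change \<Phi> \<Psi> x \<theta> \<and> (\<theta> has_real_derivative D) (at 0) \<and> r x = inverse D)"
  using associated unfolding associated_function_def by blast

lemma r_nonneg: "0 \<le> r x"
  using associated by (simp add: associated_function_def)

lemma velocity_reparam:
  assumes x: "x \<in> nonfixed \<Phi>" shows "has_velocity (\<lambda>\<sigma>. \<Psi> \<sigma> x) 0 (f x /\<^sub>R r x)"
proof -
  let ?c = "chart_at A x"
  have "(clock x has_real_derivative inverse (r (\<Psi> 0 x))) (at 0)"
    by (rule clock_derivative[OF x]) (use r_nonfixed in blast)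
  then have cl: "(clock x has_real_derivative inverse (r x)) (at 0)" by simp
  have "((\<lambda>s. snd ?c (\<Phi> s x)) has_vector_derivative f x) (at (clock x 0))"
    using velocity_flow[of x 0] by (simp add: has_velocity_def)
  from vector_diff_chain_at[OF cl[unfolded has_real_derivative_iff_has_vector_derivative] this]
  have "((\<lambda>\<sigma>. snd ?c (\<Phi> (clock x \<sigma>) x)) has_vector_derivative f x /\<^sub>R r x) (at 0)"
    by (simp add: comp_def)
  then show ?thesis by (simp add: has_velocity_def clock_eq)
qed

text \<open>The velocity field of \<open>\<Psi>\<close> is \<open>f / r\<close>, and it is this
  field that \<open>\<Psi>\<close> transports. Rewriting in terms of \<open>f\<close> leaves the
  quotient of the two values of \<open>r\<close>.\<close>

lemma tangent_reparam_field:
  assumes x: "x \<in> nonfixed \<Phi>"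
  shows "tangent_map A (\<Psi> \<tau>) x (f x) = (r x / r (\<Psi> \<tau> x)) *\<^sub>R f (\<Psi> \<tau> x)"
proof -
  have y: "\<Psi> \<tau> x \<in> nonfixed \<Phi>"
    using x rep.nonfixed_flow[of x \<tau>] by (simp add: nonfixed_reparam)
  have eq: "tangent_map A (\<Psi> \<tau>) x (f x /\<^sub>R r x) = f (\<Psi> \<tau> x) /\<^sub>R r (\<Psi> \<tau> x)"
    by (rule rep.tangent_flow_velocity[OF velocity_reparam[OF x] velocity_reparam[OF y]])
  have "f x = r x *\<^sub>R (f x /\<^sub>R r x)" using r_nonfixed[OF x] by simp
  then have "tangent_map A (\<Psi> \<tau>) x (f x) = r x *\<^sub>R tangent_map A (\<Psi> \<tau>) x (f x /\<^sub>R r x)"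
    using linear_scale[OF rep.linear_tangent_flow] by metis
  then show ?thesis by (simp add: eq divide_inverse)
qed

lemmas inner_form_pulled = inner_form_pulled_metric[of g, OF form]

lemmas inner_form_pulled_reparam = rep.inner_form_pulled_metric[of g, OF form]

lemma riem_norm_pulled_field:
  assumes "f x \<noteq> 0"
  shows "riem_norm (pulled_metric A g \<Psi> x) (elapsed x t) (f x)
    = r x / r (\<Phi> t x) * riem_norm (pulled_metric A g \<Phi> x) t (f x)"
proof -
  have x: "x \<in> nonfixed \<Phi>" by (rule nonfixed_field[OF assms])
  have "0 < r x" "0 < r (\<Phi> t x)"
    using r_nonfixed x nonfixed_flow[of x t] by simp_all
  then show ?thesis
    by (simp add: riem_norm_pulled_metric tangent_reparam_field[OF x] flow_elapsed[OF x]
        tangent_flow_field riem_norm_scale[of g "\<Phi> t x", OF form])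
qed

text \<open>Both tangent maps send \<open>f x\<close> to a multiple of \<open>f\<close> at the same
  later point, so the discrepancy between them is absorbed by adding a multiple of
  \<open>f x\<close> to the argument. For \<open>\<Psi>\<close> the multiple \<open>a'\<close> also
  undoes the factor from \<open>tangent_reparam_field\<close>.\<close>

lemma slow_mod_reparam:
  assumes "f x \<noteq> 0"
  shows "slow_mod (\<lambda>n. pulled_metric A g \<Phi> x (s n)) (f x) c
    = slow_mod (\<lambda>n. pulled_metric A g \<Psi> x (elapsed x (s n))) (f x) c"
proof -
  have x: "x \<in> nonfixed \<Phi>" by (rule nonfixed_field[OF assms])
  have T: "\<exists>a::real. tangent_map A (\<Psi> (elapsed x t)) x v = tangent_map A (\<Phi> t) x v + a *\<^sub>R f (\<Phi> t x)" for t v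
    using tangent_reparam[OF x, of "elapsed x t" "f (\<Phi> t x)" v] velocity_flow[of x t]
      field_nonzero_flow[OF assms, of t] by (simp add: clock_elapsed[OF x])
  note lin = linear_add[OF linear_tangent_flow] linear_scale[OF linear_tangent_flow]
    linear_add[OF rep.linear_tangent_flow] linear_scale[OF rep.linear_tangent_flow]
    linear_diff[OF rep.linear_tangent_flow]
  have pos: "0 < r x" "0 < r (\<Phi> t x)" for t
    using r_nonfixed x nonfixed_flow[of x t] by simp_all
  show ?thesis
  proof (intro equalityI slow_mod_mono)
    fix n v
    obtain a :: real where a: "tangent_map A (\<Psi> (elapsed x (s n))) x v
        = tangent_map A (\<Phi> (s n)) x v + a *\<^sub>R f (\<Phi> (s n) x)" using T by blast
    have "tangent_map A (\<Phi> (s n)) x (v + a *\<^sub>R f x) = tangent_map A (\<Psi> (elapsed x (s n))) x v"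
      by (simp add: lin a tangent_flow_field)
    then show "\<exists>a. riem_norm (\<lambda>n. pulled_metric A g \<Phi> x (s n)) n (v + a *\<^sub>R f x)
        = riem_norm (\<lambda>n. pulled_metric A g \<Psi> x (elapsed x (s n))) n v"
      by (intro exI[of _ a]) (simp add: riem_norm_def pulled_metric_def flow_elapsed[OF x])
    define a' where "a' = - a * r (\<Phi> (s n) x) / r x"
    have "tangent_map A (\<Psi> (elapsed x (s n))) x (v + a' *\<^sub>R f x) = tangent_map A (\<Phi> (s n)) x v"
      using pos(1) pos(2)[of "s n"] by (simp add: lin a tangent_reparam_field[OF x] flow_elapsed[OF x] a'_def)
    then show "\<exists>a. riem_norm (\<lambda>n. pulled_metric A g \<Psi> x (elapsed x (s n))) n (v + a *\<^sub>R f x)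
        = riem_norm (\<lambda>n. pulled_metric A g \<Phi> x (s n)) n v"
      by (intro exI[of _ a']) (simp add: riem_norm_def pulled_metric_def flow_elapsed[OF x])
  qed
qed

end

lemma tendsto_quotient_self: "(\<lambda>n. real n / real n) \<longlonglongrightarrow> 1"
  by (rule tendsto_eventually) (use eventually_gt_at_top[of 0] in eventually_elim, simp)

lemma sorted_eq_by_mset: "sorted xs \<Longrightarrow> sorted ys \<Longrightarrow> mset xs = mset ys \<Longrightarrow> xs = ys"
  by (metis sorted_sort_id properties_for_sort)

text \<open>The tangent map carries a frame at \<open>x\<close> for the times \<open>n + s\<close>
  to a frame at \<open>\<Phi> s x\<close> for the times \<open>n\<close>. Both frames there contain
  \<open>w\<close> and refer to the same metrics, so their exponents agree.\<close>

lemma (in Ck_flow_on_manifold) exponents_flow_invariant: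
  assumes g: "\<And>y. inner_form (g y)" and v: "v \<noteq> 0" "tangent_map A (\<Phi> s) x v = w"
    and os: "oseledets_splitting A g \<Phi> x (\<Lambda>, E)" "0 \<in> \<Lambda>" "v \<in> E 0"
    and os': "oseledets_splitting A g \<Phi> (\<Phi> s x) (\<Lambda>', E')" "0 \<in> \<Lambda>'" "w \<in> E' 0"
  shows "exponent_list \<Lambda>' E' = exponent_list \<Lambda> E"
proof -
  let ?y = "\<Phi> s x" let ?M = "tangent_map A (\<Phi> s) x"
  have w: "w \<noteq> 0"
    using v linear_injective_0[OF linear_tangent_flow] bij_is_inj[OF bij_tangent_flow] by blast
  \<comment> \<open>A fixed shift does not change the rate \<open>1\<close> of the times.\<close>
  have "(\<lambda>n. real n / real n + s / real n) \<longlonglongrightarrow> 1 + 0"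
    by (intro tendsto_add tendsto_quotient_self lim_const_over_n)
  then have shift: "(\<lambda>n. (real n + s) / real n) \<longlonglongrightarrow> 1" by (simp add: add_divide_distrib)
  obtain b :: "'n \<Rightarrow> real^'n" and k i0 where
    fr: "adapted_frame (\<lambda>n. pulled_metric A g \<Phi> x (real n + s)) b (\<lambda>i. 1 * k i)"
    and k: "b i0 = v" "k i0 = 0" "image_mset k (mset_set UNIV) = mset (exponent_list \<Lambda> E)"
    by (rule splitting_adapted_frame[OF os(1) g linear_tangent_flow bij_tangent_flow os(2,3) v(1) shift]) auto
  obtain b' :: "'n \<Rightarrow> real^'n" and k' j0 where
    fr': "adapted_frame (\<lambda>n. pulled_metric A g \<Phi> ?y (real n)) b' (\<lambda>i. 1 * k' i)"
    and k': "b' j0 = w" "k' j0 = 0" "image_mset k' (mset_set UNIV) = mset (exponent_list \<Lambda>' E')"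
    by (rule splitting_adapted_frame[OF os'(1) g linear_tangent_flow bij_tangent_flow os'(2,3) w tendsto_quotient_self]) auto
  have pm: "inner_form (pulled_metric A g \<Phi> ?y t)" for t
    by (rule inner_form_pulled_metric[of g, OF g])
  have push: "adapted_frame (\<lambda>n. pulled_metric A g \<Phi> ?y (real n)) (\<lambda>i. ?M (b i)) (\<lambda>i. 1 * k i)"
    by (rule adapted_frame_push[OF fr linear_tangent_flow bij_tangent_flow pm])
       (simp add: pulled_metric_def tangent_flow_add flow_add)
  have "image_mset (\<lambda>i. 1 * k' i) (mset_set UNIV) = image_mset (\<lambda>i. 1 * k i) (mset_set UNIV)"
    by (rule adapted_frames_same_exponents[OF fr' push k'(1) trans[OF arg_cong[OF k(1), of ?M] v(2)]])
       (simp_all add: k k')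
  then have "mset (exponent_list \<Lambda>' E') = mset (exponent_list \<Lambda> E)" by (simp add: k(3) k'(3))
  then show ?thesis by (intro sorted_eq_by_mset sorted_exponent_list)
qed

context generated_reparameterization
begin

text \<open>The growth of the flow direction under \<open>\<Psi>\<close> along the times \<open>elapsed x (t n)\<close> is
  that of \<open>1 / r\<close> up to a factor of growth rate \<open>0\<close>.\<close>

lemma reparam_field_components:
  assumes fx: "f x \<noteq> 0" and os: "oseledets_splitting A g \<Phi> x (\<Lambda>, E)" "0 \<in> \<Lambda>" "f x \<in> E 0"
    and os': "oseledets_splitting A g \<Psi> x (\<Lambda>', E')"
    and w: "\<And>\<kappa>. \<kappa> \<in> \<Lambda>' \<Longrightarrow> w \<kappa> \<in> E' \<kappa>" "f x = (\<Sum>\<kappa>\<in>\<Lambda>'. w \<kappa>)"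
    and t: "(\<lambda>n. t n / real n) \<longlonglongrightarrow> \<epsilon>" "\<epsilon> \<noteq> 0"
    and \<sigma>: "(\<lambda>n. elapsed x (t n) / real n) \<longlonglongrightarrow> \<sigma>" "\<sigma> \<noteq> 0"
    and slow: "\<And>L. (\<lambda>n. ln (r (\<Phi> (t n) x)) / real n) \<longlonglongrightarrow> L \<Longrightarrow> L = 0"
    and \<kappa>: "\<kappa> \<in> \<Lambda>'" "w \<kappa> \<noteq> 0"
  shows "\<sigma> * \<kappa> \<le> 0"
proof -
  have x: "x \<in> nonfixed \<Phi>" by (rule nonfixed_field[OF fx])
  obtain m where m: "\<And>\<kappa>. \<kappa> \<in> \<Lambda>' \<Longrightarrow> w \<kappa> \<noteq> 0 \<Longrightarrow> \<sigma> * \<kappa> \<le> \<sigma> * m"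
    and lim: "(\<lambda>n. ln (riem_norm (\<lambda>n. pulled_metric A g \<Psi> x (elapsed x (t n))) n (f x)) / real n) \<longlonglongrightarrow> \<sigma> * m"
    using splitting_limit[OF os' inner_form_pulled_reparam w fx \<sigma>] by metis
  have lim0: "(\<lambda>n. ln (riem_norm (\<lambda>n. pulled_metric A g \<Phi> x (t n)) n (f x)) / real n) \<longlonglongrightarrow> \<epsilon> * 0"
    by (rule splitting_rates(1)[OF os(1) t os(2,3) fx])
  \<comment> \<open>The norms of the flow direction under the two flows differ by the factor
    \<open>r x / r (\<Phi> (t n) x)\<close>, so their rates determine that of \<open>r\<close> along
    the orbit.\<close>
  have eq: "ln (r x) / real n + ln (riem_norm (\<lambda>n. pulled_metric A g \<Phi> x (t n)) n (f x)) / real n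
      - ln (riem_norm (\<lambda>n. pulled_metric A g \<Psi> x (elapsed x (t n))) n (f x)) / real n
      = ln (r (\<Phi> (t n) x)) / real n" for n
  proof -
    have pos: "0 < r x" "0 < r (\<Phi> (t n) x)" using r_nonfixed x nonfixed_flow[of x "t n"] by simp_all
    have N: "0 < riem_norm (pulled_metric A g \<Phi> x) (t n) (f x)"
      by (rule riem_norm_pos[of "pulled_metric A g \<Phi> x", OF inner_form_pulled fx])
    have "riem_norm (\<lambda>n. pulled_metric A g \<Psi> x (elapsed x (t n))) n (f x)
        = r x / r (\<Phi> (t n) x) * riem_norm (pulled_metric A g \<Phi> x) (t n) (f x)"
      using riem_norm_pulled_field[OF fx, of "t n"] by (simp only: riem_norm_def)
    moreover have "riem_norm (\<lambda>n. pulled_metric A g \<Phi> x (t n)) n (f x)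
        = riem_norm (pulled_metric A g \<Phi> x) (t n) (f x)" by (simp only: riem_norm_def)
    ultimately show ?thesis
      using pos N by (simp add: ln_mult_pos ln_divide_pos add_divide_distrib diff_divide_distrib)
  qed
  \<comment> \<open>Regularity of both flows provides a limit of this sequence, and
    \<open>slow\<close> identifies it as \<open>0\<close>. Hence the dominant component of
    \<open>f x\<close> has exponent \<open>0\<close>.\<close>
  have "(\<lambda>n. ln (r (\<Phi> (t n) x)) / real n) \<longlonglongrightarrow> 0 + \<epsilon> * 0 - \<sigma> * m"
    unfolding eq[symmetric] by (intro tendsto_diff tendsto_add lim_const_over_n lim lim0)
  then have "0 + \<epsilon> * 0 - \<sigma> * m = 0" by (rule slow)
  then show ?thesis using m[OF \<kappa>] by linarith
qed

text \<open>Forward times bound the exponents of the components of \<open>f x\<close> by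
  \<open>0\<close> from above, backward times from below. Only the component in \<open>E' 0\<close>
  remains.\<close>

lemma reparam_zero_exponent:
  assumes fx: "f x \<noteq> 0" and os: "oseledets_splitting A g \<Phi> x (\<Lambda>, E)" "0 \<in> \<Lambda>" "f x \<in> E 0"
    and os': "oseledets_splitting A g \<Psi> x (\<Lambda>', E')"
    and \<rho>: "(\<lambda>n. elapsed x (real n) / real n) \<longlonglongrightarrow> \<rho>" "0 < \<rho>"
    and \<rho>': "(\<lambda>n. elapsed x (- real n) / real n) \<longlonglongrightarrow> - \<rho>'" "0 < \<rho>'"
    and slow: "\<And>L. (\<lambda>n. ln (r (\<Phi> (real n) x)) / real n) \<longlonglongrightarrow> L \<Longrightarrow> L = 0"
    and slow': "\<And>L. (\<lambda>n. ln (r (\<Phi> (- real n) x)) / real n) \<longlonglongrightarrow> L \<Longrightarrow> L = 0"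
  shows "0 \<in> \<Lambda>'" "f x \<in> E' 0"
proof -
  have minus_one: "(\<lambda>n. - real n / real n) \<longlonglongrightarrow> - 1"
    using tendsto_minus[OF tendsto_quotient_self] by simp
  have fin: "finite \<Lambda>'" and sub: "\<And>\<kappa>. \<kappa> \<in> \<Lambda>' \<Longrightarrow> subspace (E' \<kappa>)"
    and dec: "\<exists>!w. w \<in> Pi\<^sub>E \<Lambda>' E' \<and> f x = (\<Sum>\<kappa>\<in>\<Lambda>'. w \<kappa>)"
    using os' unfolding oseledets_splitting_def by auto
  obtain w where w: "\<And>\<kappa>. \<kappa> \<in> \<Lambda>' \<Longrightarrow> w \<kappa> \<in> E' \<kappa>" "f x = (\<Sum>\<kappa>\<in>\<Lambda>'. w \<kappa>)"
    by (rule splitting_decomposition[OF dec]) (rule that)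
  have zero: "\<kappa> = 0" if \<kappa>: "\<kappa> \<in> \<Lambda>'" "w \<kappa> \<noteq> 0" for \<kappa>
  proof -
    have "\<rho> * \<kappa> \<le> 0"
      by (rule reparam_field_components[OF fx os os' w tendsto_quotient_self _ \<rho>(1) _ slow \<kappa>]) (use \<rho> in auto)
    moreover have "- \<rho>' * \<kappa> \<le> 0"
      by (rule reparam_field_components[OF fx os os' w minus_one _ \<rho>'(1) _ slow' \<kappa>]) (use \<rho>' in auto)
    ultimately show "\<kappa> = 0" using \<rho>(2) \<rho>'(2) by (simp add: mult_le_0_iff zero_le_mult_iff)
  qed
  show "0 \<in> \<Lambda>'"
  proof (rule ccontr)
    assume "0 \<notin> \<Lambda>'"
    then have "w \<kappa> = 0" if "\<kappa> \<in> \<Lambda>'" for \<kappa> using zero that by auto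
    then have "f x = 0" by (simp add: w(2))
    with fx show False by simp
  qed
  have "f x = w 0"
  proof -
    have "(\<Sum>\<kappa>\<in>\<Lambda>'. w \<kappa>) = (\<Sum>\<kappa>\<in>{0}. w \<kappa>)"
      by (rule sum.mono_neutral_right[OF fin]) (use zero \<open>0 \<in> \<Lambda>'\<close> in auto)
    then show ?thesis by (simp add: w(2))
  qed
  then show "f x \<in> E' 0" using w(1)[OF \<open>0 \<in> \<Lambda>'\<close>] by simp
qed

text \<open>With \<open>\<Phi>\<close> read at integer times and \<open>\<Psi>\<close> at the
  corresponding times \<open>elapsed x n\<close>, the growth modulo \<open>f x\<close> is the same.
  The second frame has its exponents multiplied by \<open>\<rho>\<close> because these times grow
  like \<open>\<rho> * n\<close>, and a positive factor preserves the order of the list.\<close>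

theorem reparam_exponents:
  assumes fx: "f x \<noteq> 0" and os: "oseledets_splitting A g \<Phi> x (\<Lambda>, E)" "0 \<in> \<Lambda>" "f x \<in> E 0"
    and os': "oseledets_splitting A g \<Psi> x (\<Lambda>', E')" "0 \<in> \<Lambda>'" "f x \<in> E' 0"
    and \<rho>: "(\<lambda>n. elapsed x (real n) / real n) \<longlonglongrightarrow> \<rho>" "0 < \<rho>"
  shows "exponent_list \<Lambda> E = map ((*) \<rho>) (exponent_list \<Lambda>' E')"
proof -
  have x: "x \<in> nonfixed \<Phi>" by (rule nonfixed_field[OF fx])
  obtain b :: "'n \<Rightarrow> real^'n" and k i0 where
    fr: "adapted_frame (\<lambda>n. pulled_metric A g \<Phi> x (real n)) b (\<lambda>i. 1 * k i)"
    and k: "b i0 = f x" "k i0 = 0" "image_mset k (mset_set UNIV) = mset (exponent_list \<Lambda> E)"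
    by (rule splitting_adapted_frame[OF os(1) form linear_tangent_flow bij_tangent_flow os(2,3) fx tendsto_quotient_self]) auto
  obtain b' :: "'n \<Rightarrow> real^'n" and k' j0 where
    fr': "adapted_frame (\<lambda>n. pulled_metric A g \<Psi> x (elapsed x (real n))) b' (\<lambda>i. \<rho> * k' i)"
    and k': "b' j0 = f x" "k' j0 = 0" "image_mset k' (mset_set UNIV) = mset (exponent_list \<Lambda>' E')"
    by (rule splitting_adapted_frame[OF os'(1) form rep.linear_tangent_flow rep.bij_tangent_flow os'(2,3) fx \<rho>(1)])
       (use \<rho>(2) in auto)
  have "image_mset (\<lambda>i. 1 * k i) (mset_set UNIV) = image_mset (\<lambda>i. \<rho> * k' i) (mset_set UNIV)"
    by (rule adapted_frames_same_exponents[OF fr fr' k(1) k'(1)])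
       (simp_all add: k k' slow_mod_reparam[OF fx])
  then have "mset (exponent_list \<Lambda> E) = image_mset ((*) \<rho>) (image_mset k' (mset_set UNIV))"
    by (simp add: k(3) image_mset.compositionality comp_def)
  then have "mset (exponent_list \<Lambda> E) = mset (map ((*) \<rho>) (exponent_list \<Lambda>' E'))"
    by (simp add: k'(3))
  moreover have "sorted (map ((*) \<rho>) (exponent_list \<Lambda>' E'))"
    using sorted_exponent_list[of \<Lambda>' E'] \<rho>(2)
    by (simp add: sorted_map)
  ultimately show ?thesis by (intro sorted_eq_by_mset sorted_exponent_list)
qed

end

section \<open>Invariant measures of flows\<close>

lemma (in continuous_flow) measurable_flow_compose [measurable (raw)]:
  assumes [measurable]: "t \<in> borel_measurable N" "z \<in> borel_measurable N"
  shows "(\<lambda>x. \<Phi> (t x) (z x)) \<in> borel_measurable N"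
proof -
  have "(\<lambda>p. \<Phi> (fst p) (snd p)) \<in> borel_measurable borel"
    using flow_continuous by (intro borel_measurable_continuous_onI) (simp add: case_prod_unfold)
  then have joint: "(\<lambda>p. \<Phi> (fst p) (snd p)) \<in> borel \<Otimes>\<^sub>M borel \<rightarrow>\<^sub>M borel" by (simp add: borel_prod)
  have "(\<lambda>x. (t x, z x)) \<in> N \<rightarrow>\<^sub>M borel \<Otimes>\<^sub>M borel" by measurable
  from measurable_compose[OF this joint] show ?thesis by simp
qed

lemma (in continuous_flow) measurable_flow: "\<Phi> t \<in> borel \<rightarrow>\<^sub>M borel"
  by (rule borel_measurable_continuous_onI) (simp add: continuous_on_eq_continuous_at isCont_flow)

locale measure_preserving_flow = continuous_flow \<Phi> + prob_space M
  for \<Phi> :: "real \<Rightarrow> 'a::{t2_space,second_countable_topology} \<Rightarrow> 'a" and M :: "'a measure" +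
  assumes sets_M [measurable_cong]: "sets M = sets borel"
    and distr_flow: "distr M M (\<Phi> t) = M"
begin

lemma measurable_flow_M [measurable]: "\<Phi> t \<in> M \<rightarrow>\<^sub>M M"
  using measurable_flow by (simp cong: measurable_cong_sets[OF sets_M sets_M])

lemma measure_preserving_flow_map: "measure_preserving_map M (\<Phi> t)"
  by unfold_locales (simp_all add: distr_flow)

lemma reversed: "measure_preserving_flow (\<lambda>t. \<Phi> (- t)) M"
proof unfold_locales
  show "\<Phi> (- (s + t)) x = \<Phi> (- s) (\<Phi> (- t) x)" for s t x
    using flow_add[of "- s" "- t" x] by simp
  show "continuous_on UNIV (\<lambda>(t, x). \<Phi> (- t) x)"
    unfolding continuous_on_eq_continuous_within continuous_within case_prod_unfold
    by (intro ballI tendsto_flow tendsto_intros)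
qed (simp_all add: sets_M distr_flow)

lemma nn_integral_flow:
  assumes "f \<in> borel_measurable M"
  shows "(\<integral>\<^sup>+x. f (\<Phi> t x) \<partial>M) = (\<integral>\<^sup>+x. f x \<partial>M)"
  by (rule measure_preserving_map.nn_integral_T[OF measure_preserving_flow_map assms])

text \<open>After the integrals are exchanged, invariance makes the inner one independent of
  \<open>s\<close> on the interval, so only its length is left as a factor.\<close>

lemma nn_integral_time_integral:
  fixes F :: "'a \<Rightarrow> ennreal" and h :: "'a \<Rightarrow> ennreal"
  assumes [measurable]: "F \<in> borel_measurable M" "h \<in> borel_measurable M"
    and inv: "\<And>s. AE x in M. h (\<Phi> s x) = h x"
  shows "(\<integral>\<^sup>+x. h x * (\<integral>\<^sup>+s. F (\<Phi> s x) * indicator {a..b} s \<partial>lborel) \<partial>M)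
    = emeasure lborel {a..b} * (\<integral>\<^sup>+x. h x * F x \<partial>M)"
proof -
  have [measurable]: "(indicator {a..b} :: real \<Rightarrow> ennreal) \<in> borel_measurable borel" by simp
  interpret pair_sigma_finite lborel M
    by (intro pair_sigma_finite.intro sigma_finite_lborel sigma_finite_measure_axioms)
  have "(\<integral>\<^sup>+x. h x * (\<integral>\<^sup>+s. F (\<Phi> s x) * indicator {a..b} s \<partial>lborel) \<partial>M)
      = (\<integral>\<^sup>+x. (\<integral>\<^sup>+s. h x * (F (\<Phi> s x) * indicator {a..b} s) \<partial>lborel) \<partial>M)"
    by (intro nn_integral_cong nn_integral_cmult[symmetric]) measurable
  also have "\<dots> = (\<integral>\<^sup>+s. (\<integral>\<^sup>+x. h x * (F (\<Phi> s x) * indicator {a..b} s) \<partial>M) \<partial>lborel)"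
    by (rule Fubini'[of "\<lambda>s x. h x * (F (\<Phi> s x) * indicator {a..b} s)"]) measurable
  also have "\<dots> = (\<integral>\<^sup>+s. (\<integral>\<^sup>+x. h x * F x \<partial>M) * indicator {a..b} s \<partial>lborel)"
  proof (rule nn_integral_cong)
    fix s
    have "(\<integral>\<^sup>+x. h x * (F (\<Phi> s x) * indicator {a..b} s) \<partial>M)
        = (\<integral>\<^sup>+x. h (\<Phi> s x) * F (\<Phi> s x) * indicator {a..b} s \<partial>M)"
      by (rule nn_integral_cong_AE) (use inv[of s] in eventually_elim, simp add: mult.assoc)
    also have "\<dots> = (\<integral>\<^sup>+x. h (\<Phi> s x) * F (\<Phi> s x) \<partial>M) * indicator {a..b} s"
      by (rule nn_integral_multc) measurable
    also have "(\<integral>\<^sup>+x. h (\<Phi> s x) * F (\<Phi> s x) \<partial>M) = (\<integral>\<^sup>+x. h x * F x \<partial>M)"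
      by (rule nn_integral_flow[of "\<lambda>x. h x * F x"]) measurable
    finally show "(\<integral>\<^sup>+x. h x * (F (\<Phi> s x) * indicator {a..b} s) \<partial>M)
        = (\<integral>\<^sup>+x. h x * F x \<partial>M) * indicator {a..b} s" .
  qed
  also have "\<dots> = emeasure lborel {a..b} * (\<integral>\<^sup>+x. h x * F x \<partial>M)"
    by (subst nn_integral_cmult_indicator) (auto simp: mult.commute)
  finally show ?thesis .
qed

text \<open>\<open>S x t\<close> plays the role of the integral of \<open>r\<close> along the orbit of \<open>x\<close> from time \<open>0\<close> to \<open>t\<close>.\<close>

theorem flow_birkhoff:
  fixes r :: "'a \<Rightarrow> real" and S :: "'a \<Rightarrow> real \<Rightarrow> real"
  assumes r: "integrable M r" "\<And>x. 0 \<le> r x"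
    and S: "AE x in M. S x 0 = 0 \<and> strict_mono (S x) \<and> (\<forall>t. (S x has_real_derivative r (\<Phi> t x)) (at t))"
  obtains \<rho> where "\<rho> \<in> borel_measurable M"
    "AE x in M. 0 < \<rho> x \<and> (\<lambda>n. S x (real n) / real n) \<longlonglongrightarrow> \<rho> x"
    "\<And>h :: 'a \<Rightarrow> real. h \<in> borel_measurable M \<Longrightarrow> (\<And>x. 0 \<le> h x) \<Longrightarrow>
      (\<And>s. AE x in M. h (\<Phi> s x) = h x) \<Longrightarrow>
      (\<integral>\<^sup>+x. ennreal (h x) * ennreal (\<rho> x) \<partial>M) = (\<integral>\<^sup>+x. ennreal (h x) * ennreal (r x) \<partial>M)"
proof -
  have [measurable]: "r \<in> borel_measurable M" using r by auto
  interpret T: measure_preserving_map M "\<Phi> 1" by (rule measure_preserving_flow_map)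
  have [measurable]: "r \<in> borel_measurable borel"
    using \<open>r \<in> borel_measurable M\<close> by (simp cong: measurable_cong_sets[OF sets_M])
  have along [measurable]: "(\<lambda>s. r (\<Phi> s x)) \<in> borel_measurable borel" for x
  proof -
    have "(\<lambda>s. \<Phi> s x) \<in> borel \<rightarrow>\<^sub>M borel"
      by (rule borel_measurable_continuous_onI) (simp add: continuous_on_eq_continuous_at isCont_orbit)
    then show ?thesis by measurable
  qed
  have [measurable]: "(indicator {0..1} :: real \<Rightarrow> ennreal) \<in> borel_measurable borel" by simp
  \<comment> \<open>The integral of \<open>r\<close> over one unit of time. Defining it by an
    integral instead of \<open>S x 1\<close> makes it measurable in \<open>x\<close>; almost
    everywhere its Birkhoff sums under \<open>\<Phi> 1\<close> telescope to
    \<open>S x n\<close>.\<close>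
  let ?I = "\<lambda>x. \<integral>\<^sup>+s. ennreal (r (\<Phi> s x)) * indicator {0..1} s \<partial>lborel"
  define R where "R x = enn2real (?I x)" for x
  have [measurable]: "?I \<in> borel_measurable M" by measurable
  then have R_meas [measurable]: "R \<in> borel_measurable M" unfolding R_def by measurable
  have I: "?I (\<Phi> t x) = ennreal (S x (t + 1) - S x t)"
    if "\<forall>t. (S x has_real_derivative r (\<Phi> t x)) (at t)" for x t
  proof -
    have "((\<lambda>s. S x (s + t)) has_real_derivative r (\<Phi> s (\<Phi> t x))) (at s)" for s
    proof -
      have "(S x has_real_derivative r (\<Phi> (s + t) x)) (at (s + t))" using that by blast
      then have "((\<lambda>s. S x (s + t)) has_real_derivative r (\<Phi> (s + t) x) * 1) (at s)"
        by (rule DERIV_chain2) (auto intro!: derivative_eq_intros)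
      then show ?thesis by (simp add: flow_add)
    qed
    then have "?I (\<Phi> t x) = ennreal (S x (1 + t) - S x (0 + t))"
      by (intro nn_integral_FTC_Icc[OF along]) (auto intro: has_field_derivative_at_within simp: r(2))
    then show ?thesis by (simp add: add.commute)
  qed
  have sums: "birkhoff_sum (\<Phi> 1) R n x = S x (real n)"
    if "S x 0 = 0" "strict_mono (S x)" "\<forall>t. (S x has_real_derivative r (\<Phi> t x)) (at t)" for n x
  proof (induction n)
    case (Suc n)
    have "R ((\<Phi> 1 ^^ n) x) = S x (real n + 1) - S x (real n)"
      using I[OF that(3), of "real n"] strict_mono_less_eq[OF that(2)]
      by (simp add: R_def flow_power)
    with Suc show ?case by (simp add: birkhoff_sum_def add.commute)
  qed (simp add: that)
  have RI: "AE x in M. ennreal (R x) = ?I x"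
    using S
  proof eventually_elim
    case (elim x)
    then show ?case using I[of x 0] by (simp add: R_def)
  qed
  have RS: "AE x in M. 0 < R x"
    using S
  proof eventually_elim
    case (elim x)
    then have "0 < S x 1" using strict_monoD[of "S x" 0 1] by simp
    then show ?case using I[of x 0] elim by (simp add: R_def)
  qed
  have "(\<integral>\<^sup>+x. ennreal (R x) \<partial>M) = (\<integral>\<^sup>+x. 1 * ?I x \<partial>M)"
    by (rule nn_integral_cong_AE) (use RI in eventually_elim, simp)
  also have "\<dots> = emeasure lborel {0..1::real} * (\<integral>\<^sup>+x. 1 * ennreal (r x) \<partial>M)"
    by (rule nn_integral_time_integral) auto
  also have "\<dots> < \<infinity>" using r by (simp add: nn_integral_eq_integral)
  finally have "(\<integral>\<^sup>+x. ennreal (R x) \<partial>M) < \<infinity>" .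
  then have Rint: "integrable M R"
    by (intro integrableI_nonneg) (auto simp: R_def)
  have R0: "0 \<le> R x" for x by (simp add: R_def)
  define \<rho> where "\<rho> x = lim (\<lambda>n. birkhoff_sum (\<Phi> 1) R n x / real n)" for x
  have \<rho>_meas [measurable]: "\<rho> \<in> borel_measurable M"
    unfolding \<rho>_def by (rule borel_measurable_lim_metric) measurable
  have lim: "AE x in M. (\<lambda>n. birkhoff_sum (\<Phi> 1) R n x / real n) \<longlonglongrightarrow> \<rho> x"
    using T.birkhoff_convergent[OF Rint]
    by eventually_elim (simp add: \<rho>_def convergent_LIMSEQ_iff)
  have \<rho>0: "AE x in M. 0 \<le> \<rho> x"
    using lim
  proof eventually_elim
    case (elim x)
    then show ?case
      by (rule LIMSEQ_le_const) (auto intro!: birkhoff_sum_nonneg divide_nonneg_nonneg R0)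
  qed
  have \<rho>T: "AE x in M. \<rho> (\<Phi> 1 x) = \<rho> x"
    using lim T.AE_funpow[OF lim, of 1]
  proof eventually_elim
    case (elim x)
    \<comment> \<open>The sums at \<open>x\<close> and at \<open>\<Phi> 1 x\<close> differ by the
      term \<open>R x\<close> and by one index; the factor \<open>1 + 1 / n\<close> turns the
      denominator \<open>Suc n\<close> into \<open>n\<close>.\<close>
    have "(\<lambda>n. birkhoff_sum (\<Phi> 1) R (Suc n) x / real (Suc n) * (1 + 1 / real n) - R x / real n)
        \<longlonglongrightarrow> \<rho> x * (1 + 0) - 0"
      by (intro tendsto_diff tendsto_mult tendsto_add tendsto_const lim_const_over_n LIMSEQ_Suc elim(1))
    moreover have "\<forall>\<^sub>F n in sequentially.
        birkhoff_sum (\<Phi> 1) R (Suc n) x / real (Suc n) * (1 + 1 / real n) - R x / real n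
        = birkhoff_sum (\<Phi> 1) R n (\<Phi> 1 x) / real n"
      using eventually_gt_at_top[of 0]
    proof eventually_elim
      case (elim n)
      have "1 + 1 / real n = real (Suc n) / real n" using elim by (simp add: field_simps)
      then have "birkhoff_sum (\<Phi> 1) R (Suc n) x / real (Suc n) * (1 + 1 / real n)
          = birkhoff_sum (\<Phi> 1) R (Suc n) x / real n" by simp
      then show ?case by (simp add: birkhoff_sum_Suc add_divide_distrib)
    qed
    ultimately have "(\<lambda>n. birkhoff_sum (\<Phi> 1) R n (\<Phi> 1 x) / real n) \<longlonglongrightarrow> \<rho> x"
      by (simp add: tendsto_cong)
    with elim(2) show ?case by (simp add: LIMSEQ_unique)
  qed
  have pos: "AE x in M. 0 < \<rho> x"
  proof -
    \<comment> \<open>The set where \<open>\<rho> \<le> 0\<close> is invariant up to null sets.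
      Tested against its indicator, the integral of \<open>R\<close> vanishes although
      \<open>R\<close> is positive almost everywhere, so the set is null.\<close>
    let ?h = "\<lambda>x. if \<rho> x \<le> 0 then 1 else 0 :: real"
    have "(\<integral>\<^sup>+x. ennreal (?h x) * ennreal (\<rho> x) \<partial>M) = (\<integral>\<^sup>+x. ennreal (?h x) * ennreal (R x) \<partial>M)"
    proof (rule T.nn_integral_birkhoff_limit[OF Rint R0 _ _ _ \<rho>_meas lim])
      show "AE x in M. ?h (\<Phi> 1 x) = ?h x" using \<rho>T by eventually_elim simp
    qed auto
    moreover have "(\<lambda>x. ennreal (?h x) * ennreal (\<rho> x)) = (\<lambda>x. 0)"
      by (auto simp: ennreal_neg)
    ultimately have "(\<integral>\<^sup>+x. ennreal (?h x) * ennreal (R x) \<partial>M) = 0" by simp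
    then have "AE x in M. ennreal (?h x) * ennreal (R x) = 0"
      by (subst (asm) nn_integral_0_iff_AE) auto
    with RS show ?thesis
    proof eventually_elim
      case (elim x)
      then show ?case by (cases "\<rho> x \<le> 0") auto
    qed
  qed
  show ?thesis
  proof (rule that[OF \<rho>_meas])
    show "AE x in M. 0 < \<rho> x \<and> (\<lambda>n. S x (real n) / real n) \<longlonglongrightarrow> \<rho> x"
      using pos lim S by eventually_elim (simp add: sums)
    fix h :: "'a \<Rightarrow> real"
    assume [measurable]: "h \<in> borel_measurable M" and h: "\<And>x. 0 \<le> h x"
      and inv: "\<And>s. AE x in M. h (\<Phi> s x) = h x"
    have "(\<integral>\<^sup>+x. ennreal (h x) * ennreal (\<rho> x) \<partial>M) = (\<integral>\<^sup>+x. ennreal (h x) * ennreal (R x) \<partial>M)"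
      by (rule T.nn_integral_birkhoff_limit[OF Rint R0 _ h inv \<rho>_meas lim]) measurable
    \<comment> \<open>Invariance of \<open>h\<close> under all times, and not just under
      \<open>\<Phi> 1\<close>, lets \<open>R\<close> be replaced by \<open>r\<close>.\<close>
    also have "\<dots> = (\<integral>\<^sup>+x. ennreal (h x) * ?I x \<partial>M)"
      by (rule nn_integral_cong_AE) (use RI in eventually_elim, simp)
    also have "\<dots> = emeasure lborel {0..1::real} * (\<integral>\<^sup>+x. ennreal (h x) * ennreal (r x) \<partial>M)"
    proof (rule nn_integral_time_integral)
      show "AE x in M. ennreal (h (\<Phi> s x)) = ennreal (h x)" for s
        using inv[of s] by eventually_elim simp
    qed measurable
    also have "\<dots> = (\<integral>\<^sup>+x. ennreal (h x) * ennreal (r x) \<partial>M)" by simp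
    finally show "(\<integral>\<^sup>+x. ennreal (h x) * ennreal (\<rho> x) \<partial>M) = (\<integral>\<^sup>+x. ennreal (h x) * ennreal (r x) \<partial>M)" .
  qed
qed

lemma AE_slow_along_flow:
  fixes u :: "'a \<Rightarrow> real"
  assumes "u \<in> borel_measurable M"
  shows "AE x in M. \<forall>L. (\<lambda>n. u (\<Phi> (real n) x) / real n) \<longlonglongrightarrow> L \<longrightarrow> L = 0"
proof -
  interpret T: measure_preserving_map M "\<Phi> 1" by (rule measure_preserving_flow_map)
  show ?thesis using T.AE_slow_growth_limit_zero[OF assms] by (simp add: flow_power)
qed

end

section \<open>Integrals against completed measures\<close>

lemma borel_measurable_completion_iff:
  fixes v :: "'a \<Rightarrow> real"
  shows "v \<in> borel_measurable (completion M) \<longleftrightarrow> (\<exists>v'\<in>borel_measurable M. AE x in M. v x = v' x)"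
proof
  assume "v \<in> borel_measurable (completion M)"
  then show "\<exists>v'\<in>borel_measurable M. AE x in M. v x = v' x" by (rule completion_ex_borel_measurable_real)
next
  assume "\<exists>v'\<in>borel_measurable M. AE x in M. v x = v' x"
  then obtain v' where v': "v' \<in> borel_measurable M" "AE x in M. v x = v' x" by blast
  show "v \<in> borel_measurable (completion M)"
  proof (rule measurableI)
    fix B :: "real set" assume B: "B \<in> sets borel"
    have A: "v' -` B \<inter> space (completion M) \<in> sets (completion M)"
      by (rule measurable_sets[OF measurable_completion[OF v'(1)] B])
    have "AE x in completion M. x \<in> v' -` B \<inter> space (completion M) \<longleftrightarrow> x \<in> v -` B \<inter> space (completion M)"
      using AE_completion[OF v'(2)] by eventually_elim simp
    then show "v -` B \<inter> space (completion M) \<in> sets (completion M)"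
      by (rule completion.in_sets_AE[OF _ A]) simp
  qed simp
qed

lemma integral_completion_AE:
  fixes v :: "'a \<Rightarrow> real"
  assumes v': "v' \<in> borel_measurable M" and eq: "AE x in M. v x = v' x"
  shows "(\<integral>x. v x \<partial>completion M) = (\<integral>x. v' x \<partial>M)"
proof -
  have "v \<in> borel_measurable (completion M)"
    using borel_measurable_completion_iff v' eq by blast
  then have "(\<integral>x. v x \<partial>completion M) = (\<integral>x. v' x \<partial>completion M)"
    by (rule integral_cong_AE[OF _ measurable_completion[OF v'] AE_completion[OF eq]])
  then show ?thesis by (simp add: integral_completion[OF v'])
qed

text \<open>The Bochner integral takes its default value here. This covers exponents without a
  measurable version.\<close>

lemma integral_completion_not_measurable:
  fixes v :: "'a \<Rightarrow> real"
  assumes "\<not> (\<exists>v'\<in>borel_measurable M. AE x in M. v x = v' x)"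
  shows "(\<integral>x. v x \<partial>completion M) = 0"
  using assms borel_measurable_completion_iff[of v M] not_integrable_integral_eq by blast

text \<open>Comparing both parts also settles the case of a function that is not integrable: then
  neither of the two is, and both integrals have the default value \<open>0\<close>.\<close>

lemma integral_eq_by_parts:
  fixes u v :: "'a \<Rightarrow> real"
  assumes [measurable]: "u \<in> borel_measurable M" "v \<in> borel_measurable M"
    and p: "(\<integral>\<^sup>+x. ennreal (u x) \<partial>M) = (\<integral>\<^sup>+x. ennreal (v x) \<partial>M)"
    and n: "(\<integral>\<^sup>+x. ennreal (- u x) \<partial>M) = (\<integral>\<^sup>+x. ennreal (- v x) \<partial>M)"
  shows "(\<integral>x. u x \<partial>M) = (\<integral>x. v x \<partial>M)"
proof -
  have "integrable M u \<longleftrightarrow> integrable M v"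
    unfolding real_integrable_def using p n by simp
  then show ?thesis
    by (cases "integrable M u") (simp_all add: real_lebesgue_integral_def p n not_integrable_integral_eq)
qed

lemma (in measure_preserving_flow) integral_pos_AE:
  fixes r :: "'a \<Rightarrow> real"
  assumes r: "integrable M r" "AE x in M. 0 < r x"
  shows "0 < (\<integral>x. r x \<partial>M)"
proof -
  let ?I = "\<integral>x. r x \<partial>M"
  have "0 \<le> ?I" by (intro integral_nonneg_AE) (use r(2) in eventually_elim, simp)
  moreover have "?I \<noteq> 0"
  proof
    assume "?I = 0"
    moreover have "AE x in M. 0 \<le> r x" using r(2) by eventually_elim simp
    ultimately have "AE x in M. r x = 0" using integral_nonneg_eq_0_iff_AE[OF r(1)] by blast
    with r(2) have "AE x in M. False" by eventually_elim simp
    then show False by simp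
  qed
  ultimately show ?thesis by simp
qed

lemma (in measure_preserving_flow) AE_reparam_measure_iff:
  fixes r :: "'a \<Rightarrow> real"
  assumes r: "integrable M r" "AE x in M. 0 < r x"
  shows "(AE x in reparam_measure M r. P x) \<longleftrightarrow> (AE x in M. P x)"
proof -
  have [measurable]: "r \<in> borel_measurable M" using r by auto
  let ?I = "\<integral>x. r x \<partial>M"
  have I: "?I > 0" by (rule integral_pos_AE[OF r])
  have "(AE x in reparam_measure M r. P x) \<longleftrightarrow> (AE x in M. 0 < ennreal (r x / ?I) \<longrightarrow> P x)"
    unfolding reparam_measure_def by (rule AE_density) measurable
  also have "\<dots> \<longleftrightarrow> (AE x in M. P x)"
  proof
    assume "AE x in M. 0 < ennreal (r x / ?I) \<longrightarrow> P x"
    with r(2) show "AE x in M. P x" by eventually_elim (use I in simp)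
  qed (auto elim: eventually_mono)
  finally show ?thesis .
qed

context measure_preserving_flow
begin

text \<open>If \<open>v\<close> has a measurable version, the test identity for
  \<open>\<rho>\<close> and \<open>r\<close> is applied to its positive and its negative part, so no
  integrability has to be assumed. Otherwise \<open>u\<close> has no measurable version either,
  because \<open>v\<close> equals \<open>u / \<rho>\<close> almost everywhere, and both sides are
  \<open>0\<close>.\<close>

lemma mean_reparam:
  fixes r \<rho> u v :: "'a \<Rightarrow> real"
  assumes r: "integrable M r" "AE x in M. 0 < r x"
    and \<rho> [measurable]: "\<rho> \<in> borel_measurable M" and \<rho>_pos: "AE x in M. 0 < \<rho> x"
    and ident: "\<And>h :: 'a \<Rightarrow> real. h \<in> borel_measurable M \<Longrightarrow> (\<And>x. 0 \<le> h x) \<Longrightarrow>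
      (\<And>s. AE x in M. h (\<Phi> s x) = h x) \<Longrightarrow>
      (\<integral>\<^sup>+x. ennreal (h x) * ennreal (\<rho> x) \<partial>M) = (\<integral>\<^sup>+x. ennreal (h x) * ennreal (r x) \<partial>M)"
    and inv: "\<And>s. AE x in M. v (\<Phi> s x) = v x"
    and u: "AE x in M. u x = \<rho> x * v x"
  shows "(\<integral>x. v x \<partial>completion (reparam_measure M r)) * (\<integral>x. r x \<partial>M) = (\<integral>x. u x \<partial>completion M)"
proof -
  have [measurable]: "r \<in> borel_measurable M" using r by auto
  let ?I = "\<integral>x. r x \<partial>M" let ?N = "reparam_measure M r"
  have I: "?I > 0" by (rule integral_pos_AE[OF r])
  note AE_N = AE_reparam_measure_iff[OF r]
  have meas_N: "borel_measurable ?N = borel_measurable M"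
    by (rule measurable_cong_sets) (simp_all add: reparam_measure_def)
  show ?thesis
  proof (cases "\<exists>v'\<in>borel_measurable M. AE x in M. v x = v' x")
    case True
    then obtain v' where v' [measurable]: "v' \<in> borel_measurable M" and vv: "AE x in M. v x = v' x" by blast
    have inv': "AE x in M. v' (\<Phi> s x) = v' x" for s
      using inv[of s] vv measure_preserving_map.AE_funpow[OF measure_preserving_flow_map[of s] vv, of 1]
      by eventually_elim simp
    have "(\<integral>x. v x \<partial>completion ?N) = (\<integral>x. v' x \<partial>?N)"
      by (rule integral_completion_AE) (simp_all add: meas_N AE_N vv)
    also have "\<dots> = (\<integral>x. (r x / ?I) *\<^sub>R v' x \<partial>M)"
      unfolding reparam_measure_def
    proof (rule integral_density)
      show "AE x in M. 0 \<le> r x / ?I" using r(2) by eventually_elim (use I in simp)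
    qed measurable
    also have "\<dots> = (\<integral>x. r x * v' x \<partial>M) / ?I" by simp
    finally have 1: "(\<integral>x. v x \<partial>completion ?N) * ?I = (\<integral>x. r x * v' x \<partial>M)" using I by simp
    have 2: "(\<integral>x. u x \<partial>completion M) = (\<integral>x. \<rho> x * v' x \<partial>M)"
    proof (rule integral_completion_AE)
      show "AE x in M. u x = \<rho> x * v' x" using u vv by eventually_elim simp
    qed measurable
    \<comment> \<open>The values \<open>c = 1\<close> and \<open>c = - 1\<close> give the positive
      and the negative part.\<close>
    have part: "(\<integral>\<^sup>+x. ennreal (c * (r x * v' x)) \<partial>M) = (\<integral>\<^sup>+x. ennreal (c * (\<rho> x * v' x)) \<partial>M)" for c :: real
    proof -
      let ?h = "\<lambda>x. max 0 (c * v' x)"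
      have "ennreal (c * (a * b)) = ennreal (max 0 (c * b)) * ennreal a" if "0 < a" for a b :: real
      proof (cases "0 \<le> c * b")
        case True
        then have "ennreal (max 0 (c * b)) * ennreal a = ennreal ((c * b) * a)"
          using that by (simp add: ennreal_mult)
        then show ?thesis by (simp add: mult_ac)
      next
        case False
        then have "c * b < 0" by (simp only: not_le)
        then have "(c * b) * a < 0" by (rule mult_neg_pos[OF _ that])
        then have "c * (a * b) < 0" by (simp add: mult_ac)
        then show ?thesis using False by (simp add: ennreal_neg)
      qed
      note split = this
      have "(\<integral>\<^sup>+x. ennreal (c * (r x * v' x)) \<partial>M) = (\<integral>\<^sup>+x. ennreal (?h x) * ennreal (r x) \<partial>M)"
        by (rule nn_integral_cong_AE) (use r(2) in eventually_elim, rule split)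
      also have "\<dots> = (\<integral>\<^sup>+x. ennreal (?h x) * ennreal (\<rho> x) \<partial>M)"
      proof (rule ident[symmetric])
        show "AE x in M. ?h (\<Phi> s x) = ?h x" for s using inv'[of s] by eventually_elim simp
      qed auto
      also have "\<dots> = (\<integral>\<^sup>+x. ennreal (c * (\<rho> x * v' x)) \<partial>M)"
        by (rule nn_integral_cong_AE) (use \<rho>_pos in eventually_elim, rule split[symmetric])
      finally show ?thesis .
    qed
    have "(\<integral>x. r x * v' x \<partial>M) = (\<integral>x. \<rho> x * v' x \<partial>M)"
      by (rule integral_eq_by_parts) (use part[of 1] part[of "- 1"] in simp_all)
    with 1 2 show ?thesis by simp
  next
    case False
    have "\<not> (\<exists>v'\<in>borel_measurable ?N. AE x in ?N. v x = v' x)" using False by (simp add: meas_N AE_N)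
    then have 1: "(\<integral>x. v x \<partial>completion ?N) = 0" by (rule integral_completion_not_measurable)
    have "\<not> (\<exists>u'\<in>borel_measurable M. AE x in M. u x = u' x)"
    proof
      assume "\<exists>u'\<in>borel_measurable M. AE x in M. u x = u' x"
      then obtain u' where [measurable]: "u' \<in> borel_measurable M" and uu: "AE x in M. u x = u' x" by blast
      have "(\<lambda>x. u' x / \<rho> x) \<in> borel_measurable M" by measurable
      moreover have "AE x in M. v x = u' x / \<rho> x"
        using u uu \<rho>_pos by eventually_elim simp
      ultimately have "\<exists>v'\<in>borel_measurable M. AE x in M. v x = v' x"
        by (intro bexI[where x = "\<lambda>x. u' x / \<rho> x"])
      with False show False by (rule notE)
    qed
    then have "(\<integral>x. u x \<partial>completion M) = 0" by (rule integral_completion_not_measurable)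
    with 1 show ?thesis by simp
  qed
qed

end

section \<open>Invariance of the reparametrized measure\<close>

lemma (in reparameterized_flow) time_integral_le:
  fixes r :: "'a \<Rightarrow> real"
  assumes x: "x \<in> nonfixed \<Phi>" and B: "B \<in> sets borel" and "0 \<le> T"
    and r: "\<And>y. y \<in> nonfixed \<Phi> \<Longrightarrow> 0 < r y \<and>
      (\<exists>\<theta> D. time_change \<Phi> \<Psi> y \<theta> \<and> (\<theta> has_real_derivative D) (at 0) \<and> r y = inverse D)"
    and cont: "continuous_on UNIV (\<lambda>t. r (\<Phi> t x))"
  shows "(\<integral>\<^sup>+s. indicator B (\<Psi> \<sigma> (\<Phi> s x)) * ennreal (r (\<Phi> s x)) * indicator {0..T} s \<partial>lborel)
    \<le> (\<integral>\<^sup>+s. indicator B (\<Phi> s x) * ennreal (r (\<Phi> s x)) * indicator {0..T} s \<partial>lborel) + ennreal \<bar>\<sigma>\<bar>"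
proof -
  let ?L = "elapsed x T"
  have L: "0 \<le> ?L"
    using strict_mono_less_eq[OF elapsed_strict_mono[OF x], of 0 T] \<open>0 \<le> T\<close> by (simp add: elapsed_0[OF x])
  have [measurable]: "B \<in> sets borel" by (rule B)
  \<comment> \<open>Substituting \<open>w = elapsed x s\<close> absorbs the weight \<open>r\<close>
    and turns the integral into the time that a segment of the orbit under \<open>\<Psi>\<close>
    spends in \<open>B\<close>.\<close>
  have sub: "(\<integral>\<^sup>+s. indicator B (\<Psi> \<sigma> (\<Phi> s x)) * ennreal (r (\<Phi> s x)) * indicator {0..T} s \<partial>lborel)
      = (\<integral>\<^sup>+w. indicator B (\<Psi> (\<sigma> + w) x) * indicator {0..?L} w \<partial>lborel)" for \<sigma>
  proof -
    define F where "F w = (indicator B (\<Psi> (\<sigma> + w) x) :: real)" for w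
    have F [measurable]: "F \<in> borel_measurable borel" unfolding F_def by measurable
    have "(\<integral>\<^sup>+w. ennreal (F w * indicator {elapsed x 0..elapsed x T} w) \<partial>lborel)
        = (\<integral>\<^sup>+s. ennreal (F (elapsed x s) * r (\<Phi> s x) * indicator {0..T} s) \<partial>lborel)"
    proof (rule nn_integral_substitution)
      show "set_borel_measurable borel {elapsed x 0..elapsed x T} F"
        unfolding set_borel_measurable_def by measurable
      show "(elapsed x has_real_derivative r (\<Phi> s x)) (at s)" for s
        by (rule elapsed_derivative[OF x r])
      show "continuous_on {0..T} (\<lambda>s. r (\<Phi> s x))" by (rule continuous_on_subset[OF cont]) simp
      show "0 \<le> r (\<Phi> s x)" for s using r[of "\<Phi> s x"] x nonfixed_flow[of x s] by simp
    qed (rule \<open>0 \<le> T\<close>)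
    moreover have "ennreal (F w * indicator {elapsed x 0..elapsed x T} w)
        = indicator B (\<Psi> (\<sigma> + w) x) * indicator {0..?L} w" for w
      by (auto simp: F_def indicator_def elapsed_0[OF x])
    moreover have "ennreal (F (elapsed x s) * r (\<Phi> s x) * indicator {0..T} s)
        = indicator B (\<Psi> \<sigma> (\<Phi> s x)) * ennreal (r (\<Phi> s x)) * indicator {0..T} s" for s
      by (auto simp: F_def indicator_def rep.flow_add flow_elapsed[OF x])
    ultimately show ?thesis by simp
  qed
  let ?F = "\<lambda>w. indicator B (\<Psi> w x) * indicator {\<sigma>..\<sigma> + ?L} w :: ennreal"
  have [measurable]: "(indicator {a..b} :: real \<Rightarrow> ennreal) \<in> borel_measurable borel" for a b by simp
  have "(\<integral>\<^sup>+w. indicator B (\<Psi> (\<sigma> + w) x) * indicator {0..?L} w \<partial>lborel) = (\<integral>\<^sup>+w. ?F (\<sigma> + 1 * w) \<partial>lborel)"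
    by (rule nn_integral_cong) (auto simp: indicator_def)
  also have "\<dots> = (\<integral>\<^sup>+w. ?F w \<partial>lborel)"
    using nn_integral_real_affine[of ?F 1 \<sigma>] by simp
  \<comment> \<open>Shifting the interval of length \<open>?L\<close> by \<open>\<sigma>\<close>
    lets a piece of length at most \<open>\<bar>\<sigma>\<bar>\<close> stick out, at the left or at
    the right end according to the sign of \<open>\<sigma>\<close>. The interval added at the other
    end is empty or a single point.\<close>
  also have "\<dots> \<le> (\<integral>\<^sup>+w. indicator B (\<Psi> w x) * indicator {0..?L} w
      + (indicator {\<sigma>..0} w + indicator {?L..\<sigma> + ?L} w) \<partial>lborel)"
    by (rule nn_integral_mono) (auto simp: indicator_def)
  also have "\<dots> = (\<integral>\<^sup>+w. indicator B (\<Psi> w x) * indicator {0..?L} w \<partial>lborel)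
      + (\<integral>\<^sup>+w. indicator {\<sigma>..0} w + indicator {?L..\<sigma> + ?L} w \<partial>lborel)"
    by (rule nn_integral_add) measurable
  also have "(\<integral>\<^sup>+w. indicator {\<sigma>..0} w + indicator {?L..\<sigma> + ?L} w \<partial>lborel)
      = (\<integral>\<^sup>+w. indicator {\<sigma>..0} w \<partial>lborel) + (\<integral>\<^sup>+w. indicator {?L..\<sigma> + ?L} w \<partial>lborel)"
    by (rule nn_integral_add) measurable
  also have "\<dots> = emeasure lborel {\<sigma>..0} + emeasure lborel {?L..\<sigma> + ?L}"
    by simp
  also have "emeasure lborel {\<sigma>..0} + emeasure lborel {?L..\<sigma> + ?L} = ennreal \<bar>\<sigma>\<bar>"
    by (cases "\<sigma> \<le> 0"; cases "\<sigma> = 0") (auto simp: emeasure_lborel_Icc_eq)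
  finally show ?thesis using sub[of \<sigma>] sub[of 0] by simp
qed

text \<open>An orbit of a nonfixed point stays in the nonfixed set, where the class of
  \<open>r\<close> in a chart gives continuity even for \<open>l = 1\<close>.\<close>

lemma (in generated_reparameterization) continuous_r_orbit:
  assumes x: "x \<in> nonfixed \<Phi>" shows "continuous_on UNIV (\<lambda>t. r (\<Phi> t x))"
  unfolding continuous_on_eq_continuous_at[OF open_UNIV]
proof
  fix t
  let ?c = "chart_at A (\<Phi> t x)"
  let ?V = "{s. \<Phi> s x \<in> fst ?c}"
  have orbit: "continuous_on UNIV (\<lambda>s. \<Phi> s x)"
    by (simp add: continuous_on_eq_continuous_at isCont_orbit)
  have V: "open ?V" "t \<in> ?V"
    using continuous_open_preimage[OF orbit open_UNIV chart(1)[OF chart_at(1)]]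
    by (simp_all add: vimage_def chart_at(2))
  have "Ck_on (l - 1) (\<lambda>u. r (chart_inv ?c u)) (snd ?c ` (fst ?c \<inter> nonfixed \<Phi>))"
    using associated chart_at(1) by (simp add: associated_function_def)
  then have r: "continuous_on (snd ?c ` (fst ?c \<inter> nonfixed \<Phi>)) (\<lambda>u. r (chart_inv ?c u))"
    by (rule Ck_on_imp_continuous_on)
  have "continuous_on ?V (\<lambda>s. r (chart_inv ?c (snd ?c (\<Phi> s x))))"
  proof (rule continuous_on_compose2[OF r])
    show "continuous_on ?V (\<lambda>s. snd ?c (\<Phi> s x))"
      by (rule continuous_on_compose2[OF chart(3)[OF chart_at(1)] continuous_on_subset[OF orbit]]) auto
    show "(\<lambda>s. snd ?c (\<Phi> s x)) ` ?V \<subseteq> snd ?c ` (fst ?c \<inter> nonfixed \<Phi>)"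
      using x nonfixed_flow[of x] by auto
  qed
  then have "continuous_on ?V (\<lambda>s. r (\<Phi> s x))"
    by (rule continuous_on_eq) (simp add: chart(5)[OF chart_at(1)])
  then show "isCont (\<lambda>t. r (\<Phi> t x)) t"
    using V continuous_on_eq_continuous_at by blast
qed

locale invariant_reparameterization =
  generated_reparameterization A m l \<Phi> \<Psi> g f r + measure_preserving_flow \<Phi> M
  for A :: "('a::{t2_space,second_countable_topology}, 'n::finite) chart set" and m l :: nat
    and \<Phi> \<Psi> :: "real \<Rightarrow> 'a \<Rightarrow> 'a" and g f r M +
  assumes field_AE: "AE x in M. f x \<noteq> 0" and r_integrable: "integrable M r"
begin

lemma nonfixed_AE: "AE x in M. x \<in> nonfixed \<Phi>"
  using field_AE by eventually_elim (rule nonfixed_field)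

lemma r_pos_AE: "AE x in M. 0 < r x"
  using nonfixed_AE by eventually_elim (use r_nonfixed in blast)

lemma r_measurable [measurable]: "r \<in> borel_measurable M"
  using r_integrable by auto

lemma integral_r_pos: "0 < (\<integral>x. r x \<partial>M)"
  by (rule integral_pos_AE[OF r_integrable r_pos_AE])

lemma AE_reparam_measure: "(AE x in reparam_measure M r. P x) \<longleftrightarrow> (AE x in M. P x)"
  by (rule AE_reparam_measure_iff[OF r_integrable r_pos_AE])

lemma space_M: "space M = UNIV"
  using sets_eq_imp_space_eq[OF sets_M] by simp

text \<open>Integrating \<open>time_integral_le\<close> over the invariant measure gives
  \<open>T * a \<le> T * b + \<bar>\<sigma>\<bar>\<close> for every \<open>T \<ge> 0\<close>. The
  error does not grow with \<open>T\<close>, so \<open>a \<le> b\<close>.\<close>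

lemma weight_reparam_le:
  assumes B: "B \<in> sets borel"
  shows "(\<integral>\<^sup>+x. indicator B (\<Psi> \<sigma> x) * ennreal (r x) \<partial>M) \<le> (\<integral>\<^sup>+x. indicator B x * ennreal (r x) \<partial>M)"
proof -
  have [measurable]: "B \<in> sets borel" by (rule B)
  have \<Psi>_meas [measurable]: "\<Psi> \<sigma> \<in> borel_measurable M"
    using rep.measurable_flow by (simp cong: measurable_cong_sets[OF sets_M])
  define a where "a = (\<integral>\<^sup>+x. indicator B (\<Psi> \<sigma> x) * ennreal (r x) \<partial>M)"
  define b where "b = (\<integral>\<^sup>+x. indicator B x * ennreal (r x) \<partial>M)"
  have fin: "(\<integral>\<^sup>+x. ennreal (r x) \<partial>M) < \<infinity>"
    using r_integrable r_nonneg by (simp add: nn_integral_eq_integral)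
  have "a \<le> (\<integral>\<^sup>+x. ennreal (r x) \<partial>M)" "b \<le> (\<integral>\<^sup>+x. ennreal (r x) \<partial>M)"
    unfolding a_def b_def by (auto intro!: nn_integral_mono simp: indicator_def)
  then have fin: "a < \<infinity>" "b < \<infinity>" using fin by (auto intro: le_less_trans)
  have le: "ennreal T * a \<le> ennreal T * b + ennreal \<bar>\<sigma>\<bar>" if "0 \<le> T" for T
  proof -
    let ?J = "\<lambda>x. \<integral>\<^sup>+s. indicator B (\<Psi> \<sigma> (\<Phi> s x)) * ennreal (r (\<Phi> s x)) * indicator {0..T} s \<partial>lborel"
    let ?K = "\<lambda>x. \<integral>\<^sup>+s. indicator B (\<Phi> s x) * ennreal (r (\<Phi> s x)) * indicator {0..T} s \<partial>lborel"
    have [measurable]: "(indicator {0..T} :: real \<Rightarrow> ennreal) \<in> borel_measurable borel" by simp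
    have [measurable]: "r \<in> borel_measurable borel"
      using r_measurable by (simp cong: measurable_cong_sets[OF sets_M])
    have "ennreal T * a = emeasure lborel {0..T} * (\<integral>\<^sup>+x. 1 * (indicator B (\<Psi> \<sigma> x) * ennreal (r x)) \<partial>M)"
      using that by (simp add: a_def)
    also have "\<dots> = (\<integral>\<^sup>+x. 1 * ?J x \<partial>M)"
      by (rule nn_integral_time_integral[symmetric, of "\<lambda>x. indicator B (\<Psi> \<sigma> x) * ennreal (r x)" "\<lambda>_. 1"]) auto
    also have "\<dots> \<le> (\<integral>\<^sup>+x. 1 * ?K x + ennreal \<bar>\<sigma>\<bar> \<partial>M)"
    proof (rule nn_integral_mono_AE)
      show "AE x in M. 1 * ?J x \<le> 1 * ?K x + ennreal \<bar>\<sigma>\<bar>"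
        using nonfixed_AE
      proof eventually_elim
        case (elim x)
        then show ?case
          using time_integral_le[OF elim B that r_nonfixed continuous_r_orbit[OF elim], of \<sigma>] by simp
      qed
    qed
    also have "\<dots> = (\<integral>\<^sup>+x. 1 * ?K x \<partial>M) + ennreal \<bar>\<sigma>\<bar>"
      by (subst nn_integral_add) (auto simp: emeasure_space_1)
    also have "(\<integral>\<^sup>+x. 1 * ?K x \<partial>M) = emeasure lborel {0..T} * (\<integral>\<^sup>+x. 1 * (indicator B x * ennreal (r x)) \<partial>M)"
      by (rule nn_integral_time_integral[of "\<lambda>x. indicator B x * ennreal (r x)" "\<lambda>_. 1"]) auto
    also have "\<dots> = ennreal T * b" using that by (simp add: b_def)
    finally show ?thesis .
  qed
  obtain \<alpha> where \<alpha>: "0 \<le> \<alpha>" "a = ennreal \<alpha>" using fin(1) by (cases a) auto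
  obtain \<beta> where \<beta>: "0 \<le> \<beta>" "b = ennreal \<beta>" using fin(2) by (cases b) auto
  have "\<alpha> \<le> \<beta>"
  proof (rule ccontr)
    assume "\<not> \<alpha> \<le> \<beta>"
    then have d: "\<alpha> - \<beta> > 0" by simp
    \<comment> \<open>This choice makes \<open>T * (\<alpha> - \<beta>)\<close> exceed
      \<open>\<bar>\<sigma>\<bar>\<close> by one.\<close>
    define T where "T = (\<bar>\<sigma>\<bar> + 1) / (\<alpha> - \<beta>)"
    have T: "0 \<le> T" using d by (simp add: T_def)
    have "ennreal (T * \<alpha>) \<le> ennreal (T * \<beta> + \<bar>\<sigma>\<bar>)"
      using le[OF T] T \<alpha> \<beta> by (simp add: ennreal_mult ennreal_plus)
    then have "T * \<alpha> \<le> T * \<beta> + \<bar>\<sigma>\<bar>"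
      using T \<beta> by (subst (asm) ennreal_le_iff) auto
    moreover have "T * (\<alpha> - \<beta>) = \<bar>\<sigma>\<bar> + 1" using d by (simp add: T_def)
    ultimately show False by (simp add: algebra_simps)
  qed
  then show ?thesis using \<alpha> \<beta> by (simp add: a_def[symmetric] b_def[symmetric] ennreal_leI)
qed

text \<open>The one-sided estimate holds for every Borel set and every time. Applying it also to the
  preimage, with the time \<open>- \<sigma>\<close>, yields equality.\<close>

theorem reparam_measure_invariant: "reparam_measure M r \<in> invariant_measures \<Psi>"
proof -
  let ?N = "reparam_measure M r" let ?I = "\<integral>x. r x \<partial>M"
  have sets_N: "sets ?N = sets borel" by (simp add: reparam_measure_def sets_M)
  have space_N: "space ?N = UNIV" by (simp add: reparam_measure_def space_M)
  have em: "emeasure ?N B = ennreal (1 / ?I) * (\<integral>\<^sup>+x. indicator B x * ennreal (r x) \<partial>M)"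
    if "B \<in> sets borel" for B
  proof -
    have [measurable]: "B \<in> sets M" using that by (simp add: sets_M)
    have "emeasure ?N B = (\<integral>\<^sup>+x. ennreal (r x / ?I) * indicator B x \<partial>M)"
      unfolding reparam_measure_def by (rule emeasure_density) measurable
    also have "\<dots> = (\<integral>\<^sup>+x. ennreal (1 / ?I) * (indicator B x * ennreal (r x)) \<partial>M)"
    proof (rule nn_integral_cong)
      fix x
      have "ennreal (r x / ?I) = ennreal (1 / ?I) * ennreal (r x)"
        using integral_r_pos r_nonneg[of x] by (simp flip: ennreal_mult)
      then show "ennreal (r x / ?I) * indicator B x = ennreal (1 / ?I) * (indicator B x * ennreal (r x))"
        by (simp add: mult_ac)
    qed
    also have "\<dots> = ennreal (1 / ?I) * (\<integral>\<^sup>+x. indicator B x * ennreal (r x) \<partial>M)"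
      by (rule nn_integral_cmult) measurable
    finally show ?thesis .
  qed
  have "emeasure ?N (space ?N) = 1"
  proof -
    have "(\<integral>\<^sup>+x. ennreal (r x) \<partial>M) = ennreal ?I"
      by (rule nn_integral_eq_integral[OF r_integrable]) (simp add: r_nonneg)
    then show ?thesis
      using em[of UNIV] integral_r_pos by (simp add: space_N flip: ennreal_mult)
  qed
  then have "prob_space ?N" by (rule prob_spaceI)
  moreover have "distr ?N ?N (\<Psi> \<sigma>) = ?N" for \<sigma>
  proof (rule measure_eqI)
    fix B assume "B \<in> sets (distr ?N ?N (\<Psi> \<sigma>))"
    then have B: "B \<in> sets borel" by (simp add: sets_N)
    have pre: "\<Psi> \<sigma> -` C \<in> sets borel" if "C \<in> sets borel" for \<sigma> C
      using measurable_sets[OF rep.measurable_flow that] by simp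
    have le: "emeasure ?N (\<Psi> \<sigma> -` C) \<le> emeasure ?N C" if "C \<in> sets borel" for \<sigma> C
    proof -
      have "(\<integral>\<^sup>+x. indicator (\<Psi> \<sigma> -` C) x * ennreal (r x) \<partial>M) = (\<integral>\<^sup>+x. indicator C (\<Psi> \<sigma> x) * ennreal (r x) \<partial>M)"
        by (rule nn_integral_cong) (simp add: indicator_def)
      then show ?thesis
        unfolding em[OF that] em[OF pre[OF that]]
        using weight_reparam_le[OF that, of \<sigma>] by (simp add: mult_left_mono)
    qed
    have "\<Psi> (- \<sigma>) -` (\<Psi> \<sigma> -` B) = B" by (auto simp: vimage_def)
    then have "emeasure ?N B \<le> emeasure ?N (\<Psi> \<sigma> -` B)" using le[OF pre[OF B], of "- \<sigma>" \<sigma>] by simp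
    with le[OF B, of \<sigma>] have eq: "emeasure ?N (\<Psi> \<sigma> -` B) = emeasure ?N B" by (rule antisym)
    have "\<Psi> \<sigma> \<in> ?N \<rightarrow>\<^sub>M ?N"
      using rep.measurable_flow by (simp cong: measurable_cong_sets[OF sets_N sets_N])
    then show "emeasure (distr ?N ?N (\<Psi> \<sigma>)) B = emeasure ?N B"
      using B eq by (simp add: emeasure_distr sets_N space_N)
  qed simp
  ultimately show ?thesis by (simp add: invariant_measures_def sets_N)
qed

end

section \<open>Exponents at regular points and the transfer of hyperbolicity\<close>

lemma oseledets_splitting_at:
  "lyapunov_regular A g \<Phi> x \<Longrightarrow>
    oseledets_splitting A g \<Phi> x (fst (splitting_at A g \<Phi> x), oseledets_space A g \<Phi> x)"
  unfolding lyapunov_regular_def splitting_at_def oseledets_space_def by (simp add: someI_ex)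

abbreviation exponents_at ::
  "('a, 'n::finite) chart set \<Rightarrow> ('a \<Rightarrow> real^'n \<Rightarrow> real^'n \<Rightarrow> real) \<Rightarrow> (real \<Rightarrow> 'a \<Rightarrow> 'a) \<Rightarrow> 'a \<Rightarrow> real list" where
  "exponents_at A g \<Phi> x \<equiv> exponent_list (fst (splitting_at A g \<Phi> x)) (oseledets_space A g \<Phi> x)"

lemma lyap_exp_nth: "lyap_exp A g \<Phi> i x = exponents_at A g \<Phi> x ! (i - 1)"
  by (simp add: lyap_exp_def exponent_list_def)

lemma exponent_list_mem:
  assumes "finite \<Lambda>" "\<kappa> \<in> set (exponent_list \<Lambda> E)" shows "\<kappa> \<in> \<Lambda>"
  using assms(2) count_exponent_list[OF assms(1), of E \<kappa>] by (auto simp: count_eq_zero_iff[symmetric] split: if_splits)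

lemma finite_splitting_at: "lyapunov_regular A g \<Phi> x \<Longrightarrow> finite (fst (splitting_at A g \<Phi> x))"
  using oseledets_splitting_at[of A g \<Phi> x] by (simp add: oseledets_splitting_def)

lemma lyap_exp_mem:
  fixes A :: "('a, 'n::finite) chart set"
  assumes "lyapunov_regular A g \<Phi> x" "i \<in> {1..CARD('n)}"
  shows "lyap_exp A g \<Phi> i x \<in> fst (splitting_at A g \<Phi> x)"
  unfolding lyap_exp_nth
proof (rule exponent_list_mem[OF finite_splitting_at[OF assms(1)] nth_mem])
  show "i - 1 < length (exponents_at A g \<Phi> x)"
    using assms length_exponent_list[OF oseledets_splitting_at[OF assms(1)]] by auto
qed

lemma lyap_exp_scale:
  fixes A :: "('a, 'n::finite) chart set"
  assumes "lyapunov_regular A g \<Psi> x" "exponents_at A g \<Phi> x = map ((*) c) (exponents_at A g \<Psi> x)"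
    and i: "i \<in> {1..CARD('n)}"
  shows "lyap_exp A g \<Phi> i x = c * lyap_exp A g \<Psi> i x"
proof -
  have "length (exponents_at A g \<Psi> x) = CARD('n)"
    by (rule length_exponent_list[OF oseledets_splitting_at[OF assms(1)]])
  then have "i - 1 < length (exponents_at A g \<Psi> x)" using i by auto
  then show ?thesis unfolding lyap_exp_nth assms(2) by (rule nth_map)
qed

context invariant_reparameterization
begin

text \<open>The part of hyperbolicity on which the comparison of the exponents rests. The flow
  \<open>F\<close> is a parameter because \<open>\<Psi>\<close> has to inherit it from
  \<open>\<Phi>\<close>.\<close>

definition field_in_zero_space :: "(real \<Rightarrow> 'a \<Rightarrow> 'a) \<Rightarrow> 'a \<Rightarrow> bool" where
  "field_in_zero_space F x \<longleftrightarrow> lyapunov_regular A g F x \<and>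
     0 \<in> fst (splitting_at A g F x) \<and> f x \<in> oseledets_space A g F x 0"

lemma elapsed_AE: "AE x in M. elapsed x 0 = 0 \<and> strict_mono (elapsed x) \<and>
    (\<forall>t. (elapsed x has_real_derivative r (\<Phi> t x)) (at t))"
  using nonfixed_AE
proof eventually_elim
  case (elim x)
  then show ?case
    using elapsed_0[OF elim] elapsed_strict_mono[OF elim] elapsed_derivative[OF elim r_nonfixed] by blast
qed

text \<open>Time reversal makes the backward rate a forward one: \<open>- elapsed x (- t)\<close> is
  the integral of \<open>r\<close> along the reversed flow, to which \<open>flow_birkhoff\<close>
  applies.\<close>

lemma elapsed_backward_rate:
  "AE x in M. \<exists>\<rho>'>0. (\<lambda>n. elapsed x (- real n) / real n) \<longlonglongrightarrow> - \<rho>'"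
proof -
  interpret rev: measure_preserving_flow "\<lambda>t. \<Phi> (- t)" M by (rule reversed)
  have "AE x in M. - elapsed x (- 0) = 0 \<and> strict_mono (\<lambda>t. - elapsed x (- t)) \<and>
      (\<forall>t. ((\<lambda>t. - elapsed x (- t)) has_real_derivative r (\<Phi> (- t) x)) (at t))"
    using elapsed_AE
  proof eventually_elim
    case (elim x)
    have "((\<lambda>t. - elapsed x (- t)) has_real_derivative r (\<Phi> (- t) x)) (at t)" for t
    proof -
      have "(elapsed x has_real_derivative r (\<Phi> (- t) x)) (at (- t))" using elim by blast
      then have "((\<lambda>t. elapsed x (- t)) has_real_derivative r (\<Phi> (- t) x) * (- 1)) (at t)"
        by (rule DERIV_chain2) (auto intro!: derivative_eq_intros)
      from DERIV_minus[OF this] show ?thesis by simp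
    qed
    then show ?case using elim by (simp add: strict_mono_def)
  qed
  then obtain \<rho>' where "AE x in M. 0 < \<rho>' x \<and> (\<lambda>n. - elapsed x (- real n) / real n) \<longlonglongrightarrow> \<rho>' x"
    by (rule rev.flow_birkhoff[OF r_integrable r_nonneg, of "\<lambda>x t. - elapsed x (- t)"]) simp
  then show ?thesis
  proof eventually_elim
    case (elim x)
    then have "(\<lambda>n. - (- elapsed x (- real n) / real n)) \<longlonglongrightarrow> - \<rho>' x" by (intro tendsto_minus) simp
    then show ?case using elim by (intro exI[of _ "\<rho>' x"]) simp
  qed
qed

lemma slow_r_AE:
  "AE x in M. (\<forall>L. (\<lambda>n. ln (r (\<Phi> (real n) x)) / real n) \<longlonglongrightarrow> L \<longrightarrow> L = 0) \<and>
    (\<forall>L. (\<lambda>n. ln (r (\<Phi> (- real n) x)) / real n) \<longlonglongrightarrow> L \<longrightarrow> L = 0)"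
proof -
  interpret rev: measure_preserving_flow "\<lambda>t. \<Phi> (- t)" M by (rule reversed)
  have m: "(\<lambda>x. ln (r x)) \<in> borel_measurable M" by measurable
  from AE_slow_along_flow[OF m] rev.AE_slow_along_flow[OF m]
  show ?thesis by eventually_elim simp
qed

lemma reparam_splitting_AE:
  assumes zero: "AE x in M. field_in_zero_space \<Phi> x" and reg: "AE x in M. lyapunov_regular A g \<Psi> x"
    and \<rho>: "AE x in M. 0 < \<rho> x \<and> (\<lambda>n. elapsed x (real n) / real n) \<longlonglongrightarrow> \<rho> x"
  shows "AE x in M. field_in_zero_space \<Psi> x \<and>
    exponents_at A g \<Phi> x = map ((*) (\<rho> x)) (exponents_at A g \<Psi> x)"
  using zero reg \<rho> field_AE elapsed_backward_rate slow_r_AE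
proof eventually_elim
  case (elim x)
  obtain \<rho>' where \<rho>': "0 < \<rho>'" "(\<lambda>n. elapsed x (- real n) / real n) \<longlonglongrightarrow> - \<rho>'" using elim(5) by blast
  have os: "oseledets_splitting A g \<Phi> x (fst (splitting_at A g \<Phi> x), oseledets_space A g \<Phi> x)"
    "0 \<in> fst (splitting_at A g \<Phi> x)" "f x \<in> oseledets_space A g \<Phi> x 0"
    using elim(1) oseledets_splitting_at by (auto simp: field_in_zero_space_def)
  have os': "oseledets_splitting A g \<Psi> x (fst (splitting_at A g \<Psi> x), oseledets_space A g \<Psi> x)"
    by (rule oseledets_splitting_at[OF elim(2)])
  have \<rho>: "(\<lambda>n. elapsed x (real n) / real n) \<longlonglongrightarrow> \<rho> x" "0 < \<rho> x" using elim(3) by auto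
  have slow: "L = 0" if "(\<lambda>n. ln (r (\<Phi> (real n) x)) / real n) \<longlonglongrightarrow> L" for L
    using elim(6) that by blast
  have slow': "L = 0" if "(\<lambda>n. ln (r (\<Phi> (- real n) x)) / real n) \<longlonglongrightarrow> L" for L
    using elim(6) that by blast
  note z = reparam_zero_exponent[OF elim(4) os os' \<rho> \<rho>'(2,1) slow slow']
  then show ?case
    using elim(2) reparam_exponents[OF elim(4) os os' z \<rho>] by (simp add: field_in_zero_space_def)
qed

text \<open>\<open>\<Psi>\<close> reaches \<open>\<Phi> s x\<close> at the time
  \<open>elapsed x s\<close>, so invariance of the exponents along \<open>\<Psi>\<close> is
  invariance along \<open>\<Phi>\<close>. The latter is the form in which the test identity for the
  \<open>\<Phi>\<close>-invariant measure \<open>M\<close> uses it.\<close>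

lemma reparam_exponents_invariant_AE:
  assumes zero: "AE x in M. field_in_zero_space \<Psi> x"
  shows "AE x in M. exponents_at A g \<Psi> (\<Phi> s x) = exponents_at A g \<Psi> x"
  using zero measure_preserving_map.AE_funpow[OF measure_preserving_flow_map[of s] zero, of 1] field_AE
proof eventually_elim
  case (elim x)
  let ?y = "\<Phi> s x"
  have x: "x \<in> nonfixed \<Phi>" by (rule nonfixed_field[OF elim(3)])
  have y: "\<Psi> (elapsed x s) x = ?y" by (rule flow_elapsed[OF x])
  have t: "tangent_map A (\<Psi> (elapsed x s)) x (f x) = (r x / r ?y) *\<^sub>R f ?y"
    using tangent_reparam_field[OF x, of "elapsed x s"] by (simp add: y)
  have zy: "field_in_zero_space \<Psi> ?y" using elim(2) by simp
  have os': "oseledets_splitting A g \<Psi> (\<Psi> (elapsed x s) x) (fst (splitting_at A g \<Psi> ?y), oseledets_space A g \<Psi> ?y)"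
    using zy oseledets_splitting_at unfolding y by (auto simp: field_in_zero_space_def)
  have "subspace (oseledets_space A g \<Psi> ?y 0)"
    using os' zy by (simp add: oseledets_splitting_def field_in_zero_space_def)
  then have w: "(r x / r ?y) *\<^sub>R f ?y \<in> oseledets_space A g \<Psi> ?y 0"
    using zy by (simp add: field_in_zero_space_def subspace_scale)
  show ?case
    by (rule rep.exponents_flow_invariant[OF form elim(3) t _ _ _ os' _ w])
       (use elim(1) zy oseledets_splitting_at in \<open>auto simp: field_in_zero_space_def\<close>)
qed

theorem mean_exponents_reparam:
  assumes zero: "AE x in M. field_in_zero_space \<Phi> x" and reg: "AE x in M. lyapunov_regular A g \<Psi> x"
    and i: "i \<in> {1..CARD('n)}"
  shows "mean_lyap_exp A g \<Psi> i (reparam_measure M r) * (\<integral>x. r x \<partial>M) = mean_lyap_exp A g \<Phi> i M"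
proof -
  obtain \<rho> where \<rho>: "\<rho> \<in> borel_measurable M"
    "AE x in M. 0 < \<rho> x \<and> (\<lambda>n. elapsed x (real n) / real n) \<longlonglongrightarrow> \<rho> x"
    and ident: "\<And>h :: 'a \<Rightarrow> real. h \<in> borel_measurable M \<Longrightarrow> (\<And>x. 0 \<le> h x) \<Longrightarrow>
      (\<And>s. AE x in M. h (\<Phi> s x) = h x) \<Longrightarrow>
      (\<integral>\<^sup>+x. ennreal (h x) * ennreal (\<rho> x) \<partial>M) = (\<integral>\<^sup>+x. ennreal (h x) * ennreal (r x) \<partial>M)"
    by (fact flow_birkhoff[OF r_integrable r_nonneg elapsed_AE])
  have split: "AE x in M. field_in_zero_space \<Psi> x \<and>
      exponents_at A g \<Phi> x = map ((*) (\<rho> x)) (exponents_at A g \<Psi> x)"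
    by (rule reparam_splitting_AE[OF zero reg \<rho>(2)])
  then have zero': "AE x in M. field_in_zero_space \<Psi> x" by eventually_elim simp
  show ?thesis
    unfolding mean_lyap_exp_def
  proof (rule mean_reparam[OF r_integrable r_pos_AE \<rho>(1) _ ident])
    show "AE x in M. 0 < \<rho> x" using \<rho>(2) by eventually_elim simp
    show "AE x in M. lyap_exp A g \<Psi> i (\<Phi> s x) = lyap_exp A g \<Psi> i x" for s
      using reparam_exponents_invariant_AE[OF zero', of s] by eventually_elim (simp add: lyap_exp_nth)
    show "AE x in M. lyap_exp A g \<Phi> i x = \<rho> x * lyap_exp A g \<Psi> i x"
      using split reg by eventually_elim (rule lyap_exp_scale[OF _ conjunct2 i], assumption+)
  qed
qed

theorem hyperbolic_reparam:
  assumes hyp: "hyperbolic A g f \<Phi> M" and zero: "AE x in M. field_in_zero_space \<Phi> x"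
    and reg: "AE x in M. lyapunov_regular A g \<Psi> x"
  shows "hyperbolic A g (\<lambda>x. f x /\<^sub>R r x) \<Psi> (reparam_measure M r)"
proof -
  obtain \<rho> where \<rho>: "AE x in M. 0 < \<rho> x \<and> (\<lambda>n. elapsed x (real n) / real n) \<longlonglongrightarrow> \<rho> x"
    by (rule flow_birkhoff[OF r_integrable r_nonneg elapsed_AE]) (rule that)
  have split: "AE x in M. field_in_zero_space \<Psi> x \<and>
      exponents_at A g \<Phi> x = map ((*) (\<rho> x)) (exponents_at A g \<Psi> x)"
    by (rule reparam_splitting_AE[OF zero reg \<rho>])
  show ?thesis
    unfolding hyperbolic_def AE_reparam_measure
    using split \<rho> field_AE r_pos_AE hyp[unfolded hyperbolic_def]
  proof eventually_elim
    case (elim x)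
    have reg': "lyapunov_regular A g \<Psi> x" using elim(1) by (simp add: field_in_zero_space_def)
    have regx: "lyapunov_regular A g \<Phi> x" using elim(5) by blast
    obtain j where j: "j \<in> {1..CARD('n)}"
      "dim (oseledets_space A g \<Phi> x (lyap_exp A g \<Phi> j x)) = 1"
      "lyap_exp A g \<Phi> j x = 0" "\<forall>i\<in>{1..<j}. lyap_exp A g \<Phi> i x < 0"
      "\<forall>i\<in>{j<..CARD('n)}. lyap_exp A g \<Phi> i x > 0" using elim(5) by blast
    have scale: "lyap_exp A g \<Phi> i x = \<rho> x * lyap_exp A g \<Psi> i x" if "i \<in> {1..CARD('n)}" for i
      by (rule lyap_exp_scale[OF reg' conjunct2[OF elim(1)] that])
    have \<rho>x: "0 < \<rho> x" using elim(2) by simp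
    have zero_j: "lyap_exp A g \<Psi> j x = 0" using scale[OF j(1)] j(3) \<rho>x by simp
    have mem: "0 \<in> fst (splitting_at A g \<Phi> x)" "0 \<in> fst (splitting_at A g \<Psi> x)"
      using lyap_exp_mem[OF regx j(1)] j(3) elim(1) by (simp_all add: field_in_zero_space_def)
    \<comment> \<open>The multiplicity of \<open>0\<close> in the exponent list is the dimension of
      the zero space, and multiplication by \<open>\<rho> x > 0\<close> neither creates nor removes
      zeros.\<close>
    have "dim (oseledets_space A g \<Psi> x 0) = count (mset (exponents_at A g \<Psi> x)) 0"
      using count_exponent_list[OF finite_splitting_at[OF reg'], of "oseledets_space A g \<Psi> x" 0] mem(2) by simp
    also have "\<dots> = count (mset (map ((*) (\<rho> x)) (exponents_at A g \<Psi> x))) 0"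
    proof -
      have "count (mset (map ((*) c) xs)) 0 = count (mset xs) 0" if "c \<noteq> 0" for c :: real and xs
        using that by (induction xs) auto
      then show ?thesis using \<rho>x by simp
    qed
    also have "\<dots> = count (mset (exponents_at A g \<Phi> x)) 0" using elim(1) by simp
    also have "\<dots> = dim (oseledets_space A g \<Phi> x 0)"
      using count_exponent_list[OF finite_splitting_at[OF regx], of "oseledets_space A g \<Phi> x" 0] mem(1) by simp
    finally have dim1: "dim (oseledets_space A g \<Psi> x 0) = 1" using j(2,3) by simp
    have os': "oseledets_splitting A g \<Psi> x (fst (splitting_at A g \<Psi> x), oseledets_space A g \<Psi> x)"
      by (rule oseledets_splitting_at[OF reg'])
    have sub: "subspace (oseledets_space A g \<Psi> x 0)"
      using os' mem(2) by (simp add: oseledets_splitting_def)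
    have fin: "f x /\<^sub>R r x \<in> oseledets_space A g \<Psi> x 0"
      using elim(1) sub by (simp add: field_in_zero_space_def subspace_scale)
    have ne: "f x /\<^sub>R r x \<noteq> 0" using elim(3,4) by simp
    have "span {f x /\<^sub>R r x} = oseledets_space A g \<Psi> x 0"
    proof (rule subspace_dim_equal)
      show "span {f x /\<^sub>R r x} \<subseteq> oseledets_space A g \<Psi> x 0"
        using fin sub by (intro span_minimal) auto
      show "dim (oseledets_space A g \<Psi> x 0) \<le> dim (span {f x /\<^sub>R r x})"
        using dim1 ne by (simp add: dim_insert)
    qed (use sub in auto)
    then have "oseledets_space A g \<Psi> x (lyap_exp A g \<Psi> j x) = span {f x /\<^sub>R r x}"
      "dim (oseledets_space A g \<Psi> x (lyap_exp A g \<Psi> j x)) = 1"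
      using dim1 by (simp_all add: zero_j)
    moreover have "\<forall>i\<in>{1..<j}. lyap_exp A g \<Psi> i x < 0"
    proof
      fix i assume i: "i \<in> {1..<j}"
      then have i': "i \<in> {1..CARD('n)}" using j(1) by auto
      from bspec[OF j(4) i] have "\<rho> x * lyap_exp A g \<Psi> i x < 0" by (simp only: scale[OF i'])
      then show "lyap_exp A g \<Psi> i x < 0" using \<rho>x by (simp add: mult_less_0_iff)
    qed
    moreover have "\<forall>i\<in>{j<..CARD('n)}. lyap_exp A g \<Psi> i x > 0"
    proof
      fix i assume i: "i \<in> {j<..CARD('n)}"
      then have i': "i \<in> {1..CARD('n)}" using j(1) by auto
      from bspec[OF j(5) i] have "0 < \<rho> x * lyap_exp A g \<Psi> i x" by (simp only: scale[OF i'])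
      then show "0 < lyap_exp A g \<Psi> i x" using \<rho>x by (simp add: zero_less_mult_iff)
    qed
    ultimately show ?case using reg' j(1) zero_j by blast
  qed
qed

end

theorem corollary1:
  fixes A :: "('a::{t2_space,second_countable_topology}, 'n::finite) chart set"
    and g :: "'a \<Rightarrow> real^'n \<Rightarrow> real^'n \<Rightarrow> real"
    and f :: "'a \<Rightarrow> real^'n"
    and \<Phi> \<Phi>\<^sub>r :: "real \<Rightarrow> 'a \<Rightarrow> 'a"
    and r :: "'a \<Rightarrow> real"
    and \<mu> :: "'a measure"
    and m l :: nat
  assumes "2 \<le> m" and "1 \<le> l" and "l < m"
    and "Ck_manifold m A"
    and "Ck_riemannian_metric A (m - 1) g"
    and "Ck_vector_field A l f"
    and "Ck_flow A l \<Phi>" and "generates A f \<Phi>"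
    and "Ck_flow A l \<Phi>\<^sub>r"
    and "time_reparameterization \<Phi> \<Phi>\<^sub>r"
    and "associated_function A l \<Phi> \<Phi>\<^sub>r r"
    and "\<forall>\<nu>\<in>invariant_measures \<Phi>. AE x in \<nu>. lyapunov_regular A g \<Phi> x"
    and "\<forall>\<nu>\<in>invariant_measures \<Phi>\<^sub>r. AE x in \<nu>. lyapunov_regular A g \<Phi>\<^sub>r x"
    and "\<mu> \<in> invariant_measures \<Phi>"
    and "hyperbolic A g f \<Phi> \<mu>"
    and "integrable \<mu> r"
  shows "reparam_measure \<mu> r \<in> invariant_measures \<Phi>\<^sub>r \<and>
    (\<forall>i\<in>{1..CARD('n)}.
       mean_lyap_exp A g \<Phi>\<^sub>r i (reparam_measure \<mu> r) * (\<integral>x. r x \<partial>\<mu>) = mean_lyap_exp A g \<Phi> i \<mu>) \<and>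
    ((AE x in \<mu>. r x > 0) \<longrightarrow>
       hyperbolic A g (\<lambda>x. f x /\<^sub>R r x) \<Phi>\<^sub>r (reparam_measure \<mu> r))"
proof -
  have zero: "AE x in \<mu>. lyapunov_regular A g \<Phi> x \<and> 0 \<in> fst (splitting_at A g \<Phi> x) \<and>
      f x \<in> oseledets_space A g \<Phi> x 0 \<and> f x \<noteq> 0"
    using \<open>hyperbolic A g f \<Phi> \<mu>\<close>[unfolded hyperbolic_def]
  proof eventually_elim
    case (elim x)
    then obtain j where j: "j \<in> {1..CARD('n)}"
      "dim (oseledets_space A g \<Phi> x (lyap_exp A g \<Phi> j x)) = 1"
      "oseledets_space A g \<Phi> x (lyap_exp A g \<Phi> j x) = span {f x}" "lyap_exp A g \<Phi> j x = 0" by blast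
    \<comment> \<open>Otherwise \<open>span {f x}\<close> would have dimension \<open>0\<close>
      instead of \<open>1\<close>.\<close>
    have "f x \<noteq> 0"
    proof
      assume "f x = 0"
      with j(2,3) show False by (simp add: dim_insert)
    qed
    moreover have "f x \<in> oseledets_space A g \<Phi> x 0" using j(3,4) by (simp add: span_base)
    moreover have "0 \<in> fst (splitting_at A g \<Phi> x)" using lyap_exp_mem[of A g \<Phi> x j] elim j(1,4) by simp
    ultimately show ?case using elim by blast
  qed
  interpret generated_reparameterization A m l \<Phi> \<Phi>\<^sub>r g f r
  proof unfold_locales
    show "inner_form (g x)" for x
      by (rule inner_form_riemannian_metric) (rule \<open>Ck_riemannian_metric A (m - 1) g\<close>)
  qed fact+
  interpret prob_space \<mu> using \<open>\<mu> \<in> invariant_measures \<Phi>\<close> by (simp add: invariant_measures_def)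
  interpret invariant_reparameterization A m l \<Phi> \<Phi>\<^sub>r g f r \<mu>
  proof unfold_locales
    show "sets \<mu> = sets borel" "distr \<mu> \<mu> (\<Phi> t) = \<mu>" for t
      using \<open>\<mu> \<in> invariant_measures \<Phi>\<close> by (auto simp: invariant_measures_def)
    show "AE x in \<mu>. f x \<noteq> 0" using zero by eventually_elim simp
  qed fact
  have zero': "AE x in \<mu>. field_in_zero_space \<Phi> x"
    using zero by eventually_elim (simp add: field_in_zero_space_def)
  \<comment> \<open>Regularity for the second flow is given for its own invariant measures. It
    reaches \<open>\<mu>\<close> because \<open>\<mu>\<close> and
    \<open>reparam_measure \<mu> r\<close> have the same null sets.\<close>
  have reg: "AE x in \<mu>. lyapunov_regular A g \<Phi>\<^sub>r x"
    using \<open>\<forall>\<nu>\<in>invariant_measures \<Phi>\<^sub>r. AE x in \<nu>. lyapunov_regular A g \<Phi>\<^sub>r x\<close> reparam_measure_invariant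
    unfolding AE_reparam_measure[symmetric] by blast
  show ?thesis
    using reparam_measure_invariant mean_exponents_reparam[OF zero' reg]
      hyperbolic_reparam[OF \<open>hyperbolic A g f \<Phi> \<mu>\<close> zero' reg] by simp
qed

end
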